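(* Let $p=(a,b,c)\in P$ and let $F_p$ be the Rössler vector field $\dot x=-y-z,\ \dot y=x+ay,\ \dot z=bx+z(x-c)$ on $\mathbb{R}^3$. Then both the one-dimensional stable manifold $W^s_{In}$ of $P_{In}=(0,0,0)$ and the one-dimensional unstable manifold $W^u_{Out}$ of $P_{Out}=(c-ab,\,b-\tfrac{c}{a},\,\tfrac{c}{a}-b)$ have an unbounded component (i.e. a component whose closure in $S^3=\mathbb{R}^3\cup\{\infty\}$ contains $\infty$). Additionally, for every sufficiently large $r>0$ there exists a smooth vector field $R_p$ on $S^3$ such that: (i) $R_p$ coincides with $F_p$ on the open ball $B_r(P_{In})$; (ii) $R_p$ has precisely two fixed points in $S^3$, namely $P_{In}$ and $P_{Out}$; (iii) $R_p$ has a heteroclinic trajectory connecting $P_{In}$ and $P_{Out}$ which passes through $\infty$.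
   Context: For $p=(a,b,c)\in\mathbb{R}^3$, $F_p$ denotes the vector field above. $P\subseteq\mathbb{R}^3$ is an open set of parameters such that for every $p=(a,b,c)\in P$: (1) $a,b\in(0,1)$ and $c>1$; (2) $F_p$ has precisely two fixed points in $\mathbb{R}^3$, $P_{In}=(0,0,0)$ and $P_{Out}=(c-ab,b-\frac{c}{a},\frac{c}{a}-b)$, both saddle-foci; (3) the Jacobian at $P_{In}$ has one negative real eigenvalue $\gamma_{In}$ and a complex-conjugate pair $\rho_{In}\pm i\omega_{In}$ with $\rho_{In}>0$ (so $P_{In}$ has a one-dimensional stable manifold $W^s_{In}$ and two-dimensional unstable manifold $W^u_{In}$), and the Jacobian at $P_{Out}$ has one positive real eigenvalue $\gamma_{Out}$ and a complex-conjugate pair $\rho_{Out}\pm i\omega_{Out}$ with $\rho_{Out}<0$ (so $P_{Out}$ has a one-dimensional unstable manifold $W^u_{Out}$ and two-dimensional stable manifold $W^s_{Out}$); (4) with saddle indices $\nu_{In}=|\rho_{In}/\gamma_{In}|$, $\nu_{Out}=|\rho_{Out}/\gamma_{Out}|$, at least one of $\nu_{In}<1$, $\nu_{Out}<1$ holds. *)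

theory Defs
  imports "HOL-Analysis.Analysis"
begin

definition roessler :: "real \<times> real \<times> real \<Rightarrow> real^3 \<Rightarrow> real^3" where
  "roessler p v = (case p of (a, b, c) \<Rightarrow>
     vector [ - (v$2) - v$3, v$1 + a * v$2, b * v$1 + v$3 * (v$1 - c)])"

definition P_In :: "real^3" where
  "P_In = vector [0, 0, 0]"

definition P_Out :: "real \<times> real \<times> real \<Rightarrow> real^3" where
  "P_Out p = (case p of (a, b, c) \<Rightarrow> vector [c - a * b, b - c / a, c / a - b])"

definition complexify :: "real^'n^'n \<Rightarrow> complex^'n^'n" where
  "complexify A = (\<chi> i j. complex_of_real (A $ i $ j))"

definition cplx_eigenvalues :: "real^'n^'n \<Rightarrow> complex set" where
  "cplx_eigenvalues A = {l. det (mat l - complexify A) = 0}"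

definition spectrum_data :: "real^'n^'n \<Rightarrow> real \<Rightarrow> real \<Rightarrow> real \<Rightarrow> bool" where
  "spectrum_data A \<gamma> \<rho> \<omega> \<longleftrightarrow> \<omega> \<noteq> 0 \<and>
     cplx_eigenvalues A = {complex_of_real \<gamma>, Complex \<rho> \<omega>, Complex \<rho> (- \<omega>)}"

definition good_param :: "real \<times> real \<times> real \<Rightarrow> bool" where
  "good_param p \<longleftrightarrow> (case p of (a, b, c) \<Rightarrow>
     0 < a \<and> a < 1 \<and> 0 < b \<and> b < 1 \<and> 1 < c \<and>
     {v. roessler p v = 0} = {P_In, P_Out p} \<and> P_In \<noteq> P_Out p \<and>
     (\<exists>\<gamma>i \<rho>i \<omega>i \<gamma>o \<rho>o \<omega>o.
        spectrum_data (jacobian (roessler p) (at P_In)) \<gamma>i \<rho>i \<omega>i \<and> \<gamma>i < 0 \<and> 0 < \<rho>i \<and>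
        spectrum_data (jacobian (roessler p) (at (P_Out p))) \<gamma>o \<rho>o \<omega>o \<and> 0 < \<gamma>o \<and> \<rho>o < 0 \<and>
        (\<bar>\<rho>i / \<gamma>i\<bar> < 1 \<or> \<bar>\<rho>o / \<gamma>o\<bar> < 1)))"

definition stable_set :: "(real^'n \<Rightarrow> real^'n) \<Rightarrow> real^'n \<Rightarrow> (real^'n) set" where
  "stable_set f P = {x0. \<exists>x :: real \<Rightarrow> real^'n. x 0 = x0 \<and>
      (\<forall>t\<ge>0. (x has_vector_derivative f (x t)) (at t within {0..})) \<and>
      (x \<longlongrightarrow> P) at_top}"

definition unstable_set :: "(real^'n \<Rightarrow> real^'n) \<Rightarrow> real^'n \<Rightarrow> (real^'n) set" where
  "unstable_set f P = {x0. \<exists>x :: real \<Rightarrow> real^'n. x 0 = x0 \<and>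
      (\<forall>t\<le>0. (x has_vector_derivative f (x t)) (at t within {..0})) \<and>
      (x \<longlongrightarrow> P) at_bot}"

definition pderiv_at :: "'n \<Rightarrow> (real^'n \<Rightarrow> real) \<Rightarrow> real^'n \<Rightarrow> real" where
  "pderiv_at i g x = deriv (\<lambda>t. g (x + t *\<^sub>R axis i 1)) 0"

fun iter_pderiv :: "'n list \<Rightarrow> (real^'n \<Rightarrow> real) \<Rightarrow> real^'n \<Rightarrow> real" where
  "iter_pderiv [] g = g"
| "iter_pderiv (i # is) g = pderiv_at i (iter_pderiv is g)"

definition smooth_real :: "(real^'n \<Rightarrow> real) \<Rightarrow> bool" where
  "smooth_real g \<longleftrightarrow> (\<forall>is. continuous_on UNIV (iter_pderiv is g) \<and>
      (\<forall>i x. (\<lambda>t. iter_pderiv is g (x + t *\<^sub>R axis i 1)) differentiable (at 0)))"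

definition smooth_map :: "(real^'n \<Rightarrow> real^'m) \<Rightarrow> bool" where
  "smooth_map f \<longleftrightarrow> (\<forall>k. smooth_real (\<lambda>x. f x $ k))"

text \<open>S^3 is the unit sphere of R^4; R^3 is identified with S^3 minus the north
  pole via inverse stereographic projection, the north pole playing the role of
  the point at infinity.\<close>

definition north :: "real^4" where
  "north = vector [0, 0, 0, 1]"

definition stereo_inv :: "real^3 \<Rightarrow> real^4" where
  "stereo_inv x = (let s = (norm x)\<^sup>2 in
     vector [2 * x$1 / (s + 1), 2 * x$2 / (s + 1), 2 * x$3 / (s + 1), (s - 1) / (s + 1)])"

text \<open>Smooth vector fields on S^3: restrictions to the sphere of smooth maps
  R^4 -> R^4 that are tangent to the sphere (every smooth vector field on S^3
  arises this way).\<close>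

definition smooth_vf_S3 :: "(real^4 \<Rightarrow> real^4) \<Rightarrow> bool" where
  "smooth_vf_S3 V \<longleftrightarrow> smooth_map V \<and> (\<forall>q\<in>sphere 0 1. V q \<bullet> q = 0)"

definition trajectory_S3 :: "(real^4 \<Rightarrow> real^4) \<Rightarrow> (real \<Rightarrow> real^4) \<Rightarrow> bool" where
  "trajectory_S3 V \<gamma> \<longleftrightarrow> (\<forall>t. \<gamma> t \<in> sphere 0 1 \<and> (\<gamma> has_vector_derivative V (\<gamma> t)) (at t))"

end

theory Submission
  imports Defs "HOL-Computational_Algebra.Polynomial"
begin

text \<open>With \<open>u = z + b\<close> and \<open>s = b - y\<close> the system becomes \<open>s' = a s - a b - x\<close>, \<open>x' = s - u\<close>,
  \<open>u' = u (x - c) + b c\<close>. The one-dimensional manifold of a fixed point with real eigenvalue \<open>\<mu>\<close>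
  is a power series in \<open>exp (\<mu> t)\<close> obtained from a quadratic recursion. At \<open>P_In\<close> all coefficients
  of one branch have the same sign, so the branch can only end by becoming infinite. At \<open>P_Out\<close> one branch is
  driven out of every bounded set by a function that grows exponentially along the flow, and this
  persists when a nonnegative multiple of the upward field is added.

  Outside a bounded segment the Roessler field never points straight down. Hence outside a large
  ball it can be blended with an upward field without creating zeros; both branches leave the ball
  under the blended field. From there a shear brings them to the third axis, which a nowhere
  vanishing rotation of \<open>S^3\<close> carries through infinity.\<close>

section \<open>Ordinary differential equations\<close>

text \<open>A local invariant manifold theorem would not tell where the two branches go. The power
  series does both: it produces the curve, and the signs of its coefficients (at
  \<open>P_In\<close>) or its first-order term (at \<open>P_Out\<close>) place it in a region whose
  later fate can be followed. In the extension, the exit points \<open>U\<close> and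
  \<open>D\<close> depend on the blended field, while the shear is built from \<open>U\<close> and
  \<open>D\<close>. This is not circular because the shear acts only at heights
  \<open>\<bar>z\<bar> > R + 3\<close>, away from the ball of radius \<open>R + 1\<close> in which
  the exit points are found. The upward field carries the factor \<open>1 + z\<^sup>2\<close>
  because that is the rotating field on the third axis, so high parts of the axis stay orbits
  throughout the transition between the two fields. The ball is centred at height -2 so that the
  vertical half-lines leaving it at the exit points do not re-enter. The rotation speed is fixed
  last, when all other sizes are known. Smoothness is required on all of R^4, so every cut-off is
  given there by an explicit formula.\<close>

lemma continuous_indefinite_integral:
  fixes g :: "real \<Rightarrow> 'a::euclidean_space"
  assumes "continuous_on UNIV g"
  shows "\<And>t. t \<ge> 0 \<Longrightarrow> ((\<lambda>t. integral {0..t} g) has_vector_derivative g t) (at t within {0..})"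
    and "continuous_on UNIV (\<lambda>t. integral {0..max 0 t} g)"
proof -
  show d: "((\<lambda>t. integral {0..t} g) has_vector_derivative g t) (at t within {0..})" if "t \<ge> 0" for t
  proof -
    have "((\<lambda>t. integral {0..t} g) has_vector_derivative g t) (at t within {0..t+1})"
      using that by (intro integral_has_vector_derivative continuous_on_subset[OF assms]) auto
    moreover have "at t within {0..t+1} = at t within {0..}"
      using that by (intro at_within_nhd[of _ "{t-1<..<t+1}"]) auto
    ultimately show ?thesis by simp
  qed
  have "continuous_on {0..} (\<lambda>t. integral {0..t} g)"
    using d by (meson atLeast_iff continuous_on_eq_continuous_within has_vector_derivative_continuous)
  then have "continuous_on UNIV ((\<lambda>t. integral {0..t} g) \<circ> (\<lambda>t. max 0 t))"
    by (intro continuous_on_compose continuous_intros) (auto elim: continuous_on_subset)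
  then show "continuous_on UNIV (\<lambda>t. integral {0..max 0 t} g)"
    by (simp add: o_def)
qed

text \<open>Integrating \<open>C * exp (K * s)\<close> gains the factor \<open>1 / K\<close>,
  uniformly in \<open>t\<close>. The same estimate yields boundedness and contraction of the
  weighted Picard operator.\<close>

lemma norm_integral_exp_bound:
  fixes g :: "real \<Rightarrow> 'a::euclidean_space"
  assumes "continuous_on UNIV g" "t \<ge> 0" "K > 0" "\<And>s. s \<in> {0..t} \<Longrightarrow> norm (g s) \<le> C * exp (K * s)" "C \<ge> 0"
  shows "exp (- K * t) * norm (integral {0..t} g) \<le> C / K"
proof -
  have hi: "((\<lambda>s. C * exp (K * s)) has_integral (C / K * exp (K * t) - C / K * exp (K * 0))) {0..t}"
  proof (rule fundamental_theorem_of_calculus)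
    fix x
    have "((\<lambda>s. C / K * exp (K * s)) has_vector_derivative (C / K * (exp (K * x) * K))) (at x within {0..t})"
      unfolding has_real_derivative_iff_has_vector_derivative[symmetric]
      by (auto intro!: derivative_eq_intros)
    then show "((\<lambda>s. C / K * exp (K * s)) has_vector_derivative C * exp (K * x)) (at x within {0..t})"
      using assms by simp
  qed (use assms in auto)
  have "norm (integral {0..t} g) \<le> integral {0..t} (\<lambda>s. C * exp (K * s))"
    using assms hi continuous_on_subset[OF assms(1)]
    by (intro integral_norm_bound_integral integrable_continuous_real continuous_intros) auto
  also have "\<dots> = C / K * exp (K * t) - C / K * exp (K * 0)"
    using hi by (rule integral_unique)
  also have "\<dots> \<le> C / K * exp (K * t)" using assms by simp
  finally have "exp (- K * t) * norm (integral {0..t} g) \<le> exp (- K * t) * (C / K * exp (K * t))"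
    by (intro mult_left_mono) auto
  also have "\<dots> = C / K" by (simp add: exp_minus)
  finally show ?thesis .
qed

text \<open>The weight \<open>exp (- 2 L t)\<close> makes the Picard operator a contraction on the whole half line.\<close>

lemma global_solution_bounded_lipschitz:
  fixes G :: "'a::euclidean_space \<Rightarrow> 'a"
  assumes lip: "L-lipschitz_on UNIV G" and "L > 0" and bd: "\<And>x. norm (G x) \<le> B"
  obtains y where "y 0 = x0" "\<And>t. t \<ge> 0 \<Longrightarrow> (y has_vector_derivative G (y t)) (at t within {0..})"
proof -
  \<comment> \<open>The weighted operator has Lipschitz constant \<open>L / K\<close>, which becomes
    \<open>1/2\<close>.\<close>
  define K where "K = 2 * L"
  have K: "K > 0" using \<open>L > 0\<close> by (simp add: K_def)
  have B0: "B \<ge> 0" using bd[of 0] norm_ge_zero order_trans by blast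
  \<comment> \<open>The unknown is the rescaled deviation
    \<open>v s = exp (- K * s) *\<^sub>R (y s - x0)\<close> for \<open>s \<ge> 0\<close>, which is
    bounded when \<open>y\<close> is a solution.\<close>
  define g where "g v = (\<lambda>s. G (x0 + exp (K * s) *\<^sub>R v s))" for v :: "real \<Rightarrow> 'a"
  have Gc: "continuous_on UNIV G" using lip by (rule lipschitz_on_continuous_on)
  have gc: "continuous_on UNIV (g v)" if "continuous_on UNIV v" for v
    unfolding g_def using that by (intro continuous_on_compose2[OF Gc] continuous_intros) auto
  define P where "P v = (\<lambda>t. exp (- K * max 0 t) *\<^sub>R integral {0..max 0 t} (g v))" for v
  have Pb: "P v \<in> bcontfun" if "continuous_on UNIV v" for v
  proof (rule bcontfun_normI)
    show "continuous_on UNIV (P v)"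
      unfolding P_def by (intro continuous_intros continuous_indefinite_integral(2) gc that)
    fix t :: real
    have "exp (- K * max 0 t) * norm (integral {0..max 0 t} (g v)) \<le> B / K"
    proof (rule norm_integral_exp_bound[OF gc[OF that] _ K])
      fix s assume "s \<in> {0..max 0 t}"
      then have "1 \<le> exp (K * s)" using K by auto
      then have "B * 1 \<le> B * exp (K * s)" using B0 by (rule mult_left_mono)
      then show "norm (g v s) \<le> B * exp (K * s)"
        using bd[of "x0 + exp (K * s) *\<^sub>R v s"] by (simp add: g_def)
    qed (use B0 in auto)
    then show "norm (P v t) \<le> B / K" by (simp add: P_def)
  qed
  define F where "F v = Bcontfun (P (apply_bcontfun v))" for v :: "real \<Rightarrow>\<^sub>C 'a"
  have Fv: "apply_bcontfun (F v) = P (apply_bcontfun v)" for v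
    unfolding F_def by (intro Bcontfun_inverse Pb) simp
  have "\<exists>!v. F v = v"
  proof (rule banach_fix_type[of "1/2"])
    show "\<forall>v w. dist (F v) (F w) \<le> 1/2 * dist v w"
    proof (intro allI dist_bound)
      fix v w :: "real \<Rightarrow>\<^sub>C 'a" and t :: real
      let ?v = "apply_bcontfun v" and ?w = "apply_bcontfun w"
      define T where "T = max 0 t"
      have T: "T \<ge> 0" by (simp add: T_def)
      have cv: "continuous_on UNIV (g ?v)" "continuous_on UNIV (g ?w)" by (auto intro: gc)
      have eq: "P ?v t - P ?w t = exp (- K * T) *\<^sub>R integral {0..T} (\<lambda>s. g ?v s - g ?w s)"
        unfolding P_def T_def[symmetric]
        by (subst Henstock_Kurzweil_Integration.integral_diff)
          (auto intro!: integrable_continuous_real intro: continuous_on_subset[OF cv(1)] continuous_on_subset[OF cv(2)]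
             simp: scaleR_diff_right)
      have "exp (- K * T) * norm (integral {0..T} (\<lambda>s. g ?v s - g ?w s)) \<le> (L * dist v w) / K"
      proof (rule norm_integral_exp_bound[OF _ T K])
        fix s
        have "norm (g ?v s - g ?w s) \<le> L * norm ((x0 + exp (K * s) *\<^sub>R ?v s) - (x0 + exp (K * s) *\<^sub>R ?w s))"
          unfolding g_def by (rule lipschitz_on_normD[OF lip]) auto
        also have "\<dots> = L * (exp (K * s) * dist (?v s) (?w s))"
          by (simp add: dist_norm flip: scaleR_diff_right)
        also have "\<dots> \<le> L * (exp (K * s) * dist v w)"
          using \<open>L > 0\<close> by (intro mult_left_mono dist_bounded) auto
        finally show "norm (g ?v s - g ?w s) \<le> (L * dist v w) * exp (K * s)" by (simp add: mult_ac)
      qed (use \<open>L > 0\<close> cv in \<open>auto intro!: continuous_intros\<close>)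
      also have "(L * dist v w) / K = 1/2 * dist v w" using \<open>L > 0\<close> by (simp add: K_def)
      finally show "dist (apply_bcontfun (F v) t) (apply_bcontfun (F w) t) \<le> 1/2 * dist v w"
        by (simp add: Fv dist_norm eq)
    qed
  qed auto
  then obtain v where v: "F v = v" by blast
  define y where "y t = x0 + integral {0..t} (g (apply_bcontfun v))" for t
  have vy: "apply_bcontfun v t = exp (- K * t) *\<^sub>R integral {0..t} (g (apply_bcontfun v))" if "t \<ge> 0" for t
    using that Fv[of v] by (simp add: v P_def max_def fun_eq_iff)
  show thesis
  proof
    show "y 0 = x0" by (simp add: y_def)
    fix t :: real assume t: "t \<ge> 0"
    have "G (y t) = g (apply_bcontfun v) t"
      by (subst g_def) (simp only: vy[OF t], simp add: y_def exp_minus)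
    moreover have "(y has_vector_derivative g (apply_bcontfun v) t) (at t within {0..})"
      unfolding y_def using continuous_indefinite_integral(1)[OF gc, of "apply_bcontfun v", OF _ t]
      by (auto intro!: derivative_eq_intros)
    ultimately show "(y has_vector_derivative G (y t)) (at t within {0..})" by simp
  qed
qed

text \<open>The intermediate value theorem puts a zero at or before every time where
  \<open>f\<close> is nonpositive, so nothing nonpositive can precede the least zero.\<close>

lemma first_zero:
  fixes f :: "real \<Rightarrow> real"
  assumes c: "continuous_on {0..T} f" and "f 0 > 0" "f T \<le> 0" "T \<ge> 0"
  obtains t where "t \<in> {0<..T}" "f t = 0" "\<And>s. s \<in> {0..<t} \<Longrightarrow> f s > 0"
proof -
  define Z where "Z = {0..T} \<inter> f -` {0}"
  have zero: "\<exists>z\<in>Z. z \<le> s" if "s \<in> {0..T}" "f s \<le> 0" for s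
    using IVT2'[of f s 0 0] that assms continuous_on_subset[OF c, of "{0..s}"] by (auto simp: Z_def)
  have "closed Z" unfolding Z_def by (intro continuous_closed_preimage c) auto
  moreover have bdd: "bdd_below Z" by (auto simp: Z_def)
  moreover have "Z \<noteq> {}" using zero[of T] assms by auto
  ultimately have "Inf Z \<in> Z" by (intro closed_contains_Inf)
  moreover have "Z \<subseteq> {0..T}" "\<forall>z\<in>Z. f z = 0" by (auto simp: Z_def)
  ultimately have Z: "Inf Z \<in> {0..T}" "f (Inf Z) = 0" by blast+
  show thesis
  proof (rule that[of "Inf Z"])
    have "Inf Z \<noteq> 0" using Z assms(2) by (metis less_irrefl)
    then show "Inf Z \<in> {0<..T}" "f (Inf Z) = 0" using Z by auto
    show "f s > 0" if s: "s \<in> {0..<Inf Z}" for s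
    proof (rule ccontr)
      assume "\<not> f s > 0"
      then obtain z where "z \<in> Z" "z \<le> s" using zero[of s] s Z by auto
      then show False using cInf_lower[OF _ bdd, of z] s by auto
    qed
  qed
qed

text \<open>Precomposition with the closest-point projection onto the ball makes the field bounded
  and globally Lipschitz without changing it on the ball. The global solution of the modified
  equation solves the original one until it first meets the boundary sphere.\<close>

lemma solution_until_exit:
  fixes G :: "'a::euclidean_space \<Rightarrow> 'a"
  assumes lip: "L-lipschitz_on (cball C R) G" and x0: "x0 \<in> ball C R"
  obtains y where "y 0 = x0"
      "\<And>T t. t \<in> {0..T} \<Longrightarrow> y t \<in> cball C R \<and> (y has_vector_derivative G (y t)) (at t within {0..T})"
    | y T where "y 0 = x0" "T \<ge> 0" "dist C (y T) = R"
      "\<And>t. t \<in> {0..T} \<Longrightarrow> y t \<in> cball C R \<and> (y has_vector_derivative G (y t)) (at t within {0..T})"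
proof -
  define c where "c = closest_point (cball C R)"
  have ne: "cball C R \<noteq> {}" using x0 ball_subset_cball by blast
  have "compact (G ` cball C R)"
    using lipschitz_on_continuous_on[OF lip] by (intro compact_continuous_image) auto
  then obtain B where B: "\<And>x. x \<in> cball C R \<Longrightarrow> norm (G x) \<le> B"
    using compact_imp_bounded bounded_iff by (metis image_eqI)
  have cin: "c x \<in> cball C R" for x
    unfolding c_def using ne by (intro closest_point_in_set) auto
  have cid: "c x = x" if "x \<in> cball C R" for x
    unfolding c_def using that by (rule closest_point_self)
  have clip: "1-lipschitz_on UNIV c"
    unfolding c_def using ne by (intro lipschitz_onI) (auto intro!: closest_point_lipschitz)
  \<comment> \<open>The constant \<open>L\<close> may be 0, whereas the global existence lemma wants
    a positive one.\<close>
  have "((L+1) * 1)-lipschitz_on UNIV (G \<circ> c)"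
    using cin by (intro lipschitz_on_compose clip lipschitz_on_mono[OF lip]) auto
  then obtain y where y: "y 0 = x0" "\<And>t. t \<ge> 0 \<Longrightarrow> (y has_vector_derivative G (c (y t))) (at t within {0..})"
    using global_solution_bounded_lipschitz[of "L+1" "G \<circ> c" B x0] lipschitz_on_nonneg[OF lip] B cin
    by (auto simp: o_def)
  have sol: "(y has_vector_derivative G (y t)) (at t within {0..T})" if "t \<in> {0..T}" "y t \<in> cball C R" for t T
    using has_vector_derivative_within_subset[OF y(2), of t "{0..T}"] that cid by auto
  show thesis
  proof (cases "\<forall>t\<ge>0. y t \<in> ball C R")
    case True
    then show ?thesis using that(1)[of y] y(1) sol by (auto simp: less_imp_le)
  next
    case False
    then obtain t1 where t1: "t1 \<ge> 0" "R - dist C (y t1) \<le> 0" by auto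
    have "continuous_on {0..} y"
      using y(2) by (meson atLeast_iff continuous_on_eq_continuous_within has_vector_derivative_continuous)
    then have "continuous_on {0..t1} (\<lambda>t. R - dist C (y t))"
      by (intro continuous_intros) (auto elim: continuous_on_subset)
    then obtain T where T: "T \<in> {0<..t1}" "R - dist C (y T) = 0" "\<And>t. t \<in> {0..<T} \<Longrightarrow> R - dist C (y t) > 0"
      using first_zero[of t1 "\<lambda>t. R - dist C (y t)"] t1 x0 y(1) by auto
    have "y t \<in> cball C R" if "t \<in> {0..T}" for t
      using T(2) T(3)[of t] that by (cases "t = T") auto
    then show ?thesis using that(2)[of y T] y(1) T(1,2) sol by auto
  qed
qed

section \<open>A class of smooth functions\<close>

text \<open>The polynomial parameter makes the family of flat functions closed under
  differentiation: \<open>P\<close> passes to \<open>[:0, 0, 1:] * (P - pderiv P)\<close>. The usual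
  \<open>exp (- 1 / t)\<close> is \<open>flat 1\<close>.\<close>

definition flat :: "real poly \<Rightarrow> real \<Rightarrow> real" where
  "flat P t = (if t > 0 then poly P (1 / t) * exp (- (1 / t)) else 0)"

lemma flat_nonpos [simp]: "t \<le> 0 \<Longrightarrow> flat P t = 0"
  by (simp add: flat_def)

lemma flat_one_pos: "t > 0 \<Longrightarrow> flat 1 t > 0"
  by (simp add: flat_def)

lemma flat_one_nonneg: "flat 1 t \<ge> 0"
  by (simp add: flat_def)

lemma poly_times_exp_tendsto_0: "((\<lambda>x. poly P x * exp (- x)) \<longlongrightarrow> (0::real)) at_top"
proof -
  have "((\<lambda>x. \<Sum>i\<le>degree P. coeff P i * (x ^ i / exp x)) \<longlongrightarrow> (\<Sum>i\<le>degree P. coeff P i * 0)) at_top"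
    by (intro tendsto_intros tendsto_power_div_exp_0)
  moreover have "(\<lambda>x. \<Sum>i\<le>degree P. coeff P i * (x ^ i / exp x)) = (\<lambda>x. poly P x * exp (- x))"
    by (simp add: poly_altdef exp_minus sum_distrib_left divide_inverse fun_eq_iff mult_ac)
  ultimately show ?thesis by simp
qed

lemma flat_tendsto_0: "(flat P \<longlongrightarrow> 0) (at 0)"
proof -
  have "((\<lambda>t. poly P (inverse t) * exp (- inverse t)) \<longlongrightarrow> 0) (at_right 0)"
    by (rule filterlim_compose[OF poly_times_exp_tendsto_0 filterlim_inverse_at_top_right])
  moreover have "\<forall>\<^sub>F t in at_right 0. flat P t = poly P (inverse t) * exp (- inverse t)"
    by (auto simp: flat_def eventually_at_filter divide_inverse)
  ultimately have r: "(flat P \<longlongrightarrow> 0) (at_right 0)"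
    by (simp add: filterlim_cong)
  have "\<forall>\<^sub>F t in at_left 0. flat P t = 0"
    by (auto simp: eventually_at_filter)
  then have "(flat P \<longlongrightarrow> 0) (at_left 0)"
    by (simp add: tendsto_eventually)
  with r show ?thesis by (simp add: filterlim_at_split)
qed

lemma flat_has_derivative:
  "(flat P has_real_derivative flat ([:0, 0, 1:] * (P - pderiv P)) t) (at t)"
proof -
  consider "t > 0" | "t < 0" | "t = 0" by linarith
  then show ?thesis
  proof cases
    case 1
    have "((\<lambda>t. poly P (1 / t) * exp (- (1 / t))) has_real_derivative
        poly (pderiv P) (1 / t) * (- 1 / t\<^sup>2) * exp (- (1 / t)) + poly P (1 / t) * (exp (- (1 / t)) * (1 / t\<^sup>2))) (at t)"
      using 1 by (auto intro!: derivative_eq_intros simp: power2_eq_square)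
    also have "poly (pderiv P) (1 / t) * (- 1 / t\<^sup>2) * exp (- (1 / t)) + poly P (1 / t) * (exp (- (1 / t)) * (1 / t\<^sup>2))
        = flat ([:0, 0, 1:] * (P - pderiv P)) t"
      using 1 by (simp add: flat_def power2_eq_square field_simps)
    finally show ?thesis
      by (rule has_field_derivative_transform_within_open[of _ _ _ "{0<..}"]) (use 1 in \<open>auto simp: flat_def\<close>)
  next
    case 2
    have "((\<lambda>t. 0) has_real_derivative flat ([:0, 0, 1:] * (P - pderiv P)) t) (at t)"
      using 2 by simp
    then show ?thesis
      by (rule has_field_derivative_transform_within_open[of _ _ _ "{..<0}"]) (use 2 in \<open>auto simp: flat_def\<close>)
  next
    case 3
    \<comment> \<open>The difference quotient at 0 is itself a member of the family, so it tends to
      0.\<close>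
    have "\<forall>\<^sub>F h in at 0. flat ([:0, 1:] * P) h = (flat P (0 + h) - flat P 0) / h"
      by (auto simp: flat_def eventually_at_filter field_simps)
    with flat_tendsto_0[of "[:0, 1:] * P"]
    have "((\<lambda>h. (flat P (0 + h) - flat P 0) / h) \<longlongrightarrow> 0) (at 0)"
      by (rule Lim_transform_eventually)
    then show ?thesis by (simp add: 3 DERIV_def)
  qed
qed

lemma continuous_on_flat: "continuous_on S (flat P)"
  by (intro continuous_at_imp_continuous_on ballI DERIV_isCont[OF flat_has_derivative])

inductive elementary :: "(real^'n \<Rightarrow> real) \<Rightarrow> bool" where
  el_const: "elementary (\<lambda>x. c)"
| el_coord: "elementary (\<lambda>x. x $ i)"
| el_add: "elementary f \<Longrightarrow> elementary g \<Longrightarrow> elementary (\<lambda>x. f x + g x)"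
| el_mult: "elementary f \<Longrightarrow> elementary g \<Longrightarrow> elementary (\<lambda>x. f x * g x)"
| el_inverse: "elementary f \<Longrightarrow> (\<And>x. f x \<noteq> 0) \<Longrightarrow> elementary (\<lambda>x. inverse (f x))"
| el_flat: "elementary f \<Longrightarrow> elementary (\<lambda>x. flat P (f x))"

lemma el_minus: "elementary f \<Longrightarrow> elementary (\<lambda>x. - f x)"
  using el_mult[OF el_const[of "-1"], of f] by simp

lemma el_diff: "elementary f \<Longrightarrow> elementary g \<Longrightarrow> elementary (\<lambda>x. f x - g x)"
  using el_add[OF _ el_minus, of f g] by simp

lemma el_power: "elementary f \<Longrightarrow> elementary (\<lambda>x. f x ^ n)"
  by (induction n) (auto intro: el_const el_mult)

lemma el_divide: "elementary f \<Longrightarrow> elementary g \<Longrightarrow> (\<And>x. g x \<noteq> 0) \<Longrightarrow> elementary (\<lambda>x. f x / g x)"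
  unfolding divide_inverse by (intro el_mult el_inverse)

lemmas el_intros = el_const el_coord el_add el_mult el_flat el_minus el_diff el_power

lemma elementary_continuous: "elementary f \<Longrightarrow> continuous_on S f"
  by (induction rule: elementary.induct)
    (auto intro!: continuous_intros continuous_on_compose2[OF continuous_on_flat[of UNIV]])

lemma elementary_has_derivative:
  fixes f :: "real^'n \<Rightarrow> real"
  assumes "elementary f"
  shows "\<exists>f'. (\<forall>i. elementary (f' i)) \<and> (\<forall>x. (f has_derivative (\<lambda>h. \<Sum>i\<in>UNIV. h $ i * f' i x)) (at x))"
  using assms
proof (induction rule: elementary.induct)
  case (el_const c)
  show ?case by (rule exI[of _ "\<lambda>i x. 0"]) (simp add: elementary.el_const)
next
  case (el_coord j)
  have "(\<lambda>h :: real^'n. \<Sum>i\<in>UNIV. h $ i * (if i = j then 1 else 0)) = (\<lambda>h. h $ j)"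
    by (simp add: fun_eq_iff if_distrib cong: if_cong)
  then show ?case
    by (intro exI[of _ "\<lambda>i x. if i = j then 1 else 0"] conjI allI)
      (simp_all only: elementary.el_const bounded_linear_imp_has_derivative[OF bounded_linear_vec_nth])
next
  case (el_add f g)
  then obtain f' g' where *: "\<forall>i. elementary (f' i)" "\<forall>i. elementary (g' i)"
    "\<forall>x. (f has_derivative (\<lambda>h. \<Sum>i\<in>UNIV. h $ i * f' i x)) (at x)"
    "\<forall>x. (g has_derivative (\<lambda>h. \<Sum>i\<in>UNIV. h $ i * g' i x)) (at x)" by blast
  show ?case
    using has_derivative_add[OF *(3)[rule_format] *(4)[rule_format]]
    by (intro exI[of _ "\<lambda>i x. f' i x + g' i x"] conjI allI elementary.el_add *(1,2)[rule_format])
      (simp add: distrib_left sum.distrib)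
next
  case (el_mult f g)
  then obtain f' g' where *: "\<forall>i. elementary (f' i)" "\<forall>i. elementary (g' i)"
    "\<forall>x. (f has_derivative (\<lambda>h. \<Sum>i\<in>UNIV. h $ i * f' i x)) (at x)"
    "\<forall>x. (g has_derivative (\<lambda>h. \<Sum>i\<in>UNIV. h $ i * g' i x)) (at x)" by blast
  show ?case
    using has_derivative_mult[OF *(3)[rule_format] *(4)[rule_format]]
    by (intro exI[of _ "\<lambda>i x. f x * g' i x + f' i x * g x"] conjI allI elementary.el_add elementary.el_mult
        el_mult.hyps *(1,2)[rule_format])
      (simp add: distrib_left sum.distrib sum_distrib_left sum_distrib_right mult_ac)
next
  case (el_inverse f)
  then obtain f' where *: "\<forall>i. elementary (f' i)"
    "\<forall>x. (f has_derivative (\<lambda>h. \<Sum>i\<in>UNIV. h $ i * f' i x)) (at x)" by blast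
  show ?case
    using Deriv.has_derivative_inverse[OF el_inverse.hyps(2) *(2)[rule_format]]
    by (intro exI[of _ "\<lambda>i x. - (inverse (f x) * f' i x * inverse (f x))"] conjI allI el_minus elementary.el_mult
        elementary.el_inverse el_inverse.hyps *(1)[rule_format])
      (simp add: sum_negf sum_distrib_left sum_distrib_right mult_ac)
next
  case (el_flat f P)
  then obtain f' where *: "\<forall>i. elementary (f' i)"
    "\<forall>x. (f has_derivative (\<lambda>h. \<Sum>i\<in>UNIV. h $ i * f' i x)) (at x)" by blast
  show ?case
    using DERIV_compose_FDERIV[OF flat_has_derivative *(2)[rule_format]]
    by (intro exI[of _ "\<lambda>i x. f' i x * flat ([:0, 0, 1:] * (P - pderiv P)) (f x)"] conjI allI elementary.el_mult
        elementary.el_flat el_flat.hyps *(1)[rule_format])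
      (simp only: sum_distrib_right mult.assoc)
qed

lemma elementary_pderiv_at:
  fixes f :: "real^'n \<Rightarrow> real"
  assumes "elementary f"
  shows "elementary (pderiv_at i f)" "(\<lambda>t. f (x + t *\<^sub>R axis i 1)) differentiable (at 0)"
proof -
  obtain f' where f': "\<forall>i. elementary (f' i)" "\<forall>x. (f has_derivative (\<lambda>h. \<Sum>i\<in>UNIV. h $ i * f' i x)) (at x)"
    using elementary_has_derivative[OF assms] by blast
  have d: "((\<lambda>t. f (x + t *\<^sub>R axis i 1)) has_real_derivative f' i x) (at 0)" for x
  proof -
    have "((\<lambda>t. x + t *\<^sub>R axis i 1) has_derivative (\<lambda>t. t *\<^sub>R axis i 1)) (at (0::real))"
      by (auto intro!: derivative_eq_intros)
    moreover have "(f has_derivative (\<lambda>h. \<Sum>j\<in>UNIV. h $ j * f' j x)) (at (x + 0 *\<^sub>R axis i 1))"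
      using f'(2) by simp
    ultimately have "((\<lambda>t. f (x + t *\<^sub>R axis i 1)) has_derivative (\<lambda>t. \<Sum>j\<in>UNIV. (t *\<^sub>R axis i 1) $ j * f' j x)) (at 0)"
      by (rule has_derivative_compose)
    moreover have "(\<Sum>j\<in>UNIV. (t *\<^sub>R axis i 1 :: real^'n) $ j * f' j x) = f' i x * t" for t
      by (simp add: axis_def if_distrib if_distribR cong: if_cong)
    ultimately show ?thesis by (simp add: has_field_derivative_def)
  qed
  have "pderiv_at i f = f' i"
    unfolding pderiv_at_def by (intro ext DERIV_imp_deriv d)
  then show "elementary (pderiv_at i f)" using f'(1) by simp
  show "(\<lambda>t. f (x + t *\<^sub>R axis i 1)) differentiable (at 0)"
    unfolding real_differentiable_def by (rule exI, rule d)
qed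

lemma elementary_smooth_real:
  assumes "elementary f"
  shows "smooth_real f"
proof -
  have "elementary (iter_pderiv is f)" for "is"
    by (induction "is") (simp_all add: assms elementary_pderiv_at(1))
  then show ?thesis
    unfolding smooth_real_def by (intro allI conjI elementary_continuous elementary_pderiv_at(2))
qed

text \<open>The partial derivatives are elementary, hence bounded on a compact ball, and the mean
  value inequality applies by convexity.\<close>

lemma elementary_lipschitz:
  fixes f :: "real^'n \<Rightarrow> real"
  assumes "elementary f"
  shows "\<exists>L. L-lipschitz_on (cball C R) f"
proof -
  obtain f' where f': "\<forall>i. elementary (f' i)" "\<forall>x. (f has_derivative (\<lambda>h. \<Sum>i\<in>UNIV. h $ i * f' i x)) (at x)"
    using elementary_has_derivative[OF assms] by blast
  have "bounded ((\<lambda>x. \<Sum>i\<in>UNIV. \<bar>f' i x\<bar>) ` cball C R)"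
    using f'(1) by (intro compact_imp_bounded compact_continuous_image continuous_intros elementary_continuous) auto
  then obtain B where B: "B > 0" "\<forall>v\<in>(\<lambda>x. \<Sum>i\<in>UNIV. \<bar>f' i x\<bar>) ` cball C R. norm v \<le> B" unfolding bounded_pos by blast
  have "norm (f x - f y) \<le> B * norm (x - y)" if "x \<in> cball C R" "y \<in> cball C R" for x y
  proof (rule differentiable_bound[OF convex_cball _ _ that])
    fix z assume z: "z \<in> cball C R"
    show "(f has_derivative (\<lambda>h. \<Sum>i\<in>UNIV. h $ i * f' i z)) (at z within cball C R)"
      by (rule has_derivative_at_withinI[OF f'(2)[rule_format]])
    show "onorm (\<lambda>h. \<Sum>i\<in>UNIV. h $ i * f' i z) \<le> B"
    proof (rule onorm_le)
      fix h :: "real^'n"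
      have "norm (\<Sum>i\<in>UNIV. h $ i * f' i z) \<le> (\<Sum>i\<in>UNIV. norm h * \<bar>f' i z\<bar>)"
        using component_le_norm_cart[of h] by (intro sum_norm_le) (simp add: abs_mult mult_right_mono)
      also have "\<dots> \<le> norm h * B" using B(2) z by (simp add: sum_distrib_left[symmetric] mult_left_mono)
      finally show "norm (\<Sum>i\<in>UNIV. h $ i * f' i z) \<le> B * norm h" by (simp add: mult.commute)
    qed
  qed
  then show ?thesis using B(1) by (intro exI[of _ B] lipschitz_onI) (auto simp: dist_norm)
qed

lemma elementary_lipschitz_vec:
  fixes f :: "real^'n \<Rightarrow> real^'m"
  assumes "\<And>k. elementary (\<lambda>x. f x $ k)"
  shows "\<exists>L. L-lipschitz_on (cball C R) f"
proof -
  have "\<forall>k. \<exists>L. L-lipschitz_on (cball C R) (\<lambda>x. f x $ k)" using elementary_lipschitz[OF assms] by blast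
  then obtain L where L: "\<And>k. (L k)-lipschitz_on (cball C R) (\<lambda>x. f x $ k)" by metis
  show ?thesis
  proof (intro exI[of _ "sum L UNIV"] lipschitz_onI)
    fix x y assume xy: "x \<in> cball C R" "y \<in> cball C R"
    have "dist (f x) (f y) \<le> (\<Sum>k\<in>UNIV. \<bar>(f x - f y) $ k\<bar>)"
      unfolding dist_norm by (rule norm_le_l1_cart)
    also have "\<dots> \<le> (\<Sum>k\<in>UNIV. L k * dist x y)"
      using lipschitz_onD[OF L xy] by (intro sum_mono) (auto simp: dist_real_def)
    finally show "dist (f x) (f y) \<le> sum L UNIV * dist x y" by (simp add: sum_distrib_right)
  qed (use L lipschitz_on_nonneg in \<open>blast intro: sum_nonneg\<close>)
qed

section \<open>A smooth step function\<close>

definition bump_den :: "real \<Rightarrow> real" where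
  "bump_den t = flat 1 t + flat 1 (1 - t)"

lemma bump_den_pos: "bump_den t > 0"
  using flat_one_pos[of t] flat_one_pos[of "1 - t"] flat_one_nonneg[of t] flat_one_nonneg[of "1 - t"]
  unfolding bump_den_def by (cases "t > 0") auto

definition step :: "real \<Rightarrow> real" where
  "step t = flat 1 t / bump_den t"

text \<open>The derivative is kept in closed form because it enters the vector field through the
  shear and has to be elementary itself.\<close>

definition step' :: "real \<Rightarrow> real" where
  "step' t = (flat [:0,0,1:] t * flat 1 (1 - t) + flat 1 t * flat [:0,0,1:] (1 - t)) / (bump_den t)\<^sup>2"

lemma step_bounds: "0 \<le> step t" "step t \<le> 1"
  using bump_den_pos[of t] flat_one_nonneg[of t] flat_one_nonneg[of "1 - t"]
  by (auto simp: step_def bump_den_def field_simps)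

lemma step_eq_0: "t \<le> 0 \<Longrightarrow> step t = 0"
  by (simp add: step_def)

lemma step_eq_1: "t \<ge> 1 \<Longrightarrow> step t = 1"
  using bump_den_pos[of t] by (simp add: step_def bump_den_def)

lemma step_eq_0_iff: "step t = 0 \<longleftrightarrow> t \<le> 0"
  using flat_one_pos[of t] bump_den_pos[of t] by (cases "t > 0") (auto simp: step_def)

lemma step_eq_1_iff: "step t = 1 \<longleftrightarrow> t \<ge> 1"
  using flat_one_pos[of "1 - t"] bump_den_pos[of t] by (cases "t < 1") (auto simp: step_def bump_den_def field_simps)

lemma step'_eq_0: "t \<le> 0 \<or> t \<ge> 1 \<Longrightarrow> step' t = 0"
  by (auto simp: step'_def)

lemma step_has_derivative: "(step has_real_derivative step' t) (at t)"
proof -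
  have f: "(flat 1 has_real_derivative flat [:0,0,1:] t) (at t)" for t
    using flat_has_derivative[of 1 t] by simp
  have g: "((\<lambda>t. flat 1 (1 - t)) has_real_derivative flat [:0,0,1:] (1 - t) * (- 1)) (at t)"
    by (rule DERIV_chain2[OF f]) (auto intro!: derivative_eq_intros)
  have "((\<lambda>t. flat 1 t / bump_den t) has_real_derivative
      (flat [:0,0,1:] t * bump_den t - flat 1 t * (flat [:0,0,1:] t + flat [:0,0,1:] (1 - t) * (- 1))) / (bump_den t * bump_den t)) (at t)"
    using bump_den_pos[of t] by (intro DERIV_divide f, unfold bump_den_def) (intro DERIV_add f g, simp)
  also have "flat [:0,0,1:] t * bump_den t - flat 1 t * (flat [:0,0,1:] t + flat [:0,0,1:] (1 - t) * (- 1))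
      = flat [:0,0,1:] t * flat 1 (1 - t) + flat 1 t * flat [:0,0,1:] (1 - t)"
    by (simp add: bump_den_def algebra_simps)
  finally show ?thesis
    by (simp add: step_def[abs_def] step'_def power2_eq_square)
qed

lemma el_step: "elementary f \<Longrightarrow> elementary (\<lambda>x. step (f x))"
  unfolding step_def using bump_den_pos unfolding bump_den_def
  by (intro el_divide el_intros) (auto simp: less_imp_neq[symmetric])

lemma el_step': "elementary f \<Longrightarrow> elementary (\<lambda>x. step' (f x))"
  unfolding step'_def using bump_den_pos unfolding bump_den_def
  by (intro el_divide el_intros) (auto simp: less_imp_neq[symmetric])

text \<open>This bound limits the size of the shear, and so decides how fast the rotation near
  infinity has to be.\<close>

lemma step'_bounded: "\<exists>B>0. \<forall>t. \<bar>step' t\<bar> \<le> B"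
proof -
  have "continuous_on {0..1} step'"
    unfolding step'_def using bump_den_pos unfolding bump_den_def
    by (intro continuous_intros continuous_on_compose2[OF continuous_on_flat[of UNIV]])
      (auto simp: less_imp_neq[symmetric])
  then have "bounded (step' ` {0..1})"
    by (intro compact_imp_bounded compact_continuous_image) auto
  then obtain B where B: "B > 0" "\<And>t. t \<in> {0..1} \<Longrightarrow> norm (step' t) \<le> B"
    unfolding bounded_pos by (metis image_eqI)
  have "\<bar>step' t\<bar> \<le> B" for t
    using B(1) B(2)[of t] step'_eq_0[of t] by (cases "t \<in> {0..1}") auto
  with B(1) show ?thesis by blast
qed

section \<open>One-dimensional invariant manifolds as power series\<close>

text \<open>The partial sums satisfy the differential inequality \<open>U' \<le> C U\<^sup>2\<close> uniformly in \<open>N\<close>,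
  so \<open>1 / U\<close> decreases at most at rate \<open>C\<close>.\<close>

lemma quadratic_recursion_continues:
  fixes B :: "nat \<Rightarrow> real"
  assumes nonneg: "\<And>k. B k \<ge> 0" and B0: "B 0 > 0" and "C > 0"
    and rec: "\<And>k. k \<ge> 1 \<Longrightarrow> real k * B k \<le> C * (\<Sum>i<k. B i * B (k - 1 - i))"
    and bound: "\<And>N. (\<Sum>k<N. B k * r ^ k) \<le> M" and r: "0 \<le> r" "r \<le> r'" "C * M * (r' - r) \<le> 1/2"
  shows "(\<Sum>k<N. B k * r' ^ k) \<le> 2 * M"
proof (cases N)
  case 0
  have "0 \<le> M" using bound[of 0] by simp
  then show ?thesis using 0 by simp
next
  case (Suc N')
  define U where "U x = (\<Sum>k<N. B k * x ^ k)" for x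
  define U' where "U' x = (\<Sum>k<N. B k * (real k * x ^ (k - 1)))" for x
  have dU: "(U has_real_derivative U' x) (at x)" for x
    unfolding U_def U'_def by (auto intro!: derivative_eq_intros simp: mult_ac)
  have Upos: "U x > 0" if "x \<ge> 0" for x
  proof -
    have "B 0 * x ^ 0 \<le> U x"
      unfolding U_def using that nonneg Suc by (intro member_le_sum) auto
    then show ?thesis using B0 by simp
  qed
  have M: "M > 0" using Upos[OF r(1)] bound[of N] by (simp add: U_def)
  have U'_le: "U' x \<le> C * (U x)\<^sup>2" if x: "x \<ge> 0" for x
  proof -
    have "U' x \<le> (\<Sum>k<N. C * (\<Sum>i<k. (B i * x ^ i) * (B (k - 1 - i) * x ^ (k - 1 - i))))"
      unfolding U'_def
    proof (rule sum_mono)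
      fix k assume "k \<in> {..<N}"
      show "B k * (real k * x ^ (k - 1)) \<le> C * (\<Sum>i<k. (B i * x ^ i) * (B (k - 1 - i) * x ^ (k - 1 - i)))"
      proof (cases "k = 0")
        case False
        have "B k * (real k * x ^ (k - 1)) \<le> (C * (\<Sum>i<k. B i * B (k - 1 - i))) * x ^ (k - 1)"
          using rec[of k] False x by (simp add: mult_right_mono mult.assoc[symmetric] mult.commute[of "B k"])
        also have "\<dots> = C * (\<Sum>i<k. (B i * x ^ i) * (B (k - 1 - i) * x ^ (k - 1 - i)))"
          unfolding mult.assoc sum_distrib_right
        proof (intro arg_cong[of _ _ "\<lambda>z. C * z"] sum.cong refl)
          fix i assume "i \<in> {..<k}"
          then have "x ^ (k - 1) = x ^ i * x ^ (k - 1 - i)" by (simp flip: power_add)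
          then show "B i * (B (k - 1 - i) * x ^ (k - 1)) = B i * (x ^ i * (B (k - 1 - i) * x ^ (k - 1 - i)))"
            by simp
        qed
        finally show ?thesis .
      qed simp
    qed
    also have "\<dots> = C * (\<Sum>(k, i)\<in>(SIGMA k:{..<N}. {..<k}). (B i * x ^ i) * (B (k - 1 - i) * x ^ (k - 1 - i)))"
      by (simp add: sum.Sigma sum_distrib_left case_prod_unfold)
    \<comment> \<open>The pairs \<open>(i, k - 1 - i)\<close> are distinct and fill part of the
      square \<open>{..<N} \<times> {..<N}\<close>; the missing terms of the square are
      nonnegative.\<close>
    also have "(\<Sum>(k, i)\<in>(SIGMA k:{..<N}. {..<k}). (B i * x ^ i) * (B (k - 1 - i) * x ^ (k - 1 - i)))
        = (\<Sum>(i, j)\<in>(\<lambda>(k, i). (i, k - 1 - i)) ` (SIGMA k:{..<N}. {..<k}). (B i * x ^ i) * (B j * x ^ j))"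
      by (subst sum.reindex) (auto simp: inj_on_def case_prod_unfold)
    also have "\<dots> \<le> (\<Sum>(i, j)\<in>{..<N} \<times> {..<N}. (B i * x ^ i) * (B j * x ^ j))"
      using nonneg x by (intro sum_mono2) (auto intro!: mult_nonneg_nonneg)
    also have "\<dots> = (U x)\<^sup>2"
      by (simp add: U_def power2_eq_square sum_product sum.cartesian_product)
    finally show ?thesis using \<open>C > 0\<close> by (simp add: mult_left_mono)
  qed
  have "C * r - (- 1 / U r) \<le> C * r' - (- 1 / U r')"
  proof (rule DERIV_nonneg_imp_nondecreasing[OF r(2)])
    fix x assume x: "r \<le> x" "x \<le> r'"
    with r have x0: "x \<ge> 0" by simp
    have "((\<lambda>x. C * x - (- 1 / U x)) has_real_derivative C - U' x / (U x * U x)) (at x)"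
      using Upos[OF x0] by (auto intro!: derivative_eq_intros dU)
    moreover have "0 \<le> C - U' x / (U x * U x)"
      using U'_le[OF x0] Upos[OF x0] by (simp add: divide_le_eq power2_eq_square)
    ultimately show "\<exists>y. ((\<lambda>x. C * x - (- 1 / U x)) has_real_derivative y) (at x) \<and> 0 \<le> y" by blast
  qed
  then have "1 / U r - C * (r' - r) \<le> 1 / U r'" by (simp add: algebra_simps)
  moreover have "1 / M \<le> 1 / U r"
    using bound[of N] Upos[OF r(1)] by (intro divide_left_mono) (auto simp: U_def intro!: mult_pos_pos M)
  moreover have "C * (r' - r) \<le> 1 / (2 * M)"
    using r(3) M by (simp add: field_simps)
  ultimately have "1 / (2 * M) \<le> 1 / U r'" by (simp add: field_simps)
  then show ?thesis using M Upos[of r'] r by (simp add: U_def field_simps)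
qed

text \<open>Differentiating along \<open>w * exp (\<mu> * t)\<close> multiplies the n-th coefficient
  by \<open>\<mu> * n\<close>. Taking the sum \<open>D\<close> of that series as a hypothesis allows
  each equation of the system to be verified by comparing coefficients.\<close>

lemma powser_exp_has_derivative:
  fixes c :: "nat \<Rightarrow> real"
  assumes "summable (\<lambda>n. c n * R ^ n)" "\<bar>w * exp (\<mu> * t)\<bar> < R"
    and D: "(\<lambda>n. \<mu> * real n * c n * (w * exp (\<mu> * t)) ^ n) sums D"
  shows "((\<lambda>t. \<Sum>n. c n * (w * exp (\<mu> * t)) ^ n) has_real_derivative D) (at t)"
proof -
  let ?x = "w * exp (\<mu> * t)"
  have nR: "norm ?x < norm R" using assms(2) by auto
  have d: "((\<lambda>x. \<Sum>n. c n * x ^ n) has_real_derivative (\<Sum>n. diffs c n * ?x ^ n)) (at ?x)"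
    by (rule termdiffs_strong[OF assms(1) nR])
  have "((\<lambda>t. w * exp (\<mu> * t)) has_real_derivative \<mu> * ?x) (at t)"
    by (auto intro!: derivative_eq_intros)
  from DERIV_chain2[OF d this]
  have "((\<lambda>t. \<Sum>n. c n * (w * exp (\<mu> * t)) ^ n) has_real_derivative (\<Sum>n. diffs c n * ?x ^ n) * (\<mu> * ?x)) (at t)" .
  moreover have "(\<Sum>n. diffs c n * ?x ^ n) * (\<mu> * ?x) = D"
  proof -
    have "\<And>x. norm x < norm R \<Longrightarrow> summable (\<lambda>n. c n * x ^ n)"
      using powser_inside[OF assms(1)] by blast
    from termdiff_converges[OF nR this]
    have "(\<lambda>n. diffs c n * ?x ^ n) sums (\<Sum>n. diffs c n * ?x ^ n)" by (simp add: summable_sums)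
    then have "(\<lambda>n. (diffs c n * ?x ^ n) * (\<mu> * ?x)) sums ((\<Sum>n. diffs c n * ?x ^ n) * (\<mu> * ?x))"
      by (rule sums_mult2)
    moreover have "(\<lambda>n. (diffs c n * ?x ^ n) * (\<mu> * ?x)) = (\<lambda>n. \<mu> * real (Suc n) * c (Suc n) * ?x ^ Suc n)"
      by (simp add: diffs_def fun_eq_iff mult_ac)
    ultimately have "(\<lambda>n. \<mu> * real n * c n * ?x ^ n) sums ((\<Sum>n. diffs c n * ?x ^ n) * (\<mu> * ?x))"
      using sums_Suc_iff[of "\<lambda>n. \<mu> * real n * c n * ?x ^ n"] by simp
    then show ?thesis using D sums_unique2 by blast
  qed
  ultimately show ?thesis by simp
qed

text \<open>Comparing coefficients of \<open>exp (n \<mu> t)\<close> in \<open>S' = a S - X\<close>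
  and \<open>X' = S - U\<close> expresses those of \<open>X\<close> and \<open>U\<close> as
  \<open>a - n \<mu>\<close> and \<open>(n \<mu>)\<^sup>2 - a n \<mu> + 1\<close> times that of
  \<open>S\<close>. The equation for \<open>U\<close> then leaves the characteristic polynomial at
  \<open>n \<mu>\<close> times the coefficient on one side and the convolution of \<open>U\<close>
  with \<open>X\<close> on the other. At \<open>n = 1\<close> the polynomial vanishes, so
  \<open>\<sigma>\<close> is free; its sign selects the branch.\<close>

fun mode_coeff :: "real \<Rightarrow> real \<Rightarrow> real \<Rightarrow> real \<Rightarrow> real \<Rightarrow> nat \<Rightarrow> real" where
  "mode_coeff a \<mu> \<rho> \<omega> \<sigma> n = (if n = 0 then 0 else if n = 1 then \<sigma> else
     (\<Sum>i\<in>{1..<n}. (((real i * \<mu>)\<^sup>2 - a * (real i * \<mu>) + 1) * mode_coeff a \<mu> \<rho> \<omega> \<sigma> i)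
        * ((a - real (n - i) * \<mu>) * mode_coeff a \<mu> \<rho> \<omega> \<sigma> (n - i)))
     / ((real n * \<mu> - \<mu>) * ((real n * \<mu> - \<rho>)\<^sup>2 + \<omega>\<^sup>2)))"

declare mode_coeff.simps [simp del]

text \<open>In the deviations \<open>S, X, U\<close> of \<open>b - y, x, z + b\<close> from a fixed point the system reads
  \<open>S' = a S - X\<close>, \<open>X' = S - U\<close>, \<open>U' = - d U + e X + U X\<close>; its characteristic polynomial is the
  left-hand side of \<open>char\<close>. The one-dimensional invariant manifold is the curve
  \<open>S = \<Sum> S\<^sub>n exp (n \<mu> t)\<close>.\<close>

locale fast_mode =
  fixes a d e \<mu> \<rho> \<omega> \<sigma> :: real
  assumes char: "\<And>l. (l + d) * (l\<^sup>2 - a * l + 1) - e * (a - l) = (l - \<mu>) * ((l - \<rho>)\<^sup>2 + \<omega>\<^sup>2)"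
    and opp: "\<mu> * \<rho> < 0" and \<sigma>: "\<sigma> \<noteq> 0"
begin

abbreviation "S \<equiv> mode_coeff a \<mu> \<rho> \<omega> \<sigma>"
abbreviation "pf n \<equiv> (real n * \<mu> - \<mu>) * ((real n * \<mu> - \<rho>)\<^sup>2 + \<omega>\<^sup>2)"
definition "uf n = (real n * \<mu>)\<^sup>2 - a * (real n * \<mu>) + 1"
definition "xf n = a - real n * \<mu>"
text \<open>A common majorant of the three series: the weight absorbs the quadratic growth of
  \<open>uf\<close>. Since \<open>pf n\<close> grows like \<open>n ^ 3\<close>, one power of
  \<open>n\<close> is still left over for the recursion, as in a quadratic differential
  inequality.\<close>

definition "A n = (real n)\<^sup>2 * \<bar>S n\<bar>"
definition "Cu = \<mu>\<^sup>2 + \<bar>a * \<mu>\<bar> + 1"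
definition "Cx = \<bar>a\<bar> + \<bar>\<mu>\<bar>"
definition "CC = Cu * Cx / \<bar>\<mu>\<bar> ^ 3"
definition "pS x = (\<Sum>n. S n * x ^ n)"
definition "pX x = (\<Sum>n. xf n * S n * x ^ n)"
definition "pU x = (\<Sum>n. uf n * S n * x ^ n)"

lemma mu0: "\<mu> \<noteq> 0" using opp by auto

lemma S_0 [simp]: "S 0 = 0" and S_1 [simp]: "S (Suc 0) = \<sigma>"
  by (simp_all add: mode_coeff.simps)

lemma A_nonneg: "A n \<ge> 0" by (simp add: A_def)

lemma A_0 [simp]: "A 0 = 0" by (simp add: A_def)

lemma Cu_pos: "Cu > 0" and Cx_pos: "Cx > 0" and CC_pos: "CC > 0"
proof -
  show 1: "Cu > 0" unfolding Cu_def by (rule add_nonneg_pos) auto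
  show 2: "Cx > 0" unfolding Cx_def using mu0 by auto
  show "CC > 0" unfolding CC_def using 1 2 mu0 by auto
qed

text \<open>Cleared of denominators the recursion also holds for \<open>n = 0\<close> and
  \<open>n = 1\<close>, where \<open>S 0\<close> and \<open>pf 1\<close> vanish. For
  \<open>n \<ge> 2\<close> there is no resonance: \<open>\<mu>\<close> and \<open>\<rho>\<close>
  have opposite signs, so \<open>n * \<mu> \<noteq> \<rho>\<close>.\<close>

lemma S_rec: "pf n * S n
    = (\<Sum>i\<in>{1..<n}. (uf i * S i) * (xf (n - i) * S (n - i)))"
proof -
  consider "n = 0" | "n = 1" | "n \<ge> 2" by linarith
  then show ?thesis
  proof cases
    case 3
    have "(real n * \<mu> - \<rho>)\<^sup>2 > 0"
    proof -
      have "real n * \<mu> - \<rho> \<noteq> 0"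
      proof
        assume "real n * \<mu> - \<rho> = 0"
        then have "\<mu> * \<rho> = real n * \<mu>\<^sup>2" by (simp add: power2_eq_square algebra_simps)
        then show False using opp by (simp add: mult_less_0_iff)
      qed
      then show ?thesis by simp
    qed
    then have "(real n * \<mu> - \<rho>)\<^sup>2 + \<omega>\<^sup>2 \<noteq> 0" by (smt (verit) zero_le_power2)
    moreover have "real n * \<mu> - \<mu> \<noteq> 0"
      using 3 mu0 by (simp add: left_diff_distrib[of "real n" 1 \<mu>, simplified, symmetric])
    ultimately show ?thesis
      by (subst mode_coeff.simps) (use 3 in \<open>simp add: uf_def xf_def\<close>)
  qed auto
qed

text \<open>By \<open>opp\<close> the cross term of \<open>(n * \<mu> - \<rho>)\<^sup>2\<close> is
  nonnegative, so the square is at least \<open>(n * \<mu>)\<^sup>2\<close> and no small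
  denominators occur.\<close>

lemma P_bound:
  assumes "n \<ge> 1"
  shows "(real n - 1) * \<bar>\<mu>\<bar> ^ 3 * (real n)\<^sup>2 \<le> \<bar>pf n\<bar>"
proof -
  have "0 \<le> - (2 * real n * (\<mu> * \<rho>))" using opp by (simp add: mult_nonneg_nonpos)
  then have q: "(real n * \<bar>\<mu>\<bar>)\<^sup>2 \<le> (real n * \<mu> - \<rho>)\<^sup>2 + \<omega>\<^sup>2"
    using zero_le_power2[of \<rho>] zero_le_power2[of \<omega>]
    by (simp only: power2_diff power_mult_distrib power2_abs mult.assoc)
  have "\<bar>pf n\<bar> = ((real n - 1) * \<bar>\<mu>\<bar>) * ((real n * \<mu> - \<rho>)\<^sup>2 + \<omega>\<^sup>2)"
  proof -
    have "real n * \<mu> - \<mu> = (real n - 1) * \<mu>" by (simp add: algebra_simps)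
    then show ?thesis using assms by (simp add: abs_mult)
  qed
  also have "\<dots> \<ge> ((real n - 1) * \<bar>\<mu>\<bar>) * (real n * \<bar>\<mu>\<bar>)\<^sup>2"
    using assms q by (intro mult_left_mono) auto
  finally show ?thesis by (simp add: power_mult_distrib power3_eq_cube power2_eq_square mult_ac)
qed

lemma coeff_bound:
  assumes "n \<noteq> 0 \<Longrightarrow> \<bar>f\<bar> \<le> K * (real n)\<^sup>2"
  shows "\<bar>f * S n\<bar> \<le> K * A n"
proof (cases "n = 0")
  case False
  then have "\<bar>f\<bar> * \<bar>S n\<bar> \<le> K * (real n)\<^sup>2 * \<bar>S n\<bar>" using assms by (intro mult_right_mono) auto
  then show ?thesis by (simp add: abs_mult A_def mult_ac)
qed simp

lemma uf_bound: "\<bar>uf n * S n\<bar> \<le> Cu * A n" and xf_bound: "\<bar>xf n * S n\<bar> \<le> Cx * A n"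
proof -
  have n: "1 \<le> (real n)\<^sup>2" "real n \<le> (real n)\<^sup>2" if "n \<noteq> 0"
    using that by (simp_all add: self_le_power)
  have "\<bar>uf n\<bar> \<le> \<bar>(real n)\<^sup>2 * \<mu>\<^sup>2\<bar> + \<bar>real n * (a * \<mu>)\<bar> + \<bar>1\<bar>"
    unfolding uf_def power_mult_distrib mult.left_commute[of a] by linarith
  then have "\<bar>uf n\<bar> \<le> (real n)\<^sup>2 * \<mu>\<^sup>2 + real n * \<bar>a * \<mu>\<bar> + 1" by (simp add: abs_mult)
  also have "\<dots> \<le> (real n)\<^sup>2 * \<mu>\<^sup>2 + (real n)\<^sup>2 * \<bar>a * \<mu>\<bar> + (real n)\<^sup>2" if "n \<noteq> 0"
    using n[OF that] by (intro add_mono mult_right_mono) auto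
  finally show "\<bar>uf n * S n\<bar> \<le> Cu * A n"
    by (intro coeff_bound) (simp add: Cu_def algebra_simps)
  have "\<bar>xf n\<bar> \<le> \<bar>a\<bar> * 1 + \<bar>\<mu>\<bar> * real n"
    unfolding xf_def using abs_triangle_ineq4[of a "real n * \<mu>"] by (simp add: abs_mult mult.commute)
  also have "\<dots> \<le> \<bar>a\<bar> * (real n)\<^sup>2 + \<bar>\<mu>\<bar> * (real n)\<^sup>2" if "n \<noteq> 0"
    using n[OF that] by (intro add_mono mult_left_mono) auto
  finally show "\<bar>xf n * S n\<bar> \<le> Cx * A n"
    by (intro coeff_bound) (simp add: Cx_def algebra_simps)
qed

lemma S_bound: "\<bar>S n\<bar> \<le> A n"
proof (cases "n = 0")
  case False
  then have "1 * \<bar>S n\<bar> \<le> (real n)\<^sup>2 * \<bar>S n\<bar>" by (intro mult_right_mono) auto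
  then show ?thesis by (simp add: A_def)
qed simp

lemma A_rec: "n \<ge> 1 \<Longrightarrow> (real n - 1) * A n \<le> CC * (\<Sum>i\<in>{1..<n}. A i * A (n - i))"
proof -
  assume n: "n \<ge> 1"
  have "(real n - 1) * \<bar>\<mu>\<bar> ^ 3 * A n = ((real n - 1) * \<bar>\<mu>\<bar> ^ 3 * (real n)\<^sup>2) * \<bar>S n\<bar>" by (simp add: A_def)
  also have "\<dots> \<le> \<bar>pf n\<bar> * \<bar>S n\<bar>"
    by (intro mult_right_mono P_bound n) auto
  also have "\<dots> = \<bar>\<Sum>i\<in>{1..<n}. (uf i * S i) * (xf (n - i) * S (n - i))\<bar>"
    by (simp only: abs_mult[symmetric] S_rec)
  also have "\<dots> \<le> (\<Sum>i\<in>{1..<n}. \<bar>uf i * S i\<bar> * \<bar>xf (n - i) * S (n - i)\<bar>)"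
    by (rule order_trans[OF sum_abs]) (simp add: abs_mult)
  also have "\<dots> \<le> (\<Sum>i\<in>{1..<n}. (Cu * A i) * (Cx * A (n - i)))"
    using Cu_pos Cx_pos A_nonneg by (intro sum_mono mult_mono uf_bound xf_bound) auto
  also have "\<dots> = Cu * Cx * (\<Sum>i\<in>{1..<n}. A i * A (n - i))"
    by (simp add: sum_distrib_left mult_ac)
  finally have "(real n - 1) * A n * \<bar>\<mu>\<bar> ^ 3 \<le> Cu * Cx * (\<Sum>i\<in>{1..<n}. A i * A (n - i))"
    by (simp add: mult_ac)
  then show ?thesis using mu0 by (simp add: CC_def pos_le_divide_eq)
qed

lemma A_Suc_rec: "k \<ge> 1 \<Longrightarrow> real k * A (Suc k) \<le> CC * (\<Sum>i<k. A (Suc i) * A (Suc (k - 1 - i)))"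
proof -
  assume k: "k \<ge> 1"
  have "(\<Sum>i\<in>{1..<Suc k}. A i * A (Suc k - i)) = (\<Sum>i\<in>{0..<k}. A (Suc i) * A (Suc k - Suc i))"
    unfolding One_nat_def by (rule sum.shift_bounds_Suc_ivl)
  also have "\<dots> = (\<Sum>i<k. A (Suc i) * A (Suc (k - 1 - i)))"
    by (intro sum.cong) (auto simp: Suc_diff_Suc)
  finally show ?thesis using A_rec[of "Suc k"] by simp
qed

lemma summable_shift:
  assumes "x > 0"
  shows "summable (\<lambda>n. A n * x ^ n) \<longleftrightarrow> summable (\<lambda>k. A (Suc k) * x ^ k)"
proof -
  have "summable (\<lambda>n. A n * x ^ n) \<longleftrightarrow> summable (\<lambda>k. (A (Suc k) * x ^ k) * x)"
    by (subst summable_Suc_iff[symmetric]) (simp add: mult_ac)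
  moreover have "(\<lambda>k. (A (Suc k) * x ^ k) * x) = (\<lambda>k. x * (A (Suc k) * x ^ k))" by (simp add: mult_ac)
  ultimately show ?thesis using assms by (simp add: summable_cmult_iff)
qed

text \<open>The gain in radius is \<open>1 / (2 * CC * M)\<close>: it depends on the bound at
  \<open>r\<close> only. The index is shifted because the series starts at \<open>n = 1\<close>,
  while the recursion lemma needs a positive term at 0.\<close>

lemma radius_extends:
  assumes "0 \<le> r" "r < r'" "\<And>N. (\<Sum>k<N. A (Suc k) * r ^ k) \<le> M" "CC * M * (r' - r) \<le> 1/2"
  shows "summable (\<lambda>n. A n * r' ^ n)"
proof -
  have "(\<Sum>k<N. A (Suc k) * r' ^ k) \<le> 2 * M" for N
    using assms A_nonneg CC_pos A_Suc_rec \<sigma>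
    by (intro quadratic_recursion_continues[where C = CC and r = r]) (auto simp: A_def)
  then have "summable (\<lambda>k. A (Suc k) * r' ^ k)"
    using A_nonneg assms
    by (intro bounded_imp_summable[where B = "2 * M"]) (auto simp only: lessThan_Suc_atMost[symmetric] intro!: mult_nonneg_nonneg zero_le_power)
  then show ?thesis using assms by (subst summable_shift) auto
qed

text \<open>Convergence is started from radius 0, where all partial sums are at most
  \<open>A 1\<close>.\<close>

lemma summable_init: "\<exists>r>0. summable (\<lambda>n. A n * r ^ n)"
proof -
  have A1: "A 1 > 0" using \<sigma> by (simp add: A_def)
  have "(\<Sum>k<N. A (Suc k) * 0 ^ k) \<le> A 1" for N
  proof -
    have "(\<Sum>k<N. A (Suc k) * 0 ^ k) = (\<Sum>k\<in>{..<N} \<inter> {0}. A (Suc k))"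
      by (rule sum.mono_neutral_cong_right) auto
    also have "\<dots> \<le> A 1" using A1 by (cases "N = 0") auto
    finally show ?thesis .
  qed
  then have "summable (\<lambda>n. A n * (1 / (2 * CC * A 1)) ^ n)"
    using CC_pos A1 by (intro radius_extends[where r = 0 and M = "A 1"]) (auto simp: field_simps)
  then show ?thesis using CC_pos A1 by (intro exI[of _ "1 / (2 * CC * A 1)"]) auto
qed

text \<open>The set of radii with convergence is open, so wherever the series converges it may be
  differentiated and the orbit continues a little further.\<close>

lemma summable_open:
  assumes "r > 0" "summable (\<lambda>n. A n * r ^ n)"
  shows "\<exists>R>r. summable (\<lambda>n. A n * R ^ n)"
proof -
  have s: "summable (\<lambda>k. A (Suc k) * r ^ k)" using assms summable_shift by blast
  define M where "M = (\<Sum>k. A (Suc k) * r ^ k) + 1"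
  have "(\<Sum>k<N. A (Suc k) * r ^ k) \<le> M" for N
    unfolding M_def using sum_le_suminf[OF s, of "{..<N}"] A_nonneg assms by auto
  moreover have "M > 0" unfolding M_def using suminf_nonneg[OF s] A_nonneg assms by (simp add: add_nonneg_pos)
  ultimately have "summable (\<lambda>n. A n * (r + 1 / (2 * CC * M)) ^ n)"
    using CC_pos assms by (intro radius_extends[where r = r and M = M]) (auto simp: field_simps)
  then show ?thesis using CC_pos \<open>M > 0\<close> by (intro exI[of _ "r + 1 / (2 * CC * M)"]) auto
qed

lemma summable_coeffs:
  assumes "summable (\<lambda>n. A n * R ^ n)" "R > 0" "\<bar>x\<bar> \<le> R"
  shows "summable (\<lambda>n. \<bar>S n * x ^ n\<bar>)" "summable (\<lambda>n. \<bar>xf n * S n * x ^ n\<bar>)" "summable (\<lambda>n. \<bar>uf n * S n * x ^ n\<bar>)"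
proof -
  have *: "summable (\<lambda>n. \<bar>c n * x ^ n\<bar>)" if "\<And>n. \<bar>c n\<bar> \<le> K * A n" "K \<ge> 0" for c K
  proof (rule summable_comparison_test')
    show "summable (\<lambda>n. K * (A n * R ^ n))" using assms by (intro summable_mult)
    fix n
    have "\<bar>c n\<bar> * \<bar>x\<bar> ^ n \<le> (K * A n) * R ^ n"
      using assms that A_nonneg by (intro mult_mono power_mono) auto
    then show "norm \<bar>c n * x ^ n\<bar> \<le> K * (A n * R ^ n)" by (simp add: abs_mult power_abs)
  qed
  show "summable (\<lambda>n. \<bar>S n * x ^ n\<bar>)" by (rule *[of _ 1]) (use S_bound in auto)
  show "summable (\<lambda>n. \<bar>xf n * S n * x ^ n\<bar>)" by (rule *[of _ Cx]) (use xf_bound Cx_pos in auto)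
  show "summable (\<lambda>n. \<bar>uf n * S n * x ^ n\<bar>)" by (rule *[of _ Cu]) (use uf_bound Cu_pos in auto)
qed

text \<open>The first two equations hold coefficientwise by the shape of \<open>xf\<close> and
  \<open>uf\<close>. In the third, \<open>char\<close> turns the linear part into
  \<open>pf n * S n\<close>, and by \<open>S_rec\<close> this is the n-th coefficient of the Cauchy
  product of \<open>pU\<close> and \<open>pX\<close>.\<close>

lemma mode_solution:
  assumes "summable (\<lambda>n. A n * R ^ n)" "\<bar>w * exp (\<mu> * t)\<bar> < R"
  shows "((\<lambda>t. pS (w * exp (\<mu> * t))) has_real_derivative
            a * pS (w * exp (\<mu> * t)) - pX (w * exp (\<mu> * t))) (at t)"
    and "((\<lambda>t. pX (w * exp (\<mu> * t))) has_real_derivative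
            pS (w * exp (\<mu> * t)) - pU (w * exp (\<mu> * t))) (at t)"
    and "((\<lambda>t. pU (w * exp (\<mu> * t))) has_real_derivative
            - d * pU (w * exp (\<mu> * t)) + e * pX (w * exp (\<mu> * t))
            + pU (w * exp (\<mu> * t)) * pX (w * exp (\<mu> * t))) (at t)"
proof -
  let ?x = "w * exp (\<mu> * t)"
  let ?c = "\<lambda>n i. (uf i * S i * ?x ^ i) * (xf (n - i) * S (n - i) * ?x ^ (n - i))"
  have R: "R > 0" "\<bar>R\<bar> \<le> R" and xR: "\<bar>?x\<bar> \<le> R" using assms(2) by auto
  note ss = summable_coeffs[OF assms(1) R(1) xR]
  note sR = summable_coeffs[OF assms(1) R, THEN summable_rabs_cancel]
  have sums: "(\<lambda>n. S n * ?x ^ n) sums pS ?x" "(\<lambda>n. xf n * S n * ?x ^ n) sums pX ?x"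
      "(\<lambda>n. uf n * S n * ?x ^ n) sums pU ?x"
    unfolding pS_def pX_def pU_def using ss[THEN summable_rabs_cancel] by (auto intro: summable_sums)
  have cauchy: "(\<lambda>n. \<Sum>i\<le>n. ?c n i) sums (pU ?x * pX ?x)"
    unfolding pU_def pX_def using ss by (intro Cauchy_product_sums) (auto simp: real_norm_def)
  have prod: "(\<lambda>n. pf n * S n * ?x ^ n) sums (pU ?x * pX ?x)"
  proof -
    have "(\<Sum>i\<le>n. ?c n i)
        = pf n * S n * ?x ^ n" for n
    proof -
      have "(\<Sum>i\<le>n. ?c n i)
          = (\<Sum>i\<in>{1..<n}. ?c n i)"
      proof (rule sum.mono_neutral_right)
        show "\<forall>i\<in>{..n} - {1..<n}. ?c n i = 0"
        proof
          fix i assume "i \<in> {..n} - {1..<n}"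
          then have "i = 0 \<or> n - i = 0" by auto
          then show "?c n i = 0"
            by (metis S_0 mult_zero_left mult_zero_right)
        qed
      qed auto
      also have "\<dots> = (\<Sum>i\<in>{1..<n}. (uf i * S i) * (xf (n - i) * S (n - i)) * ?x ^ n)"
      proof (intro sum.cong refl)
        fix i assume "i \<in> {1..<n}"
        then have "?x ^ n = ?x ^ i * ?x ^ (n - i)" by (simp flip: power_add)
        then show "?c n i
            = (uf i * S i) * (xf (n - i) * S (n - i)) * ?x ^ n" by (simp only: mult_ac)
      qed
      finally show ?thesis by (simp only: S_rec sum_distrib_right)
    qed
    then show ?thesis using cauchy by simp
  qed
  show "((\<lambda>t. pS (w * exp (\<mu> * t))) has_real_derivative a * pS ?x - pX ?x) (at t)"
    unfolding pS_def
  proof (rule powser_exp_has_derivative[OF sR(1) assms(2)], fold pS_def)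
    have "(\<lambda>n. a * (S n * ?x ^ n) - xf n * S n * ?x ^ n) sums (a * pS ?x - pX ?x)"
      by (intro sums_diff sums_mult sums)
    then show "(\<lambda>n. \<mu> * real n * S n * ?x ^ n) sums (a * pS ?x - pX ?x)"
      by (simp add: xf_def algebra_simps)
  qed
  show "((\<lambda>t. pX (w * exp (\<mu> * t))) has_real_derivative pS ?x - pU ?x) (at t)"
    unfolding pX_def
  proof (rule powser_exp_has_derivative[OF sR(2) assms(2)])
    have "(\<lambda>n. S n * ?x ^ n - uf n * S n * ?x ^ n) sums (pS ?x - pU ?x)"
      by (intro sums_diff sums)
    then show "(\<lambda>n. \<mu> * real n * (xf n * S n) * ?x ^ n) sums (pS ?x - pU ?x)"
      by (simp add: xf_def uf_def algebra_simps power2_eq_square)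
  qed
  have "((\<lambda>t. \<Sum>n. uf n * S n * (w * exp (\<mu> * t)) ^ n) has_real_derivative
      - d * pU ?x + e * pX ?x + pU ?x * pX ?x) (at t)"
  proof (rule powser_exp_has_derivative[OF sR(3) assms(2)])
    have "(\<lambda>n. - d * (uf n * S n * ?x ^ n) + e * (xf n * S n * ?x ^ n)
          + pf n * S n * ?x ^ n)
        sums (- d * pU ?x + e * pX ?x + pU ?x * pX ?x)"
      by (intro sums_add sums_mult sums prod)
    moreover have "- d * (uf n * S n * ?x ^ n) + e * (xf n * S n * ?x ^ n)
          + pf n * S n * ?x ^ n
        = \<mu> * real n * (uf n * S n) * ?x ^ n" for n
      unfolding char[of "real n * \<mu>", symmetric] by (simp add: uf_def xf_def algebra_simps)
    ultimately show "(\<lambda>n. \<mu> * real n * (uf n * S n) * ?x ^ n) sums (- d * pU ?x + e * pX ?x + pU ?x * pX ?x)"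
      by simp
  qed
  then show "((\<lambda>t. pU (w * exp (\<mu> * t))) has_real_derivative - d * pU ?x + e * pX ?x + pU ?x * pX ?x) (at t)"
    by (simp only: pU_def)
qed

text \<open>The slopes form \<open>\<sigma>\<close> times the eigenvector to \<open>\<mu>\<close> of
  the linear part: the curve is tangent to the eigendirection.\<close>

lemma mode_at_0:
  assumes "summable (\<lambda>n. A n * R ^ n)" "R > 0"
  shows "(pS has_real_derivative \<sigma>) (at 0)" "(pX has_real_derivative (a - \<mu>) * \<sigma>) (at 0)"
    "(pU has_real_derivative (\<mu>\<^sup>2 - a * \<mu> + 1) * \<sigma>) (at 0)"
    and "pS 0 = 0" "pX 0 = 0" "pU 0 = 0"
proof -
  have d: "((\<lambda>x. \<Sum>n. c n * x ^ n) has_real_derivative c 1) (at 0)"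
    if "summable (\<lambda>n. c n * R ^ n)" for c :: "nat \<Rightarrow> real"
    using termdiffs_strong[OF that, of 0] assms(2) by (simp add: diffs_def powser_zero)
  have "\<bar>R\<bar> \<le> R" using assms(2) by simp
  note s = summable_coeffs[OF assms this, THEN summable_rabs_cancel]
  show "(pS has_real_derivative \<sigma>) (at 0)" using d[OF s(1)] by (simp add: pS_def[abs_def])
  show "(pX has_real_derivative (a - \<mu>) * \<sigma>) (at 0)" using d[OF s(2)] by (simp add: pX_def[abs_def] xf_def)
  show "(pU has_real_derivative (\<mu>\<^sup>2 - a * \<mu> + 1) * \<sigma>) (at 0)" using d[OF s(3)] by (simp add: pU_def[abs_def] uf_def)
  show "pS 0 = 0" "pX 0 = 0" "pU 0 = 0" by (simp_all add: pS_def pX_def pU_def powser_zero)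
qed

end

section \<open>The branch with coefficients of one sign\<close>

locale monotone_mode = fast_mode +
  assumes mu_neg: "\<mu> < 0" and a_pos: "a > 0" and \<sigma>_neg: "\<sigma> < 0"
begin

lemma uf_pos: "uf n > 0" and xf_pos: "xf n > 0" and uf_ge: "(real n)\<^sup>2 * \<mu>\<^sup>2 \<le> uf n - 1"
proof -
  have "a * (real n * \<mu>) \<le> 0" "real n * \<mu> \<le> 0"
    using mu_neg a_pos by (auto simp: mult_nonneg_nonpos)
  moreover have "0 \<le> (real n)\<^sup>2 * \<mu>\<^sup>2" by simp
  ultimately show "xf n > 0" "(real n)\<^sup>2 * \<mu>\<^sup>2 \<le> uf n - 1" "uf n > 0"
    using a_pos unfolding xf_def uf_def power_mult_distrib by linarith+
qed

text \<open>The convolution multiplies two nonpositive factors, hence is nonnegative, and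
  \<open>pf n\<close> is negative for \<open>n \<ge> 2\<close>. So the sign of
  \<open>\<sigma>\<close> is inherited by every coefficient.\<close>

lemma S_nonpos: "S n \<le> 0"
proof (induction n rule: less_induct)
  case (less n)
  consider "n = 0" | "n = 1" | "n \<ge> 2" by linarith
  then show ?case
  proof cases
    case 3
    have "(\<Sum>i\<in>{1..<n}. (uf i * S i) * (xf (n - i) * S (n - i))) \<ge> 0"
    proof (rule sum_nonneg)
      fix i assume i: "i \<in> {1..<n}"
      have "uf i * S i \<le> 0" "xf (n - i) * S (n - i) \<le> 0"
        using less[of i] less[of "n - i"] i uf_pos[of i] xf_pos[of "n - i"] by (auto simp: mult_nonneg_nonpos)
      then show "0 \<le> (uf i * S i) * (xf (n - i) * S (n - i))" by (rule mult_nonpos_nonpos)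
    qed
    then have "pf n * S n \<ge> 0" by (simp only: S_rec)
    moreover have "pf n < 0"
    proof (rule mult_neg_pos)
      have "real n * \<mu> - \<mu> = (real n - 1) * \<mu>" by (simp add: algebra_simps)
      then show "real n * \<mu> - \<mu> < 0" using 3 mu_neg by (auto simp: mult_pos_neg)
      have "\<rho> > 0" using opp mu_neg by (simp add: mult_less_0_iff)
      moreover have "real n * \<mu> \<le> 0" using mu_neg by (simp add: mult_nonneg_nonpos)
      ultimately have "real n * \<mu> - \<rho> \<noteq> 0" by linarith
      then show "0 < (real n * \<mu> - \<rho>)\<^sup>2 + \<omega>\<^sup>2" by (simp add: add_pos_nonneg)
    qed
    ultimately show ?thesis by (metis mult_neg_pos not_less)
  qed (use \<sigma>_neg in auto)
qed

lemma A_eq: "A n = (real n)\<^sup>2 * - S n"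
  using S_nonpos by (simp add: A_def)

text \<open>All claims hold term by term. The ordering of \<open>pU\<close> and \<open>pS\<close>
  comes from \<open>uf n > 1\<close>, the last estimate from
  \<open>uf n \<ge> n\<^sup>2 * \<mu>\<^sup>2\<close>. That estimate makes \<open>- pU\<close> the
  only quantity to watch, since it controls the majorant; the others are the inequalities that the
  backward flow will preserve.\<close>

lemma orbit_signs:
  assumes "summable (\<lambda>n. A n * x ^ n)" "x > 0"
  shows "pS x < 0" "pX x < 0" "pU x < 0" "pU x < pS x" "\<mu>\<^sup>2 * (\<Sum>n. A n * x ^ n) \<le> - pU x"
proof -
  have pos: "summable f \<Longrightarrow> (\<And>n. f n \<le> 0) \<Longrightarrow> f 1 < 0 \<Longrightarrow> suminf f < 0" for f :: "nat \<Rightarrow> real"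
    using suminf_pos2[of "\<lambda>n. - f n" 1] by (simp add: suminf_minus summable_minus)
  have "\<bar>x\<bar> \<le> x" using assms(2) by simp
  note s = summable_coeffs[OF assms this, THEN summable_rabs_cancel]
  have m: "S n * x ^ n \<le> 0" for n using S_nonpos assms by (simp add: mult_nonpos_nonneg)
  note \<sigma>1 = \<sigma>_neg mu_neg
  have c: "suminf (\<lambda>n. f n * S n * x ^ n) < 0"
    if "summable (\<lambda>n. f n * S n * x ^ n)" "\<And>n. f n > 0" for f :: "nat \<Rightarrow> real"
  proof (rule pos[OF that(1)])
    fix n
    show "f n * S n * x ^ n \<le> 0"
      using mult_nonneg_nonpos[OF less_imp_le[OF that(2)] m, of n n] by (simp only: mult.assoc)
    show "f 1 * S 1 * x ^ 1 < 0"
      using that(2)[of 1] \<sigma>_neg assms(2) by (simp add: mult_pos_neg mult_neg_pos)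
  qed
  show "pS x < 0" unfolding pS_def using c[of "\<lambda>_. 1"] s(1) by simp
  show "pX x < 0" unfolding pX_def by (rule c[OF s(2) xf_pos])
  show "pU x < 0" unfolding pU_def by (rule c[OF s(3) uf_pos])
  have "pU x - pS x = (\<Sum>n. uf n * S n * x ^ n - S n * x ^ n)"
    unfolding pU_def pS_def by (rule suminf_diff[OF s(3,1)])
  also have "\<dots> < 0"
  proof (rule pos)
    show "summable (\<lambda>n. uf n * S n * x ^ n - S n * x ^ n)" by (rule summable_diff[OF s(3,1)])
    have eq: "uf n * S n * x ^ n - S n * x ^ n = (uf n - 1) * (S n * x ^ n)" for n by (simp add: algebra_simps)
    have "uf n - 1 \<ge> 0" for n by (rule order_trans[OF _ uf_ge]) simp
    then show "uf n * S n * x ^ n - S n * x ^ n \<le> 0" for n unfolding eq using m by (rule mult_nonneg_nonpos)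
    have "uf 1 - 1 > 0" by (rule less_le_trans[OF _ uf_ge]) (use mu0 in simp)
    then show "uf 1 * S 1 * x ^ 1 - S 1 * x ^ 1 < 0" unfolding eq using \<sigma>1 assms by (simp add: mult_pos_neg mult_neg_pos)
  qed
  finally show "pU x < pS x" by simp
  have "\<mu>\<^sup>2 * (\<Sum>n. A n * x ^ n) = (\<Sum>n. \<mu>\<^sup>2 * (A n * x ^ n))" by (rule suminf_mult[OF assms(1), symmetric])
  also have "\<dots> \<le> (\<Sum>n. - (uf n * S n * x ^ n))"
  proof (rule suminf_le)
    fix n
    have "((real n)\<^sup>2 * \<mu>\<^sup>2) * - (S n * x ^ n) \<le> uf n * - (S n * x ^ n)"
      using m uf_ge[of n] by (intro mult_right_mono) auto
    then show "\<mu>\<^sup>2 * (A n * x ^ n) \<le> - (uf n * S n * x ^ n)" by (simp add: A_eq mult_ac)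
  qed (intro summable_mult assms(1) summable_minus s(3))+
  also have "\<dots> = - pU x" unfolding pU_def by (rule suminf_minus[OF s(3)])
  finally show "\<mu>\<^sup>2 * (\<Sum>n. A n * x ^ n) \<le> - pU x" .
qed

text \<open>If \<open>- pU\<close> stayed below \<open>M\<close>, the majorant would be bounded by
  \<open>M1\<close> at every radius of convergence, so the radius could be enlarged by the same
  \<open>\<delta>\<close> again and again. But the single term \<open>A 1 * x\<close> exceeds
  \<open>M1\<close> for large \<open>x\<close>.\<close>

lemma orbit_unbounded: "\<exists>x>0. summable (\<lambda>n. A n * x ^ n) \<and> - pU x > M"
proof (rule ccontr)
  assume "\<not> ?thesis"
  then have pM: "- pU x \<le> M" if "x > 0" "summable (\<lambda>n. A n * x ^ n)" for x using that by force
  obtain r where r: "r > 0" "summable (\<lambda>n. A n * r ^ n)" using summable_init by blast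
  define M1 where "M1 = M / \<mu>\<^sup>2"
  have A1: "A 1 > 0" using \<sigma> by (simp add: A_def)
  have sum_le: "(\<Sum>n. A n * x ^ n) \<le> M1" if "x > 0" "summable (\<lambda>n. A n * x ^ n)" for x
    using orbit_signs(5)[OF that(2,1)] pM[OF that] mu0 by (simp add: M1_def pos_le_divide_eq mult.commute)
  have x_le: "A 1 * x \<le> M1" if "x > 0" "summable (\<lambda>n. A n * x ^ n)" for x
  proof -
    have "(\<Sum>n\<in>{1}. A n * x ^ n) \<le> (\<Sum>n. A n * x ^ n)"
      using that A_nonneg by (intro sum_le_suminf) auto
    then show ?thesis using sum_le[OF that] by simp
  qed
  have M1: "M1 > 0" using x_le[OF r] r A1 by (smt (verit) mult_pos_pos)
  \<comment> \<open>Dividing by a radius that is at least \<open>r\<close> bounds the shifted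
    partial sums by \<open>M1 / r\<close>; this is the gain which that bound allows.\<close>
  define \<delta> where "\<delta> = r / (2 * CC * M1)"
  have \<delta>: "\<delta> > 0" unfolding \<delta>_def using r M1 CC_pos by simp
  have "summable (\<lambda>n. A n * (r + real k * \<delta>) ^ n)" for k
  proof (induction k)
    case (Suc k)
    let ?x = "r + real k * \<delta>"
    have x: "?x \<ge> r" using \<delta> by simp
    then have x0: "?x > 0" using r by simp
    have "(\<Sum>k<N. A (Suc k) * ?x ^ k) \<le> M1 / r" for N
    proof -
      have "r * (\<Sum>k<N. A (Suc k) * ?x ^ k) \<le> ?x * (\<Sum>k<N. A (Suc k) * ?x ^ k)"
        using x x0 A_nonneg by (intro mult_right_mono sum_nonneg) auto
      also have "\<dots> = (\<Sum>k<N. A (Suc k) * ?x ^ (Suc k))" by (simp add: sum_distrib_left mult_ac)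
      also have "\<dots> = (\<Sum>n<Suc N. A n * ?x ^ n)" by (subst sum.lessThan_Suc_shift) simp
      also have "\<dots> \<le> (\<Sum>n. A n * ?x ^ n)" using Suc A_nonneg x0 by (intro sum_le_suminf) auto
      also have "\<dots> \<le> M1" by (rule sum_le[OF x0 Suc])
      finally show ?thesis using r by (simp add: pos_le_divide_eq mult.commute)
    qed
    then have "summable (\<lambda>n. A n * (?x + \<delta>) ^ n)"
      using \<delta> x0 r M1 CC_pos by (intro radius_extends[where r = ?x and M = "M1 / r"]) (auto simp: \<delta>_def)
    then show ?case by (simp add: algebra_simps)
  qed (use r in simp)
  then have "A 1 * (r + real k * \<delta>) \<le> M1" for k using \<delta> r by (intro x_le) (auto intro: add_pos_nonneg)
  moreover obtain k where k: "real k * \<delta> > M1 / A 1" using ex_less_of_nat_mult[OF \<delta>] by blast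
  have "M1 < A 1 * (r + real k * \<delta>)"
    using k r A1 by (simp add: pos_divide_less_eq algebra_simps add_pos_pos) (smt (verit) mult_pos_pos)
  ultimately show False by (smt (verit))
qed

end

section \<open>The one-dimensional manifolds of the two fixed points\<close>

lemma has_vector_derivative_vec:
  fixes f :: "real \<Rightarrow> real^'n"
  assumes "\<And>i. ((\<lambda>t. f t $ i) has_vector_derivative f' $ i) (at t within S)"
  shows "(f has_vector_derivative f') (at t within S)"
  unfolding has_vector_derivative_def
proof (subst has_derivative_componentwise_within, intro ballI)
  fix k :: "real^'n" assume "k \<in> Basis"
  then obtain i where "k = axis i 1" by (auto simp: Basis_vec_def)
  then show "((\<lambda>x. f x \<bullet> k) has_derivative (\<lambda>x. (x *\<^sub>R f') \<bullet> k)) (at t within S)"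
    using assms[of i] by (simp add: inner_axis has_vector_derivative_def)
qed

lemma has_vector_derivative_nth:
  "(f has_vector_derivative f') F \<Longrightarrow> ((\<lambda>t. f t $ i) has_real_derivative f' $ i) F"
  using bounded_linear.has_vector_derivative[OF bounded_linear_vec_nth]
  by (simp add: has_real_derivative_iff_has_vector_derivative)

lemma has_vector_derivative_3:
  fixes f :: "real \<Rightarrow> real^3"
  assumes "((\<lambda>t. f t $ 1) has_real_derivative f' $ 1) (at t within S)"
    "((\<lambda>t. f t $ 2) has_real_derivative f' $ 2) (at t within S)"
    "((\<lambda>t. f t $ 3) has_real_derivative f' $ 3) (at t within S)"
  shows "(f has_vector_derivative f') (at t within S)"
  by (rule has_vector_derivative_vec)
    (use assms in \<open>metis (full_types) exhaust_3 has_real_derivative_iff_has_vector_derivative\<close>)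

lemma roessler_nth [simp]:
  "roessler (a, b, c) v $ 1 = - (v$2) - v$3"
  "roessler (a, b, c) v $ 2 = v$1 + a * v$2"
  "roessler (a, b, c) v $ 3 = b * v$1 + v$3 * (v$1 - c)"
  by (simp_all add: roessler_def)

lemma jacobian_roessler:
  "jacobian (roessler (a, b, c)) (at v) =
     vector [vector [0, -1, -1], vector [1, a, 0], vector [b + v$3, 0, v$1 - c]]" (is "_ = ?J")
proof -
  have "(roessler (a, b, c) has_derivative (\<lambda>h. ?J *v h)) (at v)"
  proof (subst has_derivative_componentwise_within, intro ballI)
    fix k :: "real^3" assume "k \<in> Basis"
    then obtain i where k: "k = axis i 1" by (auto simp: Basis_vec_def)
    consider "i = 1" | "i = 2" | "i = 3" using exhaust_3 by blast
    then show "((\<lambda>x. roessler (a, b, c) x \<bullet> k) has_derivative (\<lambda>h. (?J *v h) \<bullet> k)) (at v)"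
    proof cases
      case 1
      show ?thesis unfolding k inner_axis 1
        by (auto intro!: derivative_eq_intros bounded_linear_imp_has_derivative[OF bounded_linear_vec_nth] simp: matrix_vector_mult_def sum_3 fun_eq_iff)
    next
      case 2
      show ?thesis unfolding k inner_axis 2
        by (auto intro!: derivative_eq_intros bounded_linear_imp_has_derivative[OF bounded_linear_vec_nth] simp: matrix_vector_mult_def sum_3 fun_eq_iff)
    next
      case 3
      show ?thesis unfolding k inner_axis 3
        by (auto intro!: derivative_eq_intros bounded_linear_imp_has_derivative[OF bounded_linear_vec_nth] simp: matrix_vector_mult_def sum_3 fun_eq_iff algebra_simps)
    qed
  qed
  then have "frechet_derivative (roessler (a, b, c)) (at v) = (\<lambda>h. ?J *v h)"
    by (metis frechet_derivative_at)
  then show ?thesis unfolding jacobian_def by (simp add: matrix_of_matrix_vector_mul)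
qed

text \<open>The spectrum is given as a set of roots, without multiplicities. The real and imaginary
  parts of the equation at the complex root determine \<open>p1\<close> and \<open>p0\<close> from
  \<open>p2\<close>; the real root then determines \<open>p2\<close>.\<close>

lemma spectrum_char_poly:
  assumes sp: "spectrum_data (jacobian (roessler (a, b, c)) (at v)) \<gamma> \<rho> \<omega>"
    and d: "d = c - v$1" and e: "e = b + v$3"
  shows "(l + d) * (l\<^sup>2 - a * l + 1) - e * (a - l) = (l - \<gamma>) * ((l - \<rho>)\<^sup>2 + \<omega>\<^sup>2)"
proof -
  define p2 p1 p0 where "p2 = d - a" and "p1 = 1 - a * d + e" and "p0 = d - e * a"
  have eig: "cplx_eigenvalues (jacobian (roessler (a, b, c)) (at v))
      = {z. z ^ 3 + of_real p2 * z ^ 2 + of_real p1 * z + of_real p0 = 0}"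
    unfolding cplx_eigenvalues_def jacobian_roessler
    by (auto simp: det_3 complexify_def mat_def d e p2_def p1_def p0_def power2_eq_square power3_eq_cube algebra_simps)
  have w: "\<omega> \<noteq> 0" using sp by (simp add: spectrum_data_def)
  have in1: "complex_of_real \<gamma> \<in> {z. z ^ 3 + of_real p2 * z ^ 2 + of_real p1 * z + of_real p0 = 0}"
    and in2: "Complex \<rho> \<omega> \<in> {z. z ^ 3 + of_real p2 * z ^ 2 + of_real p1 * z + of_real p0 = 0}"
    using sp eig by (auto simp: spectrum_data_def)
  have g: "\<gamma> ^ 3 + p2 * \<gamma> ^ 2 + p1 * \<gamma> + p0 = 0"
  proof -
    have "complex_of_real (\<gamma> ^ 3 + p2 * \<gamma> ^ 2 + p1 * \<gamma> + p0) = 0" using in1 by simp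
    then show ?thesis by (simp only: of_real_eq_0_iff)
  qed
  have "Re (Complex \<rho> \<omega> ^ 3 + of_real p2 * Complex \<rho> \<omega> ^ 2 + of_real p1 * Complex \<rho> \<omega> + of_real p0) = 0"
    "Im (Complex \<rho> \<omega> ^ 3 + of_real p2 * Complex \<rho> \<omega> ^ 2 + of_real p1 * Complex \<rho> \<omega> + of_real p0) = 0"
    using in2 by simp_all
  then have re: "\<rho> ^ 3 - 3 * \<rho> * \<omega>\<^sup>2 + p2 * (\<rho>\<^sup>2 - \<omega>\<^sup>2) + p1 * \<rho> + p0 = 0"
    and im: "\<omega> * (3 * \<rho>\<^sup>2 - \<omega>\<^sup>2 + 2 * p2 * \<rho> + p1) = 0"
    by (simp_all add: power2_eq_square power3_eq_cube algebra_simps)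
  \<comment> \<open>That \<open>q\<close> vanishes is Vieta's formula for the sum of the roots. The
    remaining equation is \<open>q\<close> times the squared distance of the real root from the
    complex one, which is positive.\<close>
  define q where "q = p2 + \<gamma> + 2 * \<rho>"
  have im': "p1 = \<omega>\<^sup>2 - 3 * \<rho>\<^sup>2 - 2 * p2 * \<rho>" using im w by simp
  have p0': "p0 = 2 * \<rho> * \<omega>\<^sup>2 + 2 * \<rho> ^ 3 + p2 * (\<rho>\<^sup>2 + \<omega>\<^sup>2)"
    using re unfolding im' by (simp add: power2_eq_square power3_eq_cube algebra_simps)
  have "q * ((\<gamma> - \<rho>)\<^sup>2 + \<omega>\<^sup>2) = 0"
    using g unfolding p0' im' q_def by (simp add: power2_eq_square power3_eq_cube algebra_simps)
  moreover have "(\<gamma> - \<rho>)\<^sup>2 + \<omega>\<^sup>2 > 0" using w by (simp add: add_nonneg_pos)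
  ultimately have "q = 0" by (metis less_irrefl mult_eq_0_iff)
  then have p2: "p2 = - \<gamma> - 2 * \<rho>" unfolding q_def by simp
  have "(l + d) * (l\<^sup>2 - a * l + 1) - e * (a - l) = l ^ 3 + p2 * l\<^sup>2 + p1 * l + p0"
    by (simp add: p2_def p1_def p0_def power2_eq_square power3_eq_cube algebra_simps)
  also have "\<dots> = (l - \<gamma>) * ((l - \<rho>)\<^sup>2 + \<omega>\<^sup>2)"
    unfolding p0' im' unfolding p2 by (simp add: power2_eq_square power3_eq_cube algebra_simps)
  finally show ?thesis .
qed

lemma deviation_solution:
  assumes "roessler (a, b, c) P = 0"
    and "(S has_real_derivative a * S t - X t) (at t within T)"
    and "(X has_real_derivative S t - U t) (at t within T)"
    and "(U has_real_derivative - (c - P$1) * U t + (b + P$3) * X t + U t * X t) (at t within T)"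
    and v: "v = (\<lambda>t. P + vector [X t, - S t, U t])"
  shows "(v has_vector_derivative roessler (a, b, c) (v t)) (at t within T)"
proof -
  have "roessler (a, b, c) P $ i = 0" for i using assms(1) by simp
  from this[of 1] this[of 2] this[of 3]
  have P: "P$3 = - (P$2)" "P$1 = - a * P$2" "b * P$1 + P$3 * (P$1 - c) = 0" by simp_all
  show ?thesis
  proof (rule has_vector_derivative_3)
    show "((\<lambda>t. v t $ 1) has_real_derivative roessler (a, b, c) (v t) $ 1) (at t within T)"
      using P by (auto simp: v intro!: derivative_eq_intros assms)
    show "((\<lambda>t. v t $ 2) has_real_derivative roessler (a, b, c) (v t) $ 2) (at t within T)"
      using P by (auto simp: v algebra_simps intro!: derivative_eq_intros assms)
    show "((\<lambda>t. v t $ 3) has_real_derivative roessler (a, b, c) (v t) $ 3) (at t within T)"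
    proof -
      have "((\<lambda>t. v t $ 3) has_real_derivative 0 + (- (c - P$1) * U t + (b + P$3) * X t + U t * X t)) (at t within T)"
        unfolding v vector_add_component vector_3 by (intro DERIV_add DERIV_const assms)
      also have "0 + (- (c - P$1) * U t + (b + P$3) * X t + U t * X t) = roessler (a, b, c) (v t) $ 3"
        using P(3) by (simp add: v algebra_simps)
      finally show ?thesis .
    qed
  qed
qed

locale fast_branch = fast_mode a d e \<mu> \<rho> \<omega> \<sigma> for a d e \<mu> \<rho> \<omega> \<sigma> +
  fixes b c :: real and P :: "real^3"
  assumes fixp: "roessler (a, b, c) P = 0" and d: "d = c - P$1" and e: "e = b + P$3"
begin

text \<open>The parameter is chosen so that the flow acts as
  \<open>x \<mapsto> x * exp (\<mu> * t)\<close>; the second sign is negative because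
  \<open>S\<close> measures \<open>b - y\<close>.\<close>

definition "branch x = P + vector [pX x, - pS x, pU x]"

lemma branch_nth: "branch x $ 1 = P$1 + pX x" "branch x $ 2 = P$2 - pS x" "branch x $ 3 = P$3 + pU x"
  by (simp_all add: branch_def)

lemma branch_solution:
  assumes "summable (\<lambda>n. A n * R ^ n)" "\<bar>w * exp (\<mu> * t)\<bar> < R"
  shows "((\<lambda>t. branch (w * exp (\<mu> * t))) has_vector_derivative
     roessler (a, b, c) (branch (w * exp (\<mu> * t)))) (at t within T)"
  using mode_solution[OF assms] unfolding branch_def
  by (intro deviation_solution[OF fixp, where S = "\<lambda>t. pS (w * exp (\<mu> * t))" and X = "\<lambda>t. pX (w * exp (\<mu> * t))"
        and U = "\<lambda>t. pU (w * exp (\<mu> * t))"])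
    (auto simp: d e intro: has_field_derivative_at_within)

lemma branch_continuous:
  assumes "summable (\<lambda>n. A n * R ^ n)" "\<bar>x\<bar> < R"
  shows "isCont branch x"
proof -
  have R: "R > 0" "\<bar>R\<bar> \<le> R" "norm x < norm R" using assms by auto
  note s = summable_coeffs[OF assms(1) R(1,2), THEN summable_rabs_cancel]
  have "pS \<midarrow>x\<rightarrow> pS x" "pX \<midarrow>x\<rightarrow> pX x" "pU \<midarrow>x\<rightarrow> pU x"
    using isCont_powser[OF s(1) R(3)] isCont_powser[OF s(2) R(3)] isCont_powser[OF s(3) R(3)]
    by (simp_all only: isCont_def pS_def[symmetric] pX_def[symmetric] pU_def[symmetric])
  then have c: "(\<lambda>x. P$1 + pX x) \<midarrow>x\<rightarrow> P$1 + pX x" "(\<lambda>x. P$2 - pS x) \<midarrow>x\<rightarrow> P$2 - pS x"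
      "(\<lambda>x. P$3 + pU x) \<midarrow>x\<rightarrow> P$3 + pU x"
    by (auto intro!: tendsto_add tendsto_diff tendsto_const)
  have "(\<lambda>x. branch x $ i) \<midarrow>x\<rightarrow> branch x $ i" for i
  proof -
    consider "i = 1" | "i = 2" | "i = 3" using exhaust_3 by blast
    then show ?thesis by cases (simp_all only: branch_nth c)
  qed
  then show ?thesis
    unfolding isCont_def by (rule vec_tendstoI)
qed

lemma branch_0: "branch 0 = P"
proof -
  obtain r where r: "r > 0" "summable (\<lambda>n. A n * r ^ n)" using summable_init by blast
  have "pS 0 = 0" "pX 0 = 0" "pU 0 = 0" by (rule mode_at_0[OF r(2,1)])+
  then show ?thesis by (simp add: vec_eq_iff forall_3 branch_nth)
qed

lemma branch_tendsto: "(branch \<longlongrightarrow> P) (at 0)"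
proof -
  obtain r where "r > 0" "summable (\<lambda>n. A n * r ^ n)" using summable_init by blast
  then have "isCont branch 0" using branch_continuous[of r 0] by simp
  then show ?thesis by (simp add: isCont_def branch_0)
qed

lemma branch_exp_tendsto:
  assumes "LIM t F. \<mu> * t :> at_bot" "w \<noteq> 0"
  shows "((\<lambda>t. branch (w * exp (\<mu> * t))) \<longlongrightarrow> P) F"
proof (rule filterlim_compose[OF branch_tendsto filterlim_atI])
  show "((\<lambda>t. w * exp (\<mu> * t)) \<longlongrightarrow> 0) F"
    by (rule tendsto_mult_right_zero[OF filterlim_compose[OF exp_at_bot assms(1)]])
qed (use assms(2) in simp)

end

lemma good_param_fixpoints:
  assumes "good_param (a, b, c)"
  shows "roessler (a, b, c) P_In = 0" "roessler (a, b, c) (P_Out (a, b, c)) = 0"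
    "roessler (a, b, c) v = 0 \<longleftrightarrow> v = P_In \<or> v = P_Out (a, b, c)"
    "0 < a" "a < 1" "0 < b" "b < 1" "1 < c"
proof -
  have *: "{v. roessler (a, b, c) v = 0} = {P_In, P_Out (a, b, c)}"
    using assms by (simp add: good_param_def)
  then show "roessler (a, b, c) P_In = 0" "roessler (a, b, c) (P_Out (a, b, c)) = 0"
    "roessler (a, b, c) v = 0 \<longleftrightarrow> v = P_In \<or> v = P_Out (a, b, c)" by blast+
  show "0 < a" "a < 1" "0 < b" "b < 1" "1 < c" using assms by (auto simp: good_param_def)
qed

lemma P_In_nth [simp]: "P_In $ i = 0"
  using exhaust_3[of i] by (auto simp: P_In_def)

lemma P_Out_nth: "P_Out (a, b, c) $ 1 = c - a * b" "P_Out (a, b, c) $ 2 = b - c / a" "P_Out (a, b, c) $ 3 = c / a - b"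
  by (simp_all add: P_Out_def)

text \<open>The positive parameters with convergent series form an interval, so their image is
  connected, and \<open>orbit_unbounded\<close> drives the third coordinate to minus infinity along
  it. The four inequalities are recorded because they describe a region that the backward flow
  cannot leave.\<close>

lemma stable_branch:
  assumes g: "good_param (a, b, c)"
  obtains K where "connected K" "K \<subseteq> stable_set (roessler (a, b, c)) P_In - {P_In}"
    "\<And>M. \<exists>v\<in>K. - (v$3) > M"
    "\<And>v. v \<in> K \<Longrightarrow> v$1 < 0 \<and> v$2 > 0 \<and> v$3 < 0 \<and> v$2 < - (v$3)"
proof -
  note gp = good_param_fixpoints[OF g]
  obtain \<mu> \<rho> \<omega> where sp: "spectrum_data (jacobian (roessler (a, b, c)) (at P_In)) \<mu> \<rho> \<omega>" "\<mu> < 0" "0 < \<rho>"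
    using g by (auto simp: good_param_def)
  \<comment> \<open>At the origin \<open>d = c\<close> and \<open>e = b\<close>;
    \<open>\<sigma> = -1\<close> picks the branch with nonpositive coefficients.\<close>
  interpret fast_branch a c b \<mu> \<rho> \<omega> "-1" b c P_In
    using spectrum_char_poly[OF sp(1), of c b] sp gp
    by unfold_locales (auto simp: mult_neg_pos)
  interpret monotone_mode a c b \<mu> \<rho> \<omega> "-1"
    by unfold_locales (use sp gp in auto)
  define I where "I = {x. x > 0 \<and> summable (\<lambda>n. A n * x ^ n)}"
  have I_down: "x \<in> I" if "y \<in> I" "0 < x" "x \<le> y" for x y
    using that A_nonneg unfolding I_def
    by (auto intro!: summable_comparison_test'[of "\<lambda>n. A n * y ^ n" 0] mult_left_mono power_mono)
  have cont: "isCont branch x" if "x \<in> I" for x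
    using summable_open[of x] that branch_continuous unfolding I_def by fastforce
  have "connected I"
    by (rule is_interval_connected) (use I_down in \<open>fastforce simp: is_interval_1 I_def\<close>)
  then have con: "connected (branch ` I)"
    using cont by (intro connected_continuous_image continuous_at_imp_continuous_on) auto
  have signs: "v$1 < 0 \<and> v$2 > 0 \<and> v$3 < 0 \<and> v$2 < - (v$3)" if "v \<in> branch ` I" for v
    using that orbit_signs unfolding I_def by (auto simp: branch_nth)
  have "branch ` I \<subseteq> stable_set (roessler (a, b, c)) P_In - {P_In}"
  proof (clarify, intro DiffI)
    fix w assume w: "w \<in> I"
    show "branch w \<notin> {P_In}" using signs[of "branch w"] w by auto
    obtain R where R: "R > w" "summable (\<lambda>n. A n * R ^ n)" using summable_open w unfolding I_def by blast
    have w0: "w > 0" using w by (simp add: I_def)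
    define x where "x t = branch (w * exp (\<mu> * t))" for t
    have "(x has_vector_derivative roessler (a, b, c) (x t)) (at t within {0..})" if "t \<ge> 0" for t
    proof -
      have "w * exp (\<mu> * t) \<le> w * 1" using w0 that sp(2) by (intro mult_left_mono) (auto simp: mult_nonpos_nonneg)
      moreover have "0 < w * exp (\<mu> * t)" using w0 by simp
      ultimately have "\<bar>w * exp (\<mu> * t)\<bar> < R" using R by linarith
      then show ?thesis unfolding x_def by (intro branch_solution[OF R(2)])
    qed
    moreover have "(x \<longlongrightarrow> P_In) at_top"
      unfolding x_def using sp(2) w0
      by (intro branch_exp_tendsto filterlim_tendsto_neg_mult_at_bot[OF tendsto_const] filterlim_ident) auto
    moreover have "x 0 = branch w" by (simp add: x_def)
    ultimately show "branch w \<in> stable_set (roessler (a, b, c)) P_In" unfolding stable_set_def by blast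
  qed
  moreover have "\<exists>v\<in>branch ` I. - (v$3) > M" for M
    using orbit_unbounded[of M] by (auto simp: I_def branch_nth)
  ultimately show thesis using con signs that by blast
qed

text \<open>\<open>lyap\<close> grows exponentially along the flow near \<open>P_Out\<close>: writing \<open>u = z + b\<close>, the quantity
  \<open>ln u - y\<close> has derivative \<open>x - c + b c / u - y'\<close>, and convexity of \<open>ln\<close> and \<open>1 / u\<close> bounds the
  nonlinear terms by their linearisations, always on the same side.\<close>

definition lyap :: "real \<Rightarrow> real \<Rightarrow> real \<Rightarrow> real \<Rightarrow> real \<Rightarrow> real \<Rightarrow> real \<Rightarrow> real \<Rightarrow> real" where
  "lyap a d e \<mu> \<rho> S X u = a * S - X - 2 * \<rho> * S + (e / \<mu>) * (ln (u / e) + S - (d / e) * X)"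

text \<open>At \<open>P_Out\<close> one has \<open>z + b = c / a\<close> and
  \<open>c - x = a * b\<close>, which are the values of \<open>e\<close> and
  \<open>d\<close>.\<close>

definition lyap_at :: "real \<times> real \<times> real \<Rightarrow> real \<Rightarrow> real \<Rightarrow> real^3 \<Rightarrow> real" where
  "lyap_at p \<mu> \<rho> v = (case p of (a, b, c) \<Rightarrow>
     lyap a (a * b) (c / a) \<mu> \<rho> (b - c / a - v$2) (v$1 - (c - a * b)) (v$3 + b))"

text \<open>On the branch with \<open>\<sigma> = 1\<close>, \<open>lyap\<close> vanishes at the
  fixed point and has positive slope there, so a point close to \<open>P_Out\<close> already has the
  sign that starts the growth.\<close>

lemma unstable_branch:
  assumes g: "good_param (a, b, c)"
  obtains \<mu> \<rho> \<omega> x where "\<mu> > 0" "\<rho> < 0"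
    "\<And>l. (l + a * b) * (l\<^sup>2 - a * l + 1) - (c / a) * (a - l) = (l - \<mu>) * ((l - \<rho>)\<^sup>2 + \<omega>\<^sup>2)"
    "\<And>t. t \<le> 0 \<Longrightarrow> (x has_vector_derivative roessler (a, b, c) (x t)) (at t within {..0})"
    "(x \<longlongrightarrow> P_Out (a, b, c)) at_bot"
    "x 0 $ 3 + b > 0" "lyap_at (a, b, c) \<mu> \<rho> (x 0) > 0"
proof -
  note gp = good_param_fixpoints[OF g]
  obtain \<mu> \<rho> \<omega> where sp: "spectrum_data (jacobian (roessler (a, b, c)) (at (P_Out (a, b, c)))) \<mu> \<rho> \<omega>" "0 < \<mu>" "\<rho> < 0"
    using g by (auto simp: good_param_def)
  define d e where "d = a * b" and "e = c / a"
  have e0: "e > 0" using gp by (simp add: e_def)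
  have ch: "(l + d) * (l\<^sup>2 - a * l + 1) - e * (a - l) = (l - \<mu>) * ((l - \<rho>)\<^sup>2 + \<omega>\<^sup>2)" for l
    using spectrum_char_poly[OF sp(1), of d e] by (simp add: P_Out_nth d_def e_def)
  interpret fast_branch a d e \<mu> \<rho> \<omega> 1 b c "P_Out (a, b, c)"
    using ch sp gp by unfold_locales (auto simp: mult_pos_neg P_Out_nth d_def e_def)
  obtain r where r: "r > 0" "summable (\<lambda>n. A n * r ^ n)" using summable_init by blast
  note ps = mode_at_0[OF r(2,1)]
  define h where "h w = lyap a d e \<mu> \<rho> (pS w) (pX w) (e + pU w)" for w
  have "(h has_real_derivative a - (a - \<mu>) - 2 * \<rho> + (e / \<mu>) * ((\<mu>\<^sup>2 - a * \<mu> + 1) / e + 1 - (d / e) * (a - \<mu>))) (at 0)"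
  proof -
    have "((\<lambda>w. (e + pU w) / e) has_real_derivative (\<mu>\<^sup>2 - a * \<mu> + 1) / e) (at 0)"
      using DERIV_cdivide[OF DERIV_add[OF DERIV_const ps(3)], of e e] by simp
    from DERIV_chain2[OF DERIV_ln this] have l: "((\<lambda>w. ln ((e + pU w) / e)) has_real_derivative (\<mu>\<^sup>2 - a * \<mu> + 1) / e) (at 0)"
      using e0 ps(6) by simp
    have "((\<lambda>w. a * pS w - pX w - 2 * \<rho> * pS w + (e / \<mu>) * (ln ((e + pU w) / e) + pS w - (d / e) * pX w))
       has_real_derivative a * 1 - (a - \<mu>) * 1 - 2 * \<rho> * 1 + (e / \<mu>) * ((\<mu>\<^sup>2 - a * \<mu> + 1) / e + 1 - (d / e) * ((a - \<mu>) * 1))) (at 0)"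
      using ps(1,2) l by (intro DERIV_add DERIV_diff DERIV_cmult) simp_all
    then show ?thesis unfolding h_def lyap_def by simp
  qed
  \<comment> \<open>The slope pairs the linear part of \<open>lyap\<close> with the tangent of the
    branch. By the coefficient identities from \<open>ch\<close> it equals \<open>\<mu> - 2 * \<rho>
    + (\<rho>\<^sup>2 + \<omega>\<^sup>2) / \<mu>\<close>, a sum of positive terms as
    \<open>\<rho> < 0\<close>.\<close>
  moreover have "a - (a - \<mu>) - 2 * \<rho> + (e / \<mu>) * ((\<mu>\<^sup>2 - a * \<mu> + 1) / e + 1 - (d / e) * (a - \<mu>)) > 0"
  proof -
    have c0: "d - e * a = - \<mu> * (\<rho>\<^sup>2 + \<omega>\<^sup>2)" using ch[of 0] by simp
    have c1: "(1 + d) * (2 - a) - e * (a - 1) = (1 - \<mu>) * ((1 - \<rho>)\<^sup>2 + \<omega>\<^sup>2)" using ch[of 1] by simp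
    have c2: "(d - 1) * (2 + a) - e * (a + 1) = (- 1 - \<mu>) * ((1 + \<rho>)\<^sup>2 + \<omega>\<^sup>2)" using ch[of "-1"]
      by (simp add: power2_eq_square algebra_simps)
    have q: "d - a = - \<mu> - 2 * \<rho>" "1 - a * d + e = \<rho>\<^sup>2 + \<omega>\<^sup>2 + 2 * \<mu> * \<rho>"
      using c0 c1 c2 by (simp_all add: power2_eq_square algebra_simps)
    have "a - (a - \<mu>) - 2 * \<rho> + (e / \<mu>) * ((\<mu>\<^sup>2 - a * \<mu> + 1) / e + 1 - (d / e) * (a - \<mu>))
        = \<mu> - 2 * \<rho> + (\<mu>\<^sup>2 + \<mu> * (d - a) + (1 - a * d + e)) / \<mu>"
      using e0 sp(2) by (simp add: field_simps)
    also have "\<dots> = \<mu> - 2 * \<rho> + (\<rho>\<^sup>2 + \<omega>\<^sup>2) / \<mu>"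
      unfolding q using sp(2) by (simp add: field_simps power2_eq_square)
    also have "\<dots> > 0" using sp(2,3) by (intro add_pos_nonneg) auto
    finally show ?thesis .
  qed
  ultimately obtain \<delta> where \<delta>: "\<delta> > 0" "\<And>w. 0 < w \<Longrightarrow> w < \<delta> \<Longrightarrow> h 0 < h w"
    using DERIV_pos_inc_right[of h _ 0] by auto
  have h0: "h 0 = 0" using e0 ps by (simp add: h_def lyap_def)
  have "(pU \<longlongrightarrow> 0) (at 0)" using DERIV_isCont[OF ps(3)] ps(6) by (simp add: isCont_def)
  then have "\<forall>\<^sub>F w in at 0. pU w > - e" using e0 by (intro order_tendstoD) auto
  then obtain \<delta>' where \<delta>': "\<delta>' > 0" "\<And>w. w \<noteq> 0 \<Longrightarrow> \<bar>w\<bar> < \<delta>' \<Longrightarrow> pU w > - e"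
    unfolding eventually_at by (auto simp: dist_real_def)
  define w where "w = min r (min \<delta> \<delta>') / 2"
  have w: "0 < w" "w < r" "w < \<delta>" "w < \<delta>'" using r(1) \<delta>(1) \<delta>'(1) by (auto simp: w_def)
  define x where "x t = branch (w * exp (\<mu> * t))" for t
  have x0: "x 0 = branch w" by (simp add: x_def)
  show thesis
  proof (rule that[OF sp(2,3)])
    show "(l + a * b) * (l\<^sup>2 - a * l + 1) - (c / a) * (a - l) = (l - \<mu>) * ((l - \<rho>)\<^sup>2 + \<omega>\<^sup>2)" for l
      using ch by (simp add: d_def e_def)
    show "(x has_vector_derivative roessler (a, b, c) (x t)) (at t within {..0})" if "t \<le> 0" for t
    proof -
      have "w * exp (\<mu> * t) \<le> w * 1" using w that sp(2) by (intro mult_left_mono) (auto simp: mult_nonneg_nonpos)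
      moreover have "0 < w * exp (\<mu> * t)" using w by simp
      ultimately have "\<bar>w * exp (\<mu> * t)\<bar> < r" using w by linarith
      then show ?thesis unfolding x_def by (intro branch_solution[OF r(2)])
    qed
    show "(x \<longlongrightarrow> P_Out (a, b, c)) at_bot"
      unfolding x_def using sp(2) w
      by (intro branch_exp_tendsto filterlim_tendsto_pos_mult_at_bot[OF tendsto_const] filterlim_ident) auto
    have "pU w > - e" using \<delta>'(2)[of w] w by simp
    then show "x 0 $ 3 + b > 0" by (simp add: x0 branch_nth P_Out_nth e_def)
    show "lyap_at (a, b, c) \<mu> \<rho> (x 0) > 0"
      using \<delta>(2)[of w] w h0 by (simp add: x0 branch_nth P_Out_nth h_def d_def e_def lyap_at_def)
  qed
qed

section \<open>Leaving bounded sets\<close>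

text \<open>A bootstrap principle: positivity at \<open>t\<close> may be proved assuming it at all
  earlier times, since a first zero would violate that step.\<close>

lemma first_exit:
  fixes f :: "real \<Rightarrow> real"
  assumes "continuous_on {0..T} f" "f 0 > 0"
    and "\<And>t. t \<in> {0<..T} \<Longrightarrow> (\<And>s. s \<in> {0..<t} \<Longrightarrow> f s > 0) \<Longrightarrow> f t > 0"
    and "t \<in> {0..T}"
  shows "f t > 0"
proof (rule ccontr)
  assume n: "\<not> f t > 0"
  have "continuous_on {0..t} f" using assms(1,4) by (auto elim: continuous_on_subset)
  then obtain s where s: "s \<in> {0<..t}" "f s = 0" "\<And>r. r \<in> {0..<s} \<Longrightarrow> f r > 0"
    using first_zero[of t f] n assms(2,4) by auto
  have "f s > 0" by (rule assms(3)[OF _ s(3)]) (use s(1) assms(4) in auto)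
  then show False using s(2) by simp
qed

text \<open>The bound on \<open>D\<close> is asked on the open interval only, because in a bootstrap
  nothing is known yet at the end point.\<close>

lemma derivative_lower_bound:
  fixes f :: "real \<Rightarrow> real"
  assumes d: "\<And>s. s \<in> {0..T} \<Longrightarrow> (f has_real_derivative D s) (at s within {0..T})"
    and k: "\<And>s. s \<in> {0<..<t} \<Longrightarrow> D s \<ge> k" and t: "t \<in> {0..T}"
  shows "f t \<ge> f 0 + k * t"
proof -
  have "f 0 - k * 0 \<le> f t - k * t"
  proof (rule DERIV_nonneg_imp_increasing_open[of 0 t "\<lambda>x. f x - k * x"])
    show "0 \<le> t" using t by simp
    have "continuous_on {0..T} f"
      unfolding continuous_on_eq_continuous_within by (auto intro: DERIV_continuous d)
    then show "continuous_on {0..t} (\<lambda>x. f x - k * x)"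
      using t by (intro continuous_intros) (auto elim: continuous_on_subset)
    fix s assume s: "0 < s" "s < t"
    then have "(f has_real_derivative D s) (at s)"
      using d[of s] t at_within_Icc_at[of 0 s T] by auto
    then have "((\<lambda>x. f x - k * x) has_real_derivative D s - k) (at s)"
      by (auto intro!: derivative_eq_intros)
    then show "\<exists>y. ((\<lambda>x. f x - k * x) has_real_derivative y) (at s) \<and> 0 \<le> y"
      using k[of s] s by (intro exI[of _ "D s - k"]) simp
  qed
  then show ?thesis by simp
qed

lemma sol_continuous:
  assumes "\<And>t. t \<in> S \<Longrightarrow> (y has_vector_derivative f t) (at t within S)"
  shows "continuous_on S y"
  using assms has_vector_derivative_continuous unfolding continuous_on_eq_continuous_within by fast

text \<open>The left-hand side is the derivative of \<open>lyap\<close> along the flow. The linear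
  part of \<open>lyap\<close> at the fixed point is a left eigenvector to \<open>\<mu>\<close>, so
  the first-order terms cancel; what remains are the errors of \<open>e / u\<close> and
  \<open>ln (u / e)\<close> against their tangents at \<open>u = e\<close>.\<close>

lemma lyap_growth_pointwise:
  assumes ch: "\<And>l. (l + d) * (l\<^sup>2 - a * l + 1) - e * (a - l) = (l - \<mu>) * ((l - \<rho>)\<^sup>2 + \<omega>\<^sup>2)"
    and pos: "\<mu> > 0" "u > 0" "e > 0" "d \<ge> 0"
  shows "a * (a * S - X) - (S - (u - e)) - 2 * \<rho> * (a * S - X)
      + (e / \<mu>) * ((u * (X - d) + e * d) / u + (a * S - X) - (d / e) * (S - (u - e))) \<ge> \<mu> * lyap a d e \<mu> \<rho> S X u"
proof -
  define m0 where "m0 = \<rho>\<^sup>2 + \<omega>\<^sup>2"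
  \<comment> \<open>Evaluation at 0, 1 and -1 recovers the coefficients of the two monic
    cubics.\<close>
  have c0: "d - e * a = - \<mu> * m0" using ch[of 0] by (simp add: m0_def)
  have q: "d - a = - \<mu> - 2 * \<rho>" "1 - a * d + e = m0 + 2 * \<mu> * \<rho>"
    using ch[of 0] ch[of 1] ch[of "-1"] by (simp_all add: m0_def power2_eq_square algebra_simps)
  have "(e / \<mu>) * ((u * (X - d) + e * d) / u + (a * S - X) - (d / e) * (S - (u - e))) \<ge> m0 * S"
  proof -
    have "e / u \<ge> 2 - u / e"
    proof -
      have "0 \<le> (u - e)\<^sup>2 / (u * e)" using pos by simp
      also have "(u - e)\<^sup>2 / (u * e) = e / u - 2 + u / e"
        using pos by (simp add: field_simps power2_eq_square)
      finally show ?thesis by simp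
    qed
    then have "d * (e / u) \<ge> d * (2 - u / e)" using pos by (intro mult_left_mono) auto
    moreover have "(u * (X - d) + e * d) / u + (a * S - X) - (d / e) * (S - (u - e))
        = d * (e / u) - d * (2 - u / e) + (a - d / e) * S"
      using pos by (simp add: field_simps)
    ultimately have "(u * (X - d) + e * d) / u + (a * S - X) - (d / e) * (S - (u - e)) \<ge> (a - d / e) * S" by simp
    then have "(e / \<mu>) * ((u * (X - d) + e * d) / u + (a * S - X) - (d / e) * (S - (u - e))) \<ge> (e / \<mu>) * ((a - d / e) * S)"
      using pos by (intro mult_left_mono) auto
    also have "(e / \<mu>) * ((a - d / e) * S) = ((e * a - d) / \<mu>) * S" using pos by (simp add: field_simps)
    also have "(e * a - d) / \<mu> = m0" using c0 pos by (simp add: field_simps)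
    finally show ?thesis .
  qed
  moreover have "\<mu> * lyap a d e \<mu> \<rho> S X u \<le> \<mu> * (a * S - X) - 2 * \<rho> * \<mu> * S + (u - e) + e * S - d * X"
  proof -
    have "ln (u / e) \<le> u / e - 1" using pos by (intro ln_le_minus_one) simp
    then have "e * ln (u / e) \<le> e * (u / e - 1)" using pos by (intro mult_left_mono) auto
    also have "\<dots> = u - e" using pos by (simp add: field_simps)
    finally have "e * ln (u / e) \<le> u - e" .
    moreover have "\<mu> * lyap a d e \<mu> \<rho> S X u
        = \<mu> * (a * S - X) - 2 * \<rho> * \<mu> * S + e * ln (u / e) + e * S - d * X"
      using pos by (simp add: lyap_def field_simps)
    ultimately show ?thesis by simp
  qed
  moreover have "a * (a * S - X) - (S - (u - e)) - 2 * \<rho> * (a * S - X) + m0 * S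
     - (\<mu> * (a * S - X) - 2 * \<rho> * \<mu> * S + (u - e) + e * S - d * X) = 0"
  proof -
    have eq: "a - 2 * \<rho> - \<mu> = d" "m0 + 2 * \<mu> * \<rho> - 1 - e = - a * d" using q by simp_all
    have eq': "a * (a * S - X) - (S - (u - e)) - 2 * \<rho> * (a * S - X) + m0 * S
       - (\<mu> * (a * S - X) - 2 * \<rho> * \<mu> * S + (u - e) + e * S - d * X)
      = (a - 2 * \<rho> - \<mu>) * (a * S - X) + d * X + (m0 + 2 * \<mu> * \<rho> - 1 - e) * S"
      by (simp add: algebra_simps)
    show ?thesis unfolding eq' eq by (simp add: algebra_simps)
  qed
  ultimately show ?thesis by linarith
qed

text \<open>The upward field does not enter the derivatives of \<open>S\<close> and
  \<open>X\<close>; it adds \<open>k2 * (c / a / \<mu>) / u\<close> to the growth of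
  \<open>lyap\<close>, which is bounded below since \<open>u \<le> M\<close>. With
  \<open>k1 + k2 \<ge> 1\<close> the growth rate is thus at least the smaller of the two individual
  rates.\<close>

lemma lyap_along_perturbed_flow:
  fixes y :: "real \<Rightarrow> real^3"
  assumes ch: "\<And>l. (l + a * b) * (l\<^sup>2 - a * l + 1) - (c / a) * (a - l) = (l - \<mu>) * ((l - \<rho>)\<^sup>2 + \<omega>\<^sup>2)"
    and pos: "0 < \<mu>" "0 < a" "0 < b" "0 < c"
    and G: "\<And>v. v \<in> B \<Longrightarrow> G v = k1 v *\<^sub>R roessler (a, b, c) v + k2 v *\<^sub>R axis 3 1"
    and k: "\<And>v. v \<in> B \<Longrightarrow> 0 \<le> k1 v \<and> k1 v \<le> 1 \<and> 0 \<le> k2 v \<and> 1 \<le> k1 v + k2 v"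
    and y: "\<And>t. t \<in> {0..T} \<Longrightarrow> y t \<in> B \<and> (y has_vector_derivative G (y t)) (at t within {0..T})"
    and B: "\<And>v. v \<in> B \<Longrightarrow> \<bar>v$1 - c\<bar> \<le> M \<and> v$3 + b \<le> M" and "0 < M"
    and y0: "y 0 $ 3 + b > 0" "lyap_at (a, b, c) \<mu> \<rho> (y 0) > 0"
    and t: "t \<in> {0..T}"
  shows "y t $ 3 + b > 0"
    and "lyap_at (a, b, c) \<mu> \<rho> (y t) \<ge> lyap_at (a, b, c) \<mu> \<rho> (y 0)
        + min (\<mu> * (lyap_at (a, b, c) \<mu> \<rho> (y 0) / 2)) (c / a / (\<mu> * M)) * t"
proof -
  let ?h = "lyap_at (a, b, c) \<mu> \<rho>"
  have yc: "continuous_on {0..T} y" using y by (intro sol_continuous) auto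
  have y': "((\<lambda>t. y t $ i) has_real_derivative G (y t) $ i) (at t within {0..T})" if "t \<in> {0..T}" for t i
    by (rule has_vector_derivative_nth) (use y[OF that] in simp)
  note yci = continuous_on_component[OF yc]
  have G': "G v $ 1 = k1 v * (- (v$2) - v$3)" "G v $ 2 = k1 v * (v$1 + a * v$2)"
     "G v $ 3 = k1 v * (b * v$1 + v$3 * (v$1 - c)) + k2 v" if "v \<in> B" for v
    using G[OF that] by (simp_all add: axis_def)
  have u_pos: "y t $ 3 + b > 0" if "t \<in> {0..T}" for t
  proof (rule first_exit[of T "\<lambda>t. y t $ 3 + b", OF _ y0(1) _ that])
    show "continuous_on {0..T} (\<lambda>t. y t $ 3 + b)" by (intro continuous_intros yci)
    fix t assume t: "t \<in> {0<..T}" and bef: "\<And>s. s \<in> {0..<t} \<Longrightarrow> 0 < y s $ 3 + b"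
    \<comment> \<open>With \<open>u = z + b\<close> the derivative of \<open>u\<close> is at least
      \<open>- M * u\<close>, as both \<open>b * c\<close> and the upward field push it up; the
      integrating factor \<open>exp (M * t)\<close> keeps \<open>u\<close> positive, as the
      logarithm needs.\<close>
    have "(y t $ 3 + b) * exp (M * t) \<ge> (y 0 $ 3 + b) * exp (M * 0) + 0 * t"
    proof (rule derivative_lower_bound)
      show "((\<lambda>t. (y t $ 3 + b) * exp (M * t)) has_real_derivative
          (G (y s) $ 3 + M * (y s $ 3 + b)) * exp (M * s)) (at s within {0..T})" if "s \<in> {0..T}" for s
        by (auto intro!: derivative_eq_intros y'[OF that] simp: algebra_simps)
      fix s assume s: "s \<in> {0<..<t}"
      then have sB: "y s \<in> B" using y[of s] t by auto
      let ?u = "y s $ 3 + b" and ?x = "y s $ 1 - c"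
      have "G (y s) $ 3 = k1 (y s) * (?u * ?x) + k1 (y s) * (b * c) + k2 (y s)"
        by (simp add: G'[OF sB] algebra_simps)
      moreover have "k1 (y s) * (?u * ?x) \<ge> - (M * ?u)"
      proof -
        have "k1 (y s) * ?x \<ge> - M" using k[OF sB] B[OF sB] mult_mono[of "k1 (y s)" 1 "\<bar>?x\<bar>" M]
            abs_mult[of "k1 (y s)" ?x] abs_ge_minus_self[of "k1 (y s) * ?x"] by simp
        then have "(k1 (y s) * ?x) * ?u \<ge> - M * ?u" using bef[of s] s by (intro mult_right_mono) auto
        then show ?thesis by (simp add: mult_ac)
      qed
      moreover have "k1 (y s) * (b * c) \<ge> 0" "k2 (y s) \<ge> 0" using k[OF sB] pos by auto
      ultimately show "0 \<le> (G (y s) $ 3 + M * ?u) * exp (M * s)" by simp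
    qed (use t in auto)
    then have "(y t $ 3 + b) * exp (M * t) > 0" using y0(1) by simp
    then show "y t $ 3 + b > 0" by (simp add: zero_less_mult_iff)
  qed
  show "y t $ 3 + b > 0" by (rule u_pos[OF t])
  define H where "H t = ?h (y t)" for t
  define H' where "H' t = k1 (y t) * \<mu> * H t + k2 (y t) * (c / a / (\<mu> * M))" for t
  have H: "\<exists>D \<ge> H' t. (H has_real_derivative D) (at t within {0..T})" if t: "t \<in> {0..T}" for t
  proof -
    define S X u where "S = b - c / a - y t $ 2" and "X = y t $ 1 - (c - a * b)" and "u = y t $ 3 + b"
    have tB: "y t \<in> B" using y[OF t] by simp
    have u: "u > 0" using u_pos[OF t] by (simp add: u_def)
    have e: "c / a > 0" using pos by simp
    define D1 where "D1 = k1 (y t) * (a * S - X)"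
    define D2 where "D2 = k1 (y t) * (S - (u - c / a))"
    define D3 where "D3 = k1 (y t) * (u * (X - a * b) + (c / a) * (a * b)) + k2 (y t)"
    have dS: "((\<lambda>t. b - c / a - y t $ 2) has_real_derivative D1) (at t within {0..T})"
      using pos by (auto intro!: derivative_eq_intros y'[OF t] simp: G'[OF tB] D1_def S_def X_def field_simps)
    have dX: "((\<lambda>t. y t $ 1 - (c - a * b)) has_real_derivative D2) (at t within {0..T})"
      by (auto intro!: derivative_eq_intros y'[OF t] simp: G'[OF tB] D2_def S_def u_def field_simps)
    have dU: "((\<lambda>t. y t $ 3 + b) has_real_derivative D3) (at t within {0..T})"
      using pos by (auto intro!: derivative_eq_intros y'[OF t] simp: G'[OF tB] D3_def X_def u_def field_simps)
    have dL: "((\<lambda>t. ln ((y t $ 3 + b) / (c / a))) has_real_derivative D3 / u) (at t within {0..T})"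
    proof -
      have "(y t $ 3 + b) / (c / a) > 0" using u e unfolding u_def by (rule divide_pos_pos)
      from DERIV_chain2[OF DERIV_ln[OF this] DERIV_cdivide[OF dU]]
      have "((\<lambda>t. ln ((y t $ 3 + b) / (c / a))) has_real_derivative inverse (u / (c / a)) * (D3 / (c / a))) (at t within {0..T})"
        by (simp only: u_def)
      also have "inverse (u / (c / a)) * (D3 / (c / a)) = D3 / u"
        using u pos by (simp add: field_simps)
      finally show ?thesis .
    qed
    have "(H has_real_derivative a * D1 - D2 - 2 * \<rho> * D1 + (c / a / \<mu>) * (D3 / u + D1 - (a * b / (c / a)) * D2)) (at t within {0..T})"
      unfolding H_def lyap_at_def lyap_def prod.case by (intro DERIV_add DERIV_diff DERIV_cmult dS dX dL)
    moreover have "a * D1 - D2 - 2 * \<rho> * D1 + (c / a / \<mu>) * (D3 / u + D1 - (a * b / (c / a)) * D2) \<ge> H' t"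
    proof -
      define Q where "Q = a * (a * S - X) - (S - (u - c / a)) - 2 * \<rho> * (a * S - X)
        + (c / a / \<mu>) * ((u * (X - a * b) + c / a * (a * b)) / u + (a * S - X) - (a * b / (c / a)) * (S - (u - c / a)))"
      have "Q \<ge> \<mu> * H t"
        unfolding Q_def H_def lyap_at_def prod.case S_def[symmetric] X_def[symmetric] u_def[symmetric]
        using pos by (intro lyap_growth_pointwise[OF ch] u e) auto
      then have "k1 (y t) * Q \<ge> k1 (y t) * (\<mu> * H t)" using k[OF tB] by (intro mult_left_mono) auto
      moreover have "k2 (y t) * ((c / a / \<mu>) / u) \<ge> k2 (y t) * ((c / a / \<mu>) / M)"
        using k[OF tB] B[OF tB] u pos \<open>0 < M\<close> by (intro mult_left_mono divide_left_mono) (auto simp: u_def)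
      moreover have "a * D1 - D2 - 2 * \<rho> * D1 + (c / a / \<mu>) * (D3 / u + D1 - (a * b / (c / a)) * D2)
          = k1 (y t) * Q + k2 (y t) * ((c / a / \<mu>) / u)"
      proof -
        have "a * (q * x1) - q * x2 - 2 * \<rho> * (q * x1) + E * ((q * x3 + q2) / u + q * x1 - r * (q * x2))
            = q * (a * x1 - x2 - 2 * \<rho> * x1 + E * (x3 / u + x1 - r * x2)) + q2 * (E / u)" for q q2 x1 x2 x3 E r :: real
          using u by (simp add: field_simps)
        then show ?thesis unfolding Q_def D1_def D2_def D3_def .
      qed
      ultimately show ?thesis by (simp add: H'_def mult_ac)
    qed
    ultimately show ?thesis by blast
  qed
  then have "\<exists>D. \<forall>t\<in>{0..T}. D t \<ge> H' t \<and> (H has_real_derivative D t) (at t within {0..T})"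
    by (intro bchoice ballI) auto
  then obtain D where DD: "\<forall>t\<in>{0..T}. D t \<ge> H' t \<and> (H has_real_derivative D t) (at t within {0..T})" ..
  have D: "D t \<ge> H' t" "(H has_real_derivative D t) (at t within {0..T})" if "t \<in> {0..T}" for t
    using bspec[OF DD that] by simp_all
  have Hc: "continuous_on {0..T} H"
    unfolding continuous_on_eq_continuous_within by (auto intro: DERIV_continuous D(2))
  have H0: "H 0 > 0" using y0 by (simp add: H_def)
  have H'_nonneg: "H' t \<ge> 0" if "t \<in> {0..T}" "H t \<ge> 0" for t
    using y[OF that(1)] k[of "y t"] that(2) pos \<open>0 < M\<close> by (auto simp: H'_def intro!: add_nonneg_nonneg mult_nonneg_nonneg)
  \<comment> \<open>Half of the initial value leaves the slack that makes the bootstrap inequality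
    strict.\<close>
  have Hge: "H t - H 0 / 2 > 0" if "t \<in> {0..T}" for t
  proof (rule first_exit[of T "\<lambda>t. H t - H 0 / 2", OF _ _ _ that])
    show "continuous_on {0..T} (\<lambda>t. H t - H 0 / 2)" by (intro continuous_intros Hc)
    fix t assume t: "t \<in> {0<..T}" and bef: "\<And>s. s \<in> {0..<t} \<Longrightarrow> 0 < H s - H 0 / 2"
    have "H t \<ge> H 0 + 0 * t"
    proof (rule derivative_lower_bound[OF D(2)])
      fix s assume s: "s \<in> {0<..<t}"
      then have "H s \<ge> 0" using bef[of s] H0 by simp
      then show "0 \<le> D s" using D(1)[of s] H'_nonneg[of s] s t by simp
    qed (use t in auto)
    then show "0 < H t - H 0 / 2" using H0 by simp
  qed (use H0 in simp)
  have "H t \<ge> H 0 + min (\<mu> * (H 0 / 2)) (c / a / (\<mu> * M)) * t"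
  proof (rule derivative_lower_bound[OF D(2) _ t])
    fix s assume "s \<in> {0<..<t}"
    then have s: "s \<in> {0..T}" using t by simp
    then have ks: "0 \<le> k1 (y s)" "0 \<le> k2 (y s)" "1 \<le> k1 (y s) + k2 (y s)" using y[OF s] k[of "y s"] by auto
    define \<delta> where "\<delta> = min (\<mu> * (H 0 / 2)) (c / a / (\<mu> * M))"
    have \<delta>: "\<delta> \<ge> 0" "\<delta> \<le> \<mu> * H s" "\<delta> \<le> c / a / (\<mu> * M)"
    proof -
      have "\<mu> * (H 0 / 2) \<le> \<mu> * H s" using Hge[OF s] pos by (intro mult_left_mono) auto
      then show "\<delta> \<le> \<mu> * H s" by (simp add: \<delta>_def)
      show "\<delta> \<le> c / a / (\<mu> * M)" by (simp add: \<delta>_def)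
      show "\<delta> \<ge> 0" unfolding \<delta>_def using H0 pos \<open>0 < M\<close> by simp
    qed
    have "\<delta> \<le> (k1 (y s) + k2 (y s)) * \<delta>" using ks \<delta>(1) mult_right_mono[of 1 "k1 (y s) + k2 (y s)" \<delta>] by simp
    also have "\<dots> = k1 (y s) * \<delta> + k2 (y s) * \<delta>" by (simp add: algebra_simps)
    also have "\<dots> \<le> k1 (y s) * (\<mu> * H s) + k2 (y s) * (c / a / (\<mu> * M))"
      using ks \<delta> by (intro add_mono mult_left_mono) auto
    also have "\<dots> = H' s" by (simp add: H'_def mult_ac)
    finally show "min (\<mu> * (H 0 / 2)) (c / a / (\<mu> * M)) \<le> D s" using D(1)[OF s] by (simp add: \<delta>_def)
  qed
  then show "?h (y t) \<ge> ?h (y 0)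
        + min (\<mu> * (?h (y 0) / 2)) (c / a / (\<mu> * M)) * t"
    by (simp add: H_def)
qed

lemma component_bounded_on_cball:
  fixes C :: "real^'n"
  obtains M where "M > 0" "\<And>v i. v \<in> cball C R \<Longrightarrow> \<bar>v $ i\<bar> \<le> M"
proof
  show "norm C + \<bar>R\<bar> + 1 > 0" using norm_ge_zero[of C] by linarith
  fix v i assume "v \<in> cball C R"
  then have "norm (v - C) \<le> R" by (simp add: dist_norm norm_minus_commute)
  moreover have "norm v \<le> norm C + norm (v - C)" by (metis add.commute diff_add_cancel norm_triangle_ineq)
  ultimately show "\<bar>v $ i\<bar> \<le> norm C + \<bar>R\<bar> + 1"
    using component_le_norm_cart[of v i] by linarith
qed

text \<open>A solution that never left the ball would have \<open>lyap\<close> growing at least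
  linearly in time, although \<open>lyap\<close> is bounded above there.\<close>

lemma reach_out:
  fixes a0 :: "real^3"
  assumes ch: "\<And>l. (l + a * b) * (l\<^sup>2 - a * l + 1) - (c / a) * (a - l) = (l - \<mu>) * ((l - \<rho>)\<^sup>2 + \<omega>\<^sup>2)"
    and pos: "0 < \<mu>" "0 < a" "0 < b" "0 < c"
    and lip: "L-lipschitz_on (cball C R) G"
    and G: "\<And>v. v \<in> cball C R \<Longrightarrow> G v = k1 v *\<^sub>R roessler (a, b, c) v + k2 v *\<^sub>R axis 3 1"
    and k: "\<And>v. v \<in> cball C R \<Longrightarrow> 0 \<le> k1 v \<and> k1 v \<le> 1 \<and> 0 \<le> k2 v \<and> 1 \<le> k1 v + k2 v"
    and a0: "a0 \<in> ball C R" "a0 $ 3 + b > 0" "lyap_at (a, b, c) \<mu> \<rho> a0 > 0"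
  obtains y T where "y 0 = a0" "T \<ge> 0" "dist C (y T) = R"
    "\<And>t. t \<in> {0..T} \<Longrightarrow> y t \<in> cball C R \<and> (y has_vector_derivative G (y t)) (at t within {0..T})
        \<and> y t $ 3 + b > 0 \<and> lyap_at (a, b, c) \<mu> \<rho> (y t) > 0"
proof -
  let ?h = "lyap_at (a, b, c) \<mu> \<rho>"
  obtain N where N: "N > 0" "\<And>v i. v \<in> cball C R \<Longrightarrow> \<bar>v $ i\<bar> \<le> N" using component_bounded_on_cball by blast
  define M where "M = N + b + c"
  have M: "M > 0" "\<And>v. v \<in> cball C R \<Longrightarrow> \<bar>v$1 - c\<bar> \<le> M \<and> v$3 + b \<le> M"
  proof -
    show "M > 0" using N pos by (simp add: M_def)
    fix v assume "v \<in> cball C R"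
    then show "\<bar>v$1 - c\<bar> \<le> M \<and> v$3 + b \<le> M" using N(2)[of v 1] N(2)[of v 3] pos by (auto simp: M_def)
  qed
  define \<delta> where "\<delta> = min (\<mu> * (?h a0 / 2)) (c / a / (\<mu> * M))"
  have \<delta>: "\<delta> > 0" using a0 pos M by (simp add: \<delta>_def)
  have sol: "y t $ 3 + b > 0 \<and> ?h (y t) \<ge> ?h a0 + \<delta> * t"
    if "y 0 = a0" "\<And>t. t \<in> {0..T} \<Longrightarrow> y t \<in> cball C R \<and> (y has_vector_derivative G (y t)) (at t within {0..T})"
      "t \<in> {0..T}" for y T t
    using lyap_along_perturbed_flow[where y = y and T = T and t = t, OF ch pos G k that(2) M(2,1) _ _ that(3)] a0
    by (simp add: that(1) \<delta>_def)
  show thesis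
  proof (rule solution_until_exit[OF lip a0(1)])
    fix y assume y: "y 0 = a0" "\<And>T t. t \<in> {0..T} \<Longrightarrow> y t \<in> cball C R \<and> (y has_vector_derivative G (y t)) (at t within {0..T})"
    \<comment> \<open>\<open>lyap\<close> with the logarithm replaced by its tangent at 1: a
      continuous upper bound on the whole ball, whereas \<open>lyap\<close> itself is only
      meaningful for \<open>u > 0\<close> and tends to minus infinity as \<open>u\<close> tends to
      0.\<close>
    define Hl where "Hl v = a * (b - c / a - v$2) - (v$1 - (c - a * b)) - 2 * \<rho> * (b - c / a - v$2)
       + (c / a / \<mu>) * ((v$3 + b) / (c / a) - 1 + (b - c / a - v$2) - (a * b / (c / a)) * (v$1 - (c - a * b)))" for v :: "real^3"
    have le: "?h v \<le> Hl v" if "v$3 + b > 0" for v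
    proof -
      have "ln ((v$3 + b) / (c / a)) \<le> (v$3 + b) / (c / a) - 1"
        using that pos by (intro ln_le_minus_one) simp
      then have "(c / a / \<mu>) * (ln ((v$3 + b) / (c / a)) + (b - c / a - v$2) - (a * b / (c / a)) * (v$1 - (c - a * b)))
          \<le> (c / a / \<mu>) * ((v$3 + b) / (c / a) - 1 + (b - c / a - v$2) - (a * b / (c / a)) * (v$1 - (c - a * b)))"
        using pos by (intro mult_left_mono) auto
      then show ?thesis unfolding lyap_at_def lyap_def Hl_def prod.case by linarith
    qed
    have "bounded (Hl ` cball C R)"
      unfolding Hl_def by (intro compact_imp_bounded compact_continuous_image continuous_intros) (use pos in auto)
    then obtain K where "\<forall>x\<in>Hl ` cball C R. \<bar>x\<bar> \<le> K" unfolding bounded_iff real_norm_def by blast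
    then have K: "\<bar>Hl v\<bar> \<le> K" if "v \<in> cball C R" for v using that by blast
    define T where "T = (\<bar>K\<bar> + 1) / \<delta>"
    have T: "T \<ge> 0" "\<delta> * T = \<bar>K\<bar> + 1" using \<delta> by (auto simp: T_def)
    have "y T $ 3 + b > 0 \<and> ?h (y T) \<ge> ?h a0 + \<delta> * T"
      using T by (intro sol[where y = y and T = T, OF y]) auto
    then show thesis using le[of "y T"] K[of "y T"] y(2)[of T T] T a0 by auto
  next
    fix y T assume y: "y 0 = a0" "0 \<le> T" "dist C (y T) = R"
      "\<And>t. t \<in> {0..T} \<Longrightarrow> y t \<in> cball C R \<and> (y has_vector_derivative G (y t)) (at t within {0..T})"
    have "y t $ 3 + b > 0 \<and> ?h (y t) > 0" if t: "t \<in> {0..T}" for t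
    proof -
      have "\<delta> * t \<ge> 0" using \<delta> t by simp
      then show ?thesis using sol[OF y(1,4) t] a0(3) by linarith
    qed
    then show thesis using that[OF y(1-3)] y(4) by blast
  qed
qed

text \<open>The region \<open>x < 0 < y < - z\<close>, \<open>z < -2\<close> is preserved under
  \<open>- G\<close>, and in it \<open>z\<close> falls at rate at least 1, which no ball permits for
  long.\<close>

lemma reach_in:
  fixes b0 :: "real^3"
  assumes pos: "0 < a" "0 < b" "b < 1" "1 < c"
    and lip: "L-lipschitz_on (cball C R) G"
    and G: "\<And>v. v \<in> cball C R \<Longrightarrow> G v = k1 v *\<^sub>R roessler (a, b, c) v + k2 v *\<^sub>R axis 3 1"
    and k: "\<And>v. v \<in> cball C R \<Longrightarrow> 0 \<le> k1 v \<and> k1 v \<le> 1 \<and> 0 \<le> k2 v \<and> 1 \<le> k1 v + k2 v"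
    and b0: "b0 \<in> ball C R" "b0 $ 1 < 0" "b0 $ 2 > 0" "b0 $ 3 < - 2" "b0 $ 2 < - (b0 $ 3)"
  obtains y T where "y 0 = b0" "T \<ge> 0" "dist C (y T) = R" "y T $ 3 < - 2"
    "\<And>t. t \<in> {0..T} \<Longrightarrow> y t \<in> cball C R \<and> (y has_vector_derivative - G (y t)) (at t within {0..T})"
proof -
  have lip': "L-lipschitz_on (cball C R) (\<lambda>v. - G v)" using lip by simp
  have G': "G v $ 1 = k1 v * (- (v$2) - v$3)" "G v $ 2 = k1 v * (v$1 + a * v$2)"
     "G v $ 3 = k1 v * (b * v$1 + v$3 * (v$1 - c)) + k2 v" if "v \<in> cball C R" for v
    using G[OF that] by (simp_all add: axis_def)
  have sol: "y t $ 3 < - 2 - t"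
    if y0: "y 0 = b0" and y: "\<And>t. t \<in> {0..T} \<Longrightarrow> y t \<in> cball C R \<and> (y has_vector_derivative - G (y t)) (at t within {0..T})"
      and t: "t \<in> {0..T}" for y T t
  proof -
    have y': "((\<lambda>t. y t $ i) has_real_derivative - G (y t) $ i) (at t within {0..T})" if "t \<in> {0..T}" for t i
      using y[OF that] has_vector_derivative_nth[of y "- G (y t)"] by simp
    have yc: "continuous_on {0..T} y" using y by (intro sol_continuous) auto
    note yci = continuous_on_component[OF yc]
    define f where "f t = min (min (- (y t $ 1)) (y t $ 2)) (min (- 2 - y t $ 3) (- (y t $ 3) - y t $ 2))" for t
    let ?f = "\<lambda>v :: real^3. b * v$1 + v$3 * (v$1 - c)"
    have G3: "G v $ 3 \<ge> 1" if "v \<in> cball C R" "v$1 < 0" "v$3 < -2" for v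
    proof -
      have "0 \<le> (- (v$1)) * (- (v$3) - b)" using that pos by (intro mult_nonneg_nonneg) auto
      moreover have "c * 2 \<le> c * - (v$3)" using that pos by (intro mult_left_mono) auto
      ultimately have "?f v \<ge> 1" using pos by (simp add: algebra_simps)
      then have "k1 v * ?f v \<ge> k1 v * 1" using k[OF that(1)] by (intro mult_left_mono) auto
      then show ?thesis using k[OF that(1)] by (simp add: G'[OF that(1)])
    qed
    \<comment> \<open>The threshold -2 is used here: with \<open>b < 1\<close> it makes
      \<open>- z - b - 1\<close> positive.\<close>
    have G32: "G v $ 3 + G v $ 2 \<ge> 0" if "v \<in> cball C R" "v$1 < 0" "v$3 < -2" "v$2 > 0" for v
    proof -
      have "0 \<le> (- (v$1)) * (- (v$3) - b - 1)" using that pos by (intro mult_nonneg_nonneg) auto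
      moreover have "0 \<le> c * - (v$3)" by (rule mult_nonneg_nonneg) (use that pos in auto)
      moreover have "0 \<le> a * v$2" using that pos by simp
      ultimately have "?f v + (v$1 + a * v$2) \<ge> 0" by (simp add: algebra_simps)
      then have "k1 v * (?f v + (v$1 + a * v$2)) \<ge> 0" using k[OF that(1)] by (intro mult_nonneg_nonneg) auto
      moreover have "G v $ 3 + G v $ 2 = k1 v * (?f v + (v$1 + a * v$2)) + k2 v"
        unfolding G'[OF that(1)] by (simp add: distrib_left)
      ultimately show ?thesis using k[OF that(1)] by linarith
    qed
    have fpos: "f t > 0" if "t \<in> {0..T}" for t
    proof (rule first_exit[of T f, OF _ _ _ that])
      show "continuous_on {0..T} f" unfolding f_def by (intro continuous_intros yci)
      show "f 0 > 0" using b0 y0 by (simp add: f_def)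
      fix t assume t: "t \<in> {0<..T}" and bef: "\<And>s. s \<in> {0..<t} \<Longrightarrow> f s > 0"
      have s: "s \<in> {0..T}" "y s \<in> cball C R" "y s $ 1 < 0" "y s $ 2 > 0" "y s $ 3 < - 2" "y s $ 2 < - (y s $ 3)"
        if "s \<in> {0<..<t}" for s
        using bef[of s] y[of s] t that by (auto simp: f_def)
      have tT: "t \<in> {0..T}" using t by simp
      have "- (y t $ 1) \<ge> - (y 0 $ 1) + 0 * t"
      proof (rule derivative_lower_bound[OF _ _ tT])
        show "((\<lambda>t. - (y t $ 1)) has_real_derivative G (y s) $ 1) (at s within {0..T})" if "s \<in> {0..T}" for s
          using DERIV_minus[OF y'[OF that, of 1]] by simp
        show "0 \<le> G (y s) $ 1" if "s \<in> {0<..<t}" for s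
          using s[OF that] k[of "y s"] by (simp add: G'[OF s(2)[OF that]])
      qed
      \<comment> \<open>Backwards \<open>y\<close> may decay, but at rate at most \<open>a\<close>:
        the terms \<open>- k1 * x\<close> and \<open>(1 - k1) * a * y\<close> are
        nonnegative.\<close>
      moreover have "y t $ 2 * exp (a * t) \<ge> y 0 $ 2 * exp (a * 0) + 0 * t"
      proof (rule derivative_lower_bound[OF _ _ tT])
        show "((\<lambda>t. y t $ 2 * exp (a * t)) has_real_derivative (- G (y s) $ 2 + a * y s $ 2) * exp (a * s)) (at s within {0..T})"
          if "s \<in> {0..T}" for s
          by (auto intro!: derivative_eq_intros y'[OF that] simp: algebra_simps)
        show "0 \<le> (- G (y s) $ 2 + a * y s $ 2) * exp (a * s)" if "s \<in> {0<..<t}" for s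
        proof -
          have "- G (y s) $ 2 + a * y s $ 2 = k1 (y s) * - (y s $ 1) + (1 - k1 (y s)) * (a * y s $ 2)"
            by (simp add: G'[OF s(2)[OF that]] algebra_simps)
          also have "\<dots> \<ge> 0" using k[OF s(2)[OF that]] s[OF that] pos by (intro add_nonneg_nonneg mult_nonneg_nonneg) auto
          finally show ?thesis by simp
        qed
      qed
      moreover have "- (y t $ 3) \<ge> - (y 0 $ 3) + 0 * t"
      proof (rule derivative_lower_bound[OF _ _ tT])
        show "((\<lambda>t. - (y t $ 3)) has_real_derivative G (y s) $ 3) (at s within {0..T})" if "s \<in> {0..T}" for s
          using DERIV_minus[OF y'[OF that, of 3]] by simp
        show "0 \<le> G (y s) $ 3" if "s \<in> {0<..<t}" for s using G3[of "y s"] s[OF that] by simp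
      qed
      moreover have "- (y t $ 3) - y t $ 2 \<ge> - (y 0 $ 3) - y 0 $ 2 + 0 * t"
      proof (rule derivative_lower_bound[OF _ _ tT])
        show "((\<lambda>t. - (y t $ 3) - y t $ 2) has_real_derivative G (y s) $ 3 + G (y s) $ 2) (at s within {0..T})" if "s \<in> {0..T}" for s
          using DERIV_diff[OF DERIV_minus[OF y'[OF that, of 3]] y'[OF that, of 2]] by simp
        show "0 \<le> G (y s) $ 3 + G (y s) $ 2" if "s \<in> {0<..<t}" for s using G32[of "y s"] s[OF that] by simp
      qed
      ultimately show "f t > 0" using b0 y0 by (auto simp: f_def zero_less_mult_iff dest: less_le_trans[rotated])
    qed
    have "- (y t $ 3) \<ge> - (y 0 $ 3) + 1 * t"
    proof (rule derivative_lower_bound[OF _ _ t])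
      show "((\<lambda>t. - (y t $ 3)) has_real_derivative G (y s) $ 3) (at s within {0..T})" if "s \<in> {0..T}" for s
        using DERIV_minus[OF y'[OF that, of 3]] by simp
      show "1 \<le> G (y s) $ 3" if "s \<in> {0<..<t}" for s
        using fpos[of s] that t y[of s] by (intro G3) (auto simp: f_def)
    qed
    then show ?thesis using b0 y0 by simp
  qed
  show thesis
  proof (rule solution_until_exit[OF lip' b0(1)])
    fix y assume y: "y 0 = b0" "\<And>T t. t \<in> {0..T} \<Longrightarrow> y t \<in> cball C R \<and> (y has_vector_derivative - G (y t)) (at t within {0..T})"
    obtain N where N: "N > 0" "\<And>v i. v \<in> cball C R \<Longrightarrow> \<bar>v $ i\<bar> \<le> N" using component_bounded_on_cball by blast
    have "y N $ 3 < - 2 - N"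
      using N by (intro sol[where y = y and T = N, OF y]) auto
    then show thesis using N(2)[of "y N" 3] y(2)[of N N] N(1) by auto
  next
    fix y T assume y: "y 0 = b0" "0 \<le> T" "dist C (y T) = R"
      "\<And>t. t \<in> {0..T} \<Longrightarrow> y t \<in> cball C R \<and> (y has_vector_derivative - G (y t)) (at t within {0..T})"
    have "y T $ 3 < - 2" using sol[OF y(1,4), of T] y(2) by simp
    then show thesis using that[OF y(1-3)] y(4) by blast
  qed
qed

section \<open>Joining pieces of solutions\<close>

definition sol_on :: "('a::real_normed_vector \<Rightarrow> 'a) \<Rightarrow> 'a set \<Rightarrow> real set \<Rightarrow> (real \<Rightarrow> 'a) \<Rightarrow> bool" where
  "sol_on V M I g \<longleftrightarrow> (\<forall>t\<in>I. g t \<in> M \<and> (g has_vector_derivative V (g t)) (at t within I))"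

lemma sol_onD:
  assumes "sol_on V M I g" "t \<in> I"
  shows "g t \<in> M" "(g has_vector_derivative V (g t)) (at t within I)"
  using assms by (auto simp: sol_on_def)

lemma sol_on_subset: "sol_on V M I g \<Longrightarrow> J \<subseteq> I \<Longrightarrow> sol_on V M J g"
  unfolding sol_on_def using has_vector_derivative_within_subset by fastforce

lemma sol_on_shift:
  assumes "sol_on V M I g"
  shows "sol_on V M ((\<lambda>t. t - c) ` I) (\<lambda>t. g (t + c))"
  unfolding sol_on_def
proof (intro ballI conjI)
  fix t assume t: "t \<in> (\<lambda>t. t - c) ` I"
  then have tc: "t + c \<in> I" by auto
  show "g (t + c) \<in> M" using sol_onD(1)[OF assms tc] .
  have im: "(\<lambda>t. t + c) ` (\<lambda>t. t - c) ` I = I" by (simp add: image_image)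
  have "((\<lambda>t. t + c) has_vector_derivative 1) (at t within (\<lambda>t. t - c) ` I)"
    by (auto intro!: derivative_eq_intros)
  from vector_diff_chain_within[OF this, of g "V (g (t + c))"] sol_onD(2)[OF assms tc]
  show "((\<lambda>t. g (t + c)) has_vector_derivative V (g (t + c))) (at t within (\<lambda>t. t - c) ` I)"
    by (simp add: im o_def)
qed

lemma sol_on_reverse:
  assumes "sol_on (\<lambda>v. - V v) M {0..T} g"
  shows "sol_on V M {0..T} (\<lambda>t. g (T - t))"
  unfolding sol_on_def
proof (intro ballI conjI)
  fix t assume t: "t \<in> {0..T}"
  then have tc: "T - t \<in> {0..T}" by auto
  show "g (T - t) \<in> M" using sol_onD(1)[OF assms tc] .
  have im: "(\<lambda>t. T - t) ` {0..T} = {0..T}"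
    by (auto simp: image_iff intro!: bexI[of _ "T - _"])
  have "((\<lambda>t. T - t) has_vector_derivative - 1) (at t within {0..T})"
    by (auto intro!: derivative_eq_intros)
  from vector_diff_chain_within[OF this, of g "- V (g (T - t))"] sol_onD(2)[OF assms tc]
  show "((\<lambda>t. g (T - t)) has_vector_derivative V (g (T - t))) (at t within {0..T})"
    by (simp add: im o_def)
qed

text \<open>At the common point both one-sided derivatives equal the value of \<open>V\<close>
  there, so the joined curve is differentiable without further matching conditions.\<close>

lemma sol_on_glue:
  assumes "sol_on V M S g" "sol_on V M T h" "closed S" "closed T" "S \<inter> T = {m}" "g m = h m"
  shows "sol_on V M (S \<union> T) (\<lambda>t. if t \<in> S then g t else h t)"
  unfolding sol_on_def
proof (intro ballI conjI)
  fix t assume t: "t \<in> S \<union> T"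
  then show "(if t \<in> S then g t else h t) \<in> M" using sol_onD(1)[OF assms(1)] sol_onD(1)[OF assms(2)] by auto
  have cl: "S \<union> (closure S \<inter> closure T) = S" "T \<union> (closure S \<inter> closure T) = T" using assms by auto
  have "((\<lambda>t. if t \<in> S then g t else h t) has_vector_derivative
      (if t \<in> S then V (g t) else V (h t))) (at t within S \<union> T)"
  proof (rule has_vector_derivative_If_within_closures[OF t refl])
    show "t \<in> closure S \<Longrightarrow> t \<in> closure T \<Longrightarrow> g t = h t" using assms by auto
    then show "t \<in> closure S \<Longrightarrow> t \<in> closure T \<Longrightarrow> V (g t) = V (h t)" by simp
  qed (simp_all only: cl sol_onD(2)[OF assms(1)] sol_onD(2)[OF assms(2)])
  then show "((\<lambda>t. if t \<in> S then g t else h t) has_vector_derivative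
      V (if t \<in> S then g t else h t)) (at t within S \<union> T)"
    by (simp add: if_distrib)
qed

text \<open>Reachability along the flow. The field is autonomous, so every piece can be timed to
  start at 0, and pieces with different parametrisations can be chained.\<close>

definition conn :: "('a::real_normed_vector \<Rightarrow> 'a) \<Rightarrow> 'a set \<Rightarrow> 'a \<Rightarrow> 'a \<Rightarrow> bool" where
  "conn V M p q \<longleftrightarrow> (\<exists>g T. T \<ge> 0 \<and> g 0 = p \<and> g T = q \<and> sol_on V M {0..T} g)"

lemma connI:
  assumes "sol_on V M {s..t} g" "s \<le> t"
  shows "conn V M (g s) (g t)"
proof -
  have "(\<lambda>x. x - s) ` {s..t} = {0..t - s}" by (auto simp: image_iff intro!: bexI[of _ "_ + s"])
  then have "sol_on V M {0..t - s} (\<lambda>x. g (x + s))" using sol_on_shift[OF assms(1), of s] by simp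
  then show ?thesis unfolding conn_def using assms(2)
    by (intro exI[of _ "\<lambda>x. g (x + s)"] exI[of _ "t - s"]) auto
qed

text \<open>The extended half orbit is re-timed to end at 0 again, so that the extension can be
  iterated.\<close>

lemma extend_left:
  assumes g: "sol_on V M {..0} g" "g 0 = p" "(g \<longlongrightarrow> A) at_bot" and c: "conn V M p q"
  obtains g' where "sol_on V M {..0} g'" "g' 0 = q" "(g' \<longlongrightarrow> A) at_bot"
proof -
  obtain h T where h: "T \<ge> 0" "h 0 = p" "h T = q" "sol_on V M {0..T} h" using c unfolding conn_def by blast
  define k where "k t = (if t \<in> {..0} then g t else h t)" for t
  have "{..0} \<inter> {0..T} = {0}" "{..0} \<union> {0..T} = {..T}" using h(1) by auto
  then have "sol_on V M {..T} k"
    using sol_on_glue[OF g(1) h(4), of 0] g(2) h(2) by (simp add: k_def[abs_def])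
  moreover have "(\<lambda>x. x - T) ` {..T} = {..0}" by (auto simp: image_iff intro!: bexI[of _ "_ + T"])
  ultimately have 1: "sol_on V M {..0} (\<lambda>t. k (t + T))" using sol_on_shift[of V M "{..T}" k T] by simp
  have 2: "k (0 + T) = q" using h g by (auto simp: k_def)
  have "\<forall>\<^sub>F t in at_bot. g t = k t"
    using eventually_le_at_bot[of 0] by eventually_elim (simp add: k_def)
  then have "(k \<longlongrightarrow> A) at_bot" using g(3) by (rule Lim_transform_eventually[rotated])
  moreover have "LIM t at_bot. t + T :> at_bot"
    unfolding filterlim_at_bot eventually_at_bot_linorder
    by (metis add_le_imp_le_diff diff_add_cancel add_right_mono)
  ultimately have 3: "((\<lambda>t. k (t + T)) \<longlongrightarrow> A) at_bot" by (rule filterlim_compose)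
  show thesis by (rule that[OF 1 2 3])
qed

lemma extend_right:
  assumes g: "sol_on V M {0..} g" "g 0 = q" "(g \<longlongrightarrow> A) at_top" and c: "conn V M p q"
  obtains g' where "sol_on V M {0..} g'" "g' 0 = p" "(g' \<longlongrightarrow> A) at_top"
proof -
  obtain h T where h: "T \<ge> 0" "h 0 = p" "h T = q" "sol_on V M {0..T} h" using c unfolding conn_def by blast
  have "(\<lambda>x. x - (- T)) ` {0..} = {T..}" by (auto simp: image_iff intro!: bexI[of _ "_ - T"])
  then have g': "sol_on V M {T..} (\<lambda>t. g (t - T))" using sol_on_shift[OF g(1), of "- T"] by simp
  define k where "k t = (if t \<in> {0..T} then h t else g (t - T))" for t
  have "{0..T} \<inter> {T..} = {T}" "{0..T} \<union> {T..} = {0..}" using h(1) by auto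
  then have 1: "sol_on V M {0..} k"
    using sol_on_glue[OF h(4) g', of T] g(2) h(3) by (simp add: k_def[abs_def])
  have 2: "k 0 = p" using h by (auto simp: k_def)
  have "LIM t at_top. t - T :> at_top"
    using filterlim_tendsto_add_at_top[OF tendsto_const[of "- T"] filterlim_ident] by simp
  then have "((\<lambda>t. g (t - T)) \<longlongrightarrow> A) at_top" using g(3) filterlim_compose by blast
  moreover have "\<forall>\<^sub>F t in at_top. g (t - T) = k t"
    using eventually_gt_at_top[of T] by eventually_elim (simp add: k_def)
  ultimately have 3: "(k \<longlongrightarrow> A) at_top" by (rule Lim_transform_eventually)
  show thesis by (rule that[OF 1 2 3])
qed

lemma sol_on_line:
  assumes "sol_on V M {..0} g" "(g \<longlongrightarrow> A) at_bot" "sol_on V M {0..} h" "(h \<longlongrightarrow> B) at_top" "g 0 = p" "h 0 = p"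
  obtains k where "\<And>t. k t \<in> M \<and> (k has_vector_derivative V (k t)) (at t)" "k 0 = p"
    "(k \<longlongrightarrow> A) at_bot" "(k \<longlongrightarrow> B) at_top"
proof -
  define k where "k t = (if t \<in> {..0} then g t else h t)" for t
  have "{..0} \<inter> {0..} = {0::real}" "{..0} \<union> {0..} = (UNIV :: real set)" by auto
  then have "sol_on V M UNIV k"
    using sol_on_glue[OF assms(1,3), of 0] assms(5,6) by (simp add: k_def[abs_def])
  then have 1: "k t \<in> M \<and> (k has_vector_derivative V (k t)) (at t)" for t
    using sol_onD[of V M UNIV k t] by simp
  have "\<forall>\<^sub>F t in at_bot. g t = k t"
    using eventually_le_at_bot[of 0] by eventually_elim (simp add: k_def)
  then have 3: "(k \<longlongrightarrow> A) at_bot" using assms(2) by (rule Lim_transform_eventually[rotated])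
  have "\<forall>\<^sub>F t in at_top. h t = k t"
    using eventually_gt_at_top[of 0] by eventually_elim (simp add: k_def)
  then have 4: "(k \<longlongrightarrow> B) at_top" using assms(4) by (rule Lim_transform_eventually[rotated])
  show thesis by (rule that[OF 1 _ 3 4]) (simp add: k_def assms)
qed

lemma unstable_set_iff:
  "x0 \<in> unstable_set f P \<longleftrightarrow> (\<exists>x. x 0 = x0 \<and> sol_on f UNIV {..0} x \<and> (x \<longlongrightarrow> P) at_bot)"
  unfolding unstable_set_def sol_on_def by auto

lemma stable_set_iff:
  "x0 \<in> stable_set f P \<longleftrightarrow> (\<exists>x. x 0 = x0 \<and> sol_on f UNIV {0..} x \<and> (x \<longlongrightarrow> P) at_top)"
  unfolding stable_set_def sol_on_def by auto

lemma unstable_set_conn: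
  assumes "p \<in> unstable_set f P" "conn f UNIV p q"
  shows "q \<in> unstable_set f P"
  using assms extend_left[of f UNIV _ p P q] unfolding unstable_set_iff by metis

section \<open>Unbounded components of the two manifolds\<close>

lemma stable_component_unbounded:
  assumes "good_param p"
  shows "\<exists>x\<in>stable_set (roessler p) P_In - {P_In}.
      \<not> bounded (connected_component_set (stable_set (roessler p) P_In - {P_In}) x)"
proof -
  obtain a b c where p: "p = (a, b, c)" by (cases p)
  obtain K where K: "connected K" "K \<subseteq> stable_set (roessler p) P_In - {P_In}" "\<And>M. \<exists>v\<in>K. - (v$3) > M"
    using stable_branch assms unfolding p by metis
  obtain v where v: "v \<in> K" using K(3) by blast
  have sub: "K \<subseteq> connected_component_set (stable_set (roessler p) P_In - {P_In}) v"
    by (rule connected_component_maximal[OF v K(1,2)])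
  have "\<not> bounded K"
  proof
    assume "bounded K"
    then obtain M where M: "\<And>v. v \<in> K \<Longrightarrow> norm v \<le> M" unfolding bounded_iff by blast
    obtain v where "v \<in> K" "- (v$3) > M" using K(3) by blast
    then show False using M[of v] component_le_norm_cart[of v 3] by auto
  qed
  then show ?thesis using sub v K(2) bounded_subset by (intro bexI[of _ v]) auto
qed

lemma elementary_roessler: "elementary (\<lambda>v. roessler (a, b, c) v $ k)"
proof -
  consider "k = 1" | "k = 2" | "k = 3" using exhaust_3 by blast
  then show ?thesis by cases (simp_all, (intro el_intros)+)
qed

lemma unstable_component_unbounded:
  assumes "good_param p"
  shows "\<exists>x\<in>unstable_set (roessler p) (P_Out p) - {P_Out p}.
      \<not> bounded (connected_component_set (unstable_set (roessler p) (P_Out p) - {P_Out p}) x)"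
proof -
  obtain a b c where p: "p = (a, b, c)" by (cases p)
  note gp = good_param_fixpoints[OF assms[unfolded p]]
  obtain \<mu> \<rho> \<omega> x where x: "\<mu> > 0" "\<rho> < 0"
    "\<And>l. (l + a * b) * (l\<^sup>2 - a * l + 1) - (c / a) * (a - l) = (l - \<mu>) * ((l - \<rho>)\<^sup>2 + \<omega>\<^sup>2)"
    "\<And>t. t \<le> 0 \<Longrightarrow> (x has_vector_derivative roessler (a, b, c) (x t)) (at t within {..0})"
    "(x \<longlongrightarrow> P_Out (a, b, c)) at_bot"
    "x 0 $ 3 + b > 0" "lyap_at (a, b, c) \<mu> \<rho> (x 0) > 0"
    using unstable_branch[OF assms[unfolded p]] by metis
  define W where "W = unstable_set (roessler p) (P_Out p) - {P_Out p}"
  \<comment> \<open>\<open>lyap\<close> vanishes at \<open>P_Out\<close>, so its positivity keeps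
    the orbit in the punctured unstable set.\<close>
  have nP: "v \<noteq> P_Out p" if "lyap_at (a, b, c) \<mu> \<rho> v > 0" for v
    using that gp by (auto simp: p P_Out_nth lyap_at_def lyap_def)
  have x0: "x 0 \<in> unstable_set (roessler p) (P_Out p)"
    unfolding unstable_set_iff by (rule exI[of _ x]) (use x in \<open>auto simp: sol_on_def p\<close>)
  have far: "\<exists>v\<in>connected_component_set W (x 0). norm v > M" for M
  proof -
    define R where "R = max (norm (x 0)) M + 1"
    obtain L where L: "L-lipschitz_on (cball 0 R) (roessler (a, b, c))"
      using elementary_lipschitz_vec[OF elementary_roessler] by blast
    obtain y T where y: "y 0 = x 0" "T \<ge> 0" "dist 0 (y T) = R"
      "\<And>t. t \<in> {0..T} \<Longrightarrow> y t \<in> cball 0 R \<and> (y has_vector_derivative roessler (a, b, c) (y t)) (at t within {0..T})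
        \<and> y t $ 3 + b > 0 \<and> lyap_at (a, b, c) \<mu> \<rho> (y t) > 0"
    \<comment> \<open>The pure field, \<open>k1 = 1\<close> and \<open>k2 = 0\<close>, on a ball of
      arbitrary size: the orbit reaches its boundary.\<close>
    proof (rule reach_out[OF x(3,1) gp(4,6) _ L, of "\<lambda>_. 1" "\<lambda>_. 0" "x 0"])
      show "x 0 \<in> ball 0 R" by (simp add: R_def)
    qed (use x gp in auto)
    have "y t \<in> W" if t: "t \<in> {0..T}" for t
    proof -
      have "sol_on (roessler p) UNIV {0..t} y"
      proof (rule sol_on_subset)
        show "sol_on (roessler p) UNIV {0..T} y" using y(4) by (simp add: sol_on_def p)
      qed (use t in auto)
      then have "conn (roessler p) UNIV (y 0) (y t)" using t by (intro connI) auto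
      then show ?thesis using unstable_set_conn[OF x0, of "y t"] y(1) y(4)[OF t] nP by (simp add: W_def)
    qed
    moreover have "continuous_on {0..T} y" using y(4) by (intro sol_continuous) auto
    then have "connected (y ` {0..T})" by (rule connected_continuous_image) simp
    moreover have "x 0 \<in> y ` {0..T}" using y(1,2) by (metis atLeastAtMost_iff image_eqI order_refl)
    ultimately have "y ` {0..T} \<subseteq> connected_component_set W (x 0)"
      by (intro connected_component_maximal) auto
    moreover have "norm (y T) > M" using y(3) by (simp add: R_def)
    moreover have "y T \<in> y ` {0..T}" using y(2) by simp
    ultimately show ?thesis by blast
  qed
  have "\<not> bounded (connected_component_set W (x 0))"
  proof
    assume "bounded (connected_component_set W (x 0))"
    then obtain M where M: "\<forall>v\<in>connected_component_set W (x 0). norm v \<le> M" unfolding bounded_iff ..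
    obtain v where "v \<in> connected_component_set W (x 0)" "norm v > M" using far[of M] ..
    then show False using bspec[OF M] by force
  qed
  moreover have "x 0 \<in> W" using x0 nP x(7) by (simp add: W_def)
  ultimately show ?thesis unfolding W_def by blast
qed

section \<open>Vector fields on the three-sphere\<close>

text \<open>The differential of \<open>stereo_inv\<close>, rewritten in terms of the image point
  \<open>q\<close>. In this form it is polynomial in \<open>q\<close> and hence defined on all of
  R^4; \<open>1 - q$4\<close> is the conformal factor \<open>2 / (nsq x + 1)\<close>.\<close>

definition sphere_push :: "real^4 \<Rightarrow> real^3 \<Rightarrow> real^4" where
  "sphere_push q v = (let r = q$1 * v$1 + q$2 * v$2 + q$3 * v$3 in
     vector [(1 - q$4) * v$1 - r * q$1, (1 - q$4) * v$2 - r * q$2, (1 - q$4) * v$3 - r * q$3, (1 - q$4) * r])"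

lemma vector_4 [simp]:
  "(vector [x, y, z, w] :: 'a::zero^4) $ 1 = x" "(vector [x, y, z, w] :: 'a^4) $ 2 = y"
  "(vector [x, y, z, w] :: 'a^4) $ 3 = z" "(vector [x, y, z, w] :: 'a^4) $ 4 = w"
  unfolding vector_def by simp_all

lemma sphere_push_nth:
  "sphere_push q v $ 1 = (1 - q$4) * v$1 - (q$1 * v$1 + q$2 * v$2 + q$3 * v$3) * q$1"
  "sphere_push q v $ 2 = (1 - q$4) * v$2 - (q$1 * v$1 + q$2 * v$2 + q$3 * v$3) * q$2"
  "sphere_push q v $ 3 = (1 - q$4) * v$3 - (q$1 * v$1 + q$2 * v$2 + q$3 * v$3) * q$3"
  "sphere_push q v $ 4 = (1 - q$4) * (q$1 * v$1 + q$2 * v$2 + q$3 * v$3)"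
  by (simp_all add: sphere_push_def Let_def)

lemma norm_sq_3: "(norm (x :: real^3))\<^sup>2 = (x$1)\<^sup>2 + (x$2)\<^sup>2 + (x$3)\<^sup>2"
  by (simp add: norm_eq_sqrt_inner inner_vec_def sum_3 power2_eq_square)

lemma norm_sq_4: "(norm (x :: real^4))\<^sup>2 = (x$1)\<^sup>2 + (x$2)\<^sup>2 + (x$3)\<^sup>2 + (x$4)\<^sup>2"
  by (simp add: norm_eq_sqrt_inner inner_vec_def sum_4 power2_eq_square)

definition nsq :: "real^3 \<Rightarrow> real" where "nsq x = (x$1)\<^sup>2 + (x$2)\<^sup>2 + (x$3)\<^sup>2"

lemma nsq_nonneg: "nsq x \<ge> 0" and nsq_pos: "nsq x + 1 > 0" and nsq_ne: "nsq x + 1 \<noteq> 0"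
proof -
  show "nsq x \<ge> 0" by (simp add: nsq_def)
  then show "nsq x + 1 > 0" "nsq x + 1 \<noteq> 0" by simp_all
qed

lemma stereo_inv_nth:
  "stereo_inv x $ 1 = 2 * x$1 / (nsq x + 1)" "stereo_inv x $ 2 = 2 * x$2 / (nsq x + 1)"
  "stereo_inv x $ 3 = 2 * x$3 / (nsq x + 1)" "stereo_inv x $ 4 = (nsq x - 1) / (nsq x + 1)"
  by (simp_all add: stereo_inv_def Let_def norm_sq_3 nsq_def)

lemma one_minus_stereo_inv_4: "1 - stereo_inv x $ 4 = 2 / (nsq x + 1)"
  using nsq_ne[of x] by (simp add: stereo_inv_nth field_simps)

lemma stereo_inv_4_less: "stereo_inv x $ 4 < 1"
  using one_minus_stereo_inv_4[of x] nsq_pos[of x] by (smt (verit) divide_pos_pos)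

lemma sphere_4_iff: "q \<in> sphere 0 1 \<longleftrightarrow> (q$1)\<^sup>2 + (q$2)\<^sup>2 + (q$3)\<^sup>2 + (q$4)\<^sup>2 = (1::real)" for q :: "real^4"
proof -
  have "q \<in> sphere 0 1 \<longleftrightarrow> (norm q)\<^sup>2 = 1\<^sup>2" by (subst power2_eq_iff_nonneg) auto
  then show ?thesis by (simp add: norm_sq_4)
qed

lemma stereo_inv_sphere: "stereo_inv x \<in> sphere 0 1"
proof -
  have "(2 * x$1)\<^sup>2 + (2 * x$2)\<^sup>2 + (2 * x$3)\<^sup>2 + (nsq x - 1)\<^sup>2 = (nsq x + 1)\<^sup>2"
    by (simp add: nsq_def power2_eq_square algebra_simps)
  then show ?thesis
    using nsq_ne[of x] unfolding sphere_4_iff stereo_inv_nth power_divide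
    by (simp add: add_divide_distrib[symmetric])
qed

lemma stereo_inv_coords:
  "stereo_inv x $ 1 / (1 - stereo_inv x $ 4) = x$1"
  "stereo_inv x $ 2 / (1 - stereo_inv x $ 4) = x$2"
  "stereo_inv x $ 3 / (1 - stereo_inv x $ 4) = x$3"
  unfolding one_minus_stereo_inv_4 stereo_inv_nth(1-3) using nsq_ne[of x] by (simp_all add: field_simps)

lemma vec4_eqI: "x$1 = y$1 \<Longrightarrow> x$2 = y$2 \<Longrightarrow> x$3 = y$3 \<Longrightarrow> x$4 = y$4 \<Longrightarrow> x = (y :: 'a^4)"
  by (simp add: vec_eq_iff forall_4)

lemma vec3_eqI: "x$1 = y$1 \<Longrightarrow> x$2 = y$2 \<Longrightarrow> x$3 = y$3 \<Longrightarrow> x = (y :: 'a^3)"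
  by (simp add: vec_eq_iff forall_3)

lemma sphere_cases:
  assumes "q \<in> sphere 0 1"
  shows "q = north \<or> (\<exists>x. q = stereo_inv x)"
proof (cases "q$4 = 1")
  case True
  then have s: "(q$1)\<^sup>2 + (q$2)\<^sup>2 + (q$3)\<^sup>2 = 0" using assms unfolding sphere_4_iff by simp
  then have "(q$1)\<^sup>2 = 0" "(q$2)\<^sup>2 = 0" "(q$3)\<^sup>2 = 0"
    using zero_le_power2[of "q$1"] zero_le_power2[of "q$2"] zero_le_power2[of "q$3"] by linarith+
  then have "q = north" using True by (intro vec4_eqI) (simp_all add: north_def)
  then show ?thesis ..
next
  case False
  define x :: "real^3" where "x = vector [q$1 / (1 - q$4), q$2 / (1 - q$4), q$3 / (1 - q$4)]"
  have ne: "1 - q$4 \<noteq> 0" using False by simp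
  have s: "(q$1)\<^sup>2 + (q$2)\<^sup>2 + (q$3)\<^sup>2 = (1 - q$4) * (1 + q$4)"
    using assms unfolding sphere_4_iff by (simp add: power2_eq_square algebra_simps)
  have "nsq x = ((q$1)\<^sup>2 + (q$2)\<^sup>2 + (q$3)\<^sup>2) / (1 - q$4)\<^sup>2"
    by (simp add: nsq_def x_def power_divide add_divide_distrib)
  also have "\<dots> = (1 + q$4) / (1 - q$4)" unfolding s using ne by (simp add: power2_eq_square)
  finally have n: "nsq x = (1 + q$4) / (1 - q$4)" .
  then have n1: "nsq x + 1 = 2 / (1 - q$4)" "nsq x - 1 = 2 * q$4 / (1 - q$4)"
    using ne by (simp_all add: field_simps)
  have "q = stereo_inv x"
    by (intro vec4_eqI) (use ne in \<open>simp_all add: stereo_inv_nth n1, simp_all add: x_def\<close>)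
  then show ?thesis by blast
qed

lemma stereo_inv_has_derivative: "(stereo_inv has_derivative sphere_push (stereo_inv x)) (at x)"
proof (subst has_derivative_componentwise_within, intro ballI)
  fix k :: "real^4" assume "k \<in> Basis"
  then obtain i where k: "k = axis i 1" by (auto simp: Basis_vec_def)
  note vd = bounded_linear_imp_has_derivative[OF bounded_linear_vec_nth]
  define r where "r h = x$1 * h$1 + x$2 * h$2 + x$3 * h$3" for h :: "real^3"
  have n: "(nsq has_derivative (\<lambda>h. 2 * r h)) (at x)"
    unfolding nsq_def[abs_def] r_def
    by (auto intro!: derivative_eq_intros vd simp: algebra_simps)
  have rr: "stereo_inv x $ 1 * h$1 + stereo_inv x $ 2 * h$2 + stereo_inv x $ 3 * h$3 = 2 * r h / (nsq x + 1)" for h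
    by (simp add: stereo_inv_nth r_def add_divide_distrib algebra_simps)
  have q: "((\<lambda>x. 2 * x $ j / (nsq x + 1)) has_derivative
      (\<lambda>h. 2 / (nsq x + 1) * h $ j - 2 * r h / (nsq x + 1) * (2 * x $ j / (nsq x + 1)))) (at x)" for j
  proof -
    have num: "((\<lambda>x. 2 * x $ j) has_derivative (\<lambda>h. 2 * h $ j)) (at x)"
      by (auto intro!: derivative_eq_intros vd)
    have den: "((\<lambda>x. nsq x + 1) has_derivative (\<lambda>h. 2 * r h)) (at x)"
      by (auto intro!: derivative_eq_intros n)
    have alg: "(2 * p * N - 2 * y * (2 * q)) / (N * N) = 2 / N * p - 2 * q / N * (2 * y / N)" if "N \<noteq> 0" for N p y q :: real
      using that by (simp add: field_simps)
    show ?thesis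
      by (rule has_derivative_eq_rhs[OF has_derivative_divide'[OF num den nsq_ne]])
        (rule ext, rule alg[OF nsq_ne])
  qed
  have q4: "((\<lambda>x. (nsq x - 1) / (nsq x + 1)) has_derivative
      (\<lambda>h. 2 / (nsq x + 1) * (2 * r h / (nsq x + 1)))) (at x)"
    using nsq_ne[of x]
    by (auto intro!: derivative_eq_intros n simp: fun_eq_iff field_simps power2_eq_square)
  consider "i = 1" | "i = 2" | "i = 3" | "i = 4" using exhaust_4 by blast
  then show "((\<lambda>x. stereo_inv x \<bullet> k) has_derivative (\<lambda>h. sphere_push (stereo_inv x) h \<bullet> k)) (at x)"
    unfolding k inner_axis
    by cases (simp_all only: sphere_push_nth rr one_minus_stereo_inv_4, use q[of 1] q[of 2] q[of 3] q4 in
        \<open>simp_all only: stereo_inv_nth inner_real_def mult_1_right\<close>)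
qed

lemma frechet_derivative_stereo_inv: "frechet_derivative stereo_inv (at x) v = sphere_push (stereo_inv x) v"
  using frechet_derivative_at[OF stereo_inv_has_derivative[of x]] by simp

lemma sphere_push_tangent:
  assumes "q \<in> sphere 0 1"
  shows "sphere_push q v \<bullet> q = 0"
proof -
  define r where "r = q$1 * v$1 + q$2 * v$2 + q$3 * v$3"
  have s: "(q$1)\<^sup>2 + (q$2)\<^sup>2 + (q$3)\<^sup>2 = (1 - q$4) * (1 + q$4)"
    using assms unfolding sphere_4_iff by (simp add: power2_eq_square algebra_simps)
  have "sphere_push q v \<bullet> q = (1 - q$4) * r - r * ((q$1)\<^sup>2 + (q$2)\<^sup>2 + (q$3)\<^sup>2) + (1 - q$4) * r * q$4"
    by (simp add: inner_vec_def sum_4 sphere_push_nth r_def[symmetric] power2_eq_square)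
      (simp add: r_def algebra_simps)
  also have "\<dots> = 0" unfolding s by (simp add: algebra_simps)
  finally show ?thesis .
qed

lemma sphere_push_eq_0_iff: "sphere_push (stereo_inv x) v = 0 \<longleftrightarrow> v = 0"
proof
  assume z: "sphere_push (stereo_inv x) v = 0"
  define r where "r = stereo_inv x $1 * v$1 + stereo_inv x $2 * v$2 + stereo_inv x $3 * v$3"
  have ne: "1 - stereo_inv x $ 4 \<noteq> 0" using stereo_inv_4_less[of x] by simp
  have "sphere_push (stereo_inv x) v $ i = 0" for i using z by simp
  from this[of 1] this[of 2] this[of 3] this[of 4]
  have "(1 - stereo_inv x $ 4) * r = 0" "(1 - stereo_inv x $ 4) * v$1 - r * stereo_inv x $ 1 = 0"
    "(1 - stereo_inv x $ 4) * v$2 - r * stereo_inv x $ 2 = 0" "(1 - stereo_inv x $ 4) * v$3 - r * stereo_inv x $ 3 = 0"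
    unfolding sphere_push_nth r_def[symmetric] by blast+
  then show "v = 0" using ne by (intro vec3_eqI) auto
qed (simp add: vec_eq_iff forall_4 sphere_push_nth)

lemma sphere_push_scale_add:
  "sphere_push q (s *\<^sub>R v + t *\<^sub>R w) = s *\<^sub>R sphere_push q v + t *\<^sub>R sphere_push q w"
  by (rule vec4_eqI) (simp_all add: sphere_push_nth algebra_simps)

text \<open>In the stereographic chart \<open>hopf \<omega>\<close> is the conformal field \<open>hopf_chart \<omega>\<close>, whose flow
  rotates the circle formed by the third axis and infinity and has no fixed points.\<close>

definition hopf :: "real \<Rightarrow> real^4 \<Rightarrow> real^4" where
  "hopf \<omega> q = vector [- \<omega> * q$2, \<omega> * q$1, - 2 * q$4, 2 * q$3]"

definition hopf_chart :: "real \<Rightarrow> real^3 \<Rightarrow> real^3" where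
  "hopf_chart \<omega> v = vector [2 * v$1 * v$3 - \<omega> * v$2, 2 * v$2 * v$3 + \<omega> * v$1, 1 + (v$3)\<^sup>2 - (v$1)\<^sup>2 - (v$2)\<^sup>2]"

lemma hopf_stereo_inv: "hopf \<omega> (stereo_inv x) = sphere_push (stereo_inv x) (hopf_chart \<omega> x)"
proof -
  define N where "N = nsq x + 1"
  have N: "N \<noteq> 0" "nsq x - 1 = N - 2" using nsq_ne[of x] by (simp_all add: N_def)
  have x3: "(x$3)\<^sup>2 = N - 1 - (x$1)\<^sup>2 - (x$2)\<^sup>2" by (simp add: N_def nsq_def)
  have r: "stereo_inv x $1 * hopf_chart \<omega> x $1 + stereo_inv x $2 * hopf_chart \<omega> x $2 + stereo_inv x $3 * hopf_chart \<omega> x $3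
      = 2 * x$3"
  proof -
    have "x$1 * hopf_chart \<omega> x $1 + x$2 * hopf_chart \<omega> x $2 + x$3 * hopf_chart \<omega> x $3 = x$3 * N"
      by (simp add: hopf_chart_def N_def nsq_def power2_eq_square algebra_simps)
    then have "(2 * (x$1 * hopf_chart \<omega> x $1 + x$2 * hopf_chart \<omega> x $2 + x$3 * hopf_chart \<omega> x $3)) / N = 2 * x$3"
      using N by simp
    then show ?thesis by (simp add: stereo_inv_nth N_def[symmetric] add_divide_distrib distrib_left mult_ac)
  qed
  have hz: "1 + (x$3)\<^sup>2 - (x$1)\<^sup>2 - (x$2)\<^sup>2 = 2 - N + 2 * (x$3)\<^sup>2" using x3 by simp
  show ?thesis
    by (rule vec4_eqI; simp only: sphere_push_nth r one_minus_stereo_inv_4; simp add: stereo_inv_nth hopf_def hopf_chart_def N_def[symmetric] N(2) hz)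
      (use N in \<open>simp_all add: field_simps power2_eq_square\<close>)
qed

lemma hopf_tangent: "hopf \<omega> q \<bullet> q = 0"
  by (simp add: hopf_def inner_vec_def sum_4)

lemma hopf_north: "hopf \<omega> north \<noteq> 0"
proof -
  have "hopf \<omega> north $ 3 \<noteq> 0" by (simp add: hopf_def north_def)
  then show ?thesis by (metis zero_index)
qed

section \<open>Extending the field to infinity\<close>

text \<open>The orbit from \<open>P_Out\<close> leaves the ball above height -1 and the backward
  orbit from \<open>P_In\<close> leaves it below -2. Moving up from the one or down from the other
  increases \<open>\<bar>z + 2\<bar>\<close>, hence the distance from this centre.\<close>

definition centre :: "real^3" where "centre = vector [0, 0, -2]"

text \<open>Squared distances keep the cut-off elementary, and
  \<open>2 * R + 1 = (R + 1)\<^sup>2 - R\<^sup>2\<close> places the transition between the radii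
  \<open>R\<close> and \<open>R + 1\<close>.\<close>

definition chi :: "real \<Rightarrow> real^3 \<Rightarrow> real" where
  "chi R v = step (((v$1)\<^sup>2 + (v$2)\<^sup>2 + (v$3 + 2)\<^sup>2 - R\<^sup>2) / (2 * R + 1))"

text \<open>The derivative in \<open>z\<close> of the profiles
  \<open>(1 - step (z - (R + 3))) * x\<close> above and
  \<open>(1 - step (- z - (R + 3))) * y\<close> below: they carry the coordinates \<open>x\<close>
  of \<open>U\<close> and \<open>y\<close> of \<open>D\<close> to 0 within one unit of
  height.\<close>

definition shear :: "real \<Rightarrow> real \<Rightarrow> real \<Rightarrow> real \<Rightarrow> real" where
  "shear R x y z = step' (- z - (R + 3)) * y - step' (z - (R + 3)) * x"

text \<open>\<open>F\<close> on the ball of radius \<open>R\<close> around \<open>centre\<close>; a multiple of the upward field outside radius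
  \<open>R + 1\<close>, sheared so that the vertical lines through \<open>U\<close> (upwards) and \<open>D\<close> (downwards) join the
  third axis at height \<open>R + 4\<close>.\<close>

definition core :: "real \<times> real \<times> real \<Rightarrow> real \<Rightarrow> real^3 \<Rightarrow> real^3 \<Rightarrow> real^3 \<Rightarrow> real^3" where
  "core p R U D v = vector
    [(1 - chi R v) * roessler p v $ 1 + chi R v * ((1 + (v$3)\<^sup>2) * shear R (U$1) (D$1) (v$3)),
     (1 - chi R v) * roessler p v $ 2 + chi R v * ((1 + (v$3)\<^sup>2) * shear R (U$2) (D$2) (v$3)),
     (1 - chi R v) * roessler p v $ 3 + chi R v * (1 + (v$3)\<^sup>2)]"

text \<open>A squared radius that covers the ball of radius \<open>R + 1\<close> and the sheared
  curves up to height \<open>R + 4\<close>: horizontal and vertical parts contribute at most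
  \<open>(R + 4)\<^sup>2\<close> each.\<close>

definition far :: "real \<Rightarrow> real" where "far R = 2 * (R + 4)\<^sup>2"

text \<open>The fourth coordinate on the sphere as a function of the squared radius. Radial cut-offs
  expressed through this coordinate are smooth across \<open>north\<close>.\<close>

definition lat :: "real \<Rightarrow> real" where "lat s = (s - 1) / (s + 1)"

definition eta :: "real \<Rightarrow> real \<Rightarrow> real" where
  "eta R h = step ((h - lat (far R)) / (lat (far R + 1) - lat (far R)))"

text \<open>\<open>den\<close> agrees with \<open>1 - h\<close> up to the latitude \<open>lat (far R + 1)\<close> but has no zeros.\<close>

definition den :: "real \<Rightarrow> real \<Rightarrow> real" where
  "den R h = 1 - h + step ((h - lat (far R + 1)) / (1 - lat (far R + 1))) * h\<^sup>2"

definition chart :: "real \<Rightarrow> real^4 \<Rightarrow> real^3" where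
  "chart R q = vector [q$1 / den R (q$4), q$2 / den R (q$4), q$3 / den R (q$4)]"

text \<open>On the sphere, \<open>chart R\<close> inverts the stereographic map only up to squared
  radius \<open>far R + 1\<close>. From there on \<open>eta\<close> is 1 and the first term drops
  out, so of \<open>chart\<close> only the smoothness matters near \<open>north\<close>.\<close>

definition ext_field :: "real \<times> real \<times> real \<Rightarrow> real \<Rightarrow> real^3 \<Rightarrow> real^3 \<Rightarrow> real \<Rightarrow> real^4 \<Rightarrow> real^4" where
  "ext_field p R U D \<omega> q = (1 - eta R (q$4)) *\<^sub>R sphere_push q (core p R U D (chart R q)) + eta R (q$4) *\<^sub>R hopf \<omega> q"

lemma dist_centre: "(dist centre v)\<^sup>2 = (v$1)\<^sup>2 + (v$2)\<^sup>2 + (v$3 + 2)\<^sup>2"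
proof -
  have "(dist centre v)\<^sup>2 = (norm (v - centre))\<^sup>2" by (simp add: dist_norm norm_minus_commute)
  then show ?thesis unfolding norm_sq_3 by (simp add: centre_def)
qed

lemma norm_centre: "norm centre = 2"
proof -
  have "(norm centre)\<^sup>2 = 2\<^sup>2" unfolding norm_sq_3 by (simp add: centre_def)
  then show ?thesis by (rule power2_eq_imp_eq) auto
qed

lemma dist_centre_le: "dist centre v \<le> norm v + 2"
  using norm_triangle_ineq4[of centre v] norm_centre by (simp add: dist_norm)

lemma chi_bounds: "0 \<le> chi R v" "chi R v \<le> 1"
  by (simp_all add: chi_def step_bounds)

lemma chi_eq_0: "R > 0 \<Longrightarrow> chi R v = 0 \<longleftrightarrow> dist centre v \<le> R"
proof -
  assume R: "R > 0"
  have "chi R v = 0 \<longleftrightarrow> (dist centre v)\<^sup>2 \<le> R\<^sup>2"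
    unfolding chi_def step_eq_0_iff dist_centre using R by (simp add: divide_le_0_iff)
  then show ?thesis using R by (simp add: abs_le_square_iff[symmetric])
qed

lemma chi_eq_1: "R > 0 \<Longrightarrow> chi R v = 1 \<longleftrightarrow> R + 1 \<le> dist centre v"
proof -
  assume R: "R > 0"
  have "chi R v = 1 \<longleftrightarrow> (R + 1)\<^sup>2 \<le> (dist centre v)\<^sup>2"
    unfolding chi_def step_eq_1_iff dist_centre using R by (simp add: le_divide_eq power2_eq_square algebra_simps)
  then show ?thesis using R by (simp add: abs_le_square_iff[symmetric])
qed

lemma cball_centre_bounds:
  assumes "dist centre v \<le> R + 1" "R > 0"
  shows "\<bar>v$1\<bar> \<le> R + 1" "\<bar>v$2\<bar> \<le> R + 1" "\<bar>v$3 + 2\<bar> \<le> R + 1" "\<bar>v$3\<bar> \<le> R + 3" "nsq v \<le> far R"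
proof -
  have d: "(v$1)\<^sup>2 + (v$2)\<^sup>2 + (v$3 + 2)\<^sup>2 \<le> (R + 1)\<^sup>2"
    unfolding dist_centre[symmetric] using assms by (intro power_mono) auto
  have *: "\<bar>t\<bar> \<le> R + 1" if "t\<^sup>2 \<le> (R + 1)\<^sup>2" for t
    using that assms(2) abs_le_square_iff[of t "R + 1"] by simp
  show "\<bar>v$1\<bar> \<le> R + 1" "\<bar>v$2\<bar> \<le> R + 1" and 3: "\<bar>v$3 + 2\<bar> \<le> R + 1"
    using d zero_le_power2[of "v$1"] zero_le_power2[of "v$2"] zero_le_power2[of "v$3 + 2"]
    by (intro *; linarith)+
  then show 4: "\<bar>v$3\<bar> \<le> R + 3" by linarith
  have "(v$1)\<^sup>2 + (v$2)\<^sup>2 \<le> (R + 1)\<^sup>2" using d zero_le_power2[of "v$3 + 2"] by linarith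
  also have "\<dots> \<le> (R + 4)\<^sup>2" using assms by (intro power_mono) auto
  finally have "(v$1)\<^sup>2 + (v$2)\<^sup>2 \<le> (R + 4)\<^sup>2" .
  moreover have "(v$3)\<^sup>2 \<le> (R + 4)\<^sup>2" using 4 assms by (subst abs_le_square_iff[symmetric]) auto
  ultimately show "nsq v \<le> far R" by (simp add: nsq_def far_def)
qed

lemma shear_eq_0: "\<bar>z\<bar> \<le> R + 3 \<Longrightarrow> shear R x y z = 0"
  unfolding shear_def by (subst (1 2) step'_eq_0) auto

text \<open>The shear vanishes on this ball, so the right-hand side is free of \<open>U\<close> and
  \<open>D\<close>. Its orbits can therefore be used to define these points.\<close>

lemma core_cball:
  assumes "v \<in> cball centre (R + 1)" "R > 0"
  shows "core p R U D v = (1 - chi R v) *\<^sub>R roessler p v + (chi R v * (1 + (v$3)\<^sup>2)) *\<^sub>R axis 3 1"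
  using shear_eq_0[OF cball_centre_bounds(4)] assms
  by (intro vec3_eqI) (simp_all add: core_def axis_def)

lemma far_pos: "R > 0 \<Longrightarrow> far R > 0"
  by (simp add: far_def)

lemma lat_mono: "-1 < s \<Longrightarrow> -1 < t \<Longrightarrow> lat s \<le> lat t \<longleftrightarrow> s \<le> t"
proof -
  assume "-1 < s" "-1 < t"
  then have "lat s = 1 - 2 * inverse (s + 1)" "lat t = 1 - 2 * inverse (t + 1)" "s + 1 > 0" "t + 1 > 0"
    by (simp_all add: lat_def field_simps)
  then show ?thesis by (simp add: inverse_le_iff_le)
qed

lemma lat_less_1: "-1 < s \<Longrightarrow> lat s < 1"
  by (simp add: lat_def)

lemma lat_nsq: "stereo_inv x $ 4 = lat (nsq x)"
  by (simp add: stereo_inv_nth lat_def)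

lemma lat_gap: "R > 0 \<Longrightarrow> lat (far R + 1) - lat (far R) > 0"
  using lat_mono[of "far R + 1" "far R"] far_pos[of R] by simp

lemma eta_stereo:
  assumes "R > 0"
  shows "eta R (stereo_inv x $ 4) = 0 \<longleftrightarrow> nsq x \<le> far R"
    "eta R (stereo_inv x $ 4) = 1 \<longleftrightarrow> far R + 1 \<le> nsq x"
proof -
  have n: "-1 < nsq x" "-1 < far R" "-1 < far R + 1" using nsq_nonneg[of x] far_pos[OF assms] by simp_all
  show "eta R (stereo_inv x $ 4) = 0 \<longleftrightarrow> nsq x \<le> far R"
    unfolding eta_def step_eq_0_iff lat_nsq lat_mono[OF n(1,2), symmetric] using lat_gap[OF assms] by (simp add: divide_le_0_iff)
  show "eta R (stereo_inv x $ 4) = 1 \<longleftrightarrow> far R + 1 \<le> nsq x"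
    unfolding eta_def step_eq_1_iff lat_nsq lat_mono[OF n(3,1), symmetric] using lat_gap[OF assms] by (simp add: le_divide_eq)
qed

lemma eta_bounds: "0 \<le> eta R h" "eta R h \<le> 1"
  by (simp_all add: eta_def step_bounds)

lemma eta_north: "R > 0 \<Longrightarrow> eta R 1 = 1"
proof -
  assume R: "R > 0"
  have "lat (far R + 1) < 1" using far_pos[OF R] by (intro lat_less_1) simp
  then show ?thesis unfolding eta_def using lat_gap[OF R] by (intro step_eq_1) (simp add: le_divide_eq)
qed

text \<open>Positivity is needed for every real \<open>h\<close>, as an elementary quotient requires
  a denominator without zeros on R^4. From \<open>h = 1\<close> on the added term is
  \<open>h\<^sup>2\<close>, and \<open>1 - h + h\<^sup>2 > 0\<close>.\<close>

lemma den_pos: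
  assumes "R > 0"
  shows "den R h > 0"
proof (cases "h < 1")
  case True
  then show ?thesis unfolding den_def by (intro add_pos_nonneg mult_nonneg_nonneg step_bounds) auto
next
  case False
  then have "h * 1 \<le> h * h" by (intro mult_left_mono) auto
  moreover have "step ((h - lat (far R + 1)) / (1 - lat (far R + 1))) = 1"
    using lat_less_1[of "far R + 1"] far_pos[OF assms] False by (intro step_eq_1) (simp add: le_divide_eq)
  ultimately show ?thesis by (simp add: den_def power2_eq_square)
qed

lemma chart_stereo:
  assumes "R > 0" "nsq x \<le> far R + 1"
  shows "chart R (stereo_inv x) = x"
proof -
  have n: "-1 < nsq x" "-1 < far R + 1" using nsq_nonneg[of x] far_pos[OF assms(1)] by simp_all
  have "lat (nsq x) \<le> lat (far R + 1)" using lat_mono[OF n] assms by simp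
  then have "step ((stereo_inv x $ 4 - lat (far R + 1)) / (1 - lat (far R + 1))) = 0"
    unfolding lat_nsq using lat_less_1[OF n(2)] by (intro step_eq_0) (simp add: divide_le_0_iff)
  then have "den R (stereo_inv x $ 4) = 1 - stereo_inv x $ 4" by (simp add: den_def)
  then show ?thesis using stereo_inv_coords[of x] by (intro vec3_eqI) (simp_all add: chart_def)
qed

lemma ext_field_stereo:
  assumes "R > 0"
  shows "ext_field p R U D \<omega> (stereo_inv x) = sphere_push (stereo_inv x)
    ((1 - eta R (stereo_inv x $ 4)) *\<^sub>R core p R U D x + eta R (stereo_inv x $ 4) *\<^sub>R hopf_chart \<omega> x)"
proof (cases "nsq x \<le> far R + 1")
  case True
  show ?thesis
    by (simp only: ext_field_def hopf_stereo_inv sphere_push_scale_add chart_stereo[OF assms True])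
next
  case False
  then have "eta R (stereo_inv x $ 4) = 1" using eta_stereo(2)[OF assms, of x] by simp
  then show ?thesis by (simp add: ext_field_def hopf_stereo_inv)
qed

lemma ext_field_near:
  assumes "R > 0" "nsq x \<le> far R"
  shows "ext_field p R U D \<omega> (stereo_inv x) = sphere_push (stereo_inv x) (core p R U D x)"
  using eta_stereo(1)[OF assms(1), of x] assms by (simp add: ext_field_stereo)

lemma ext_field_ball:
  assumes "R > 0" "dist centre x \<le> R"
  shows "ext_field p R U D \<omega> (stereo_inv x) = sphere_push (stereo_inv x) (roessler p x)"
proof -
  have "chi R x = 0" using chi_eq_0 assms by blast
  moreover have "nsq x \<le> far R" using cball_centre_bounds(5)[of x R] assms by simp
  ultimately show ?thesis using assms by (simp add: ext_field_near core_cball)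
qed

section \<open>Smoothness and zeros of the extended field\<close>

lemma el_cdivide: "elementary f \<Longrightarrow> elementary (\<lambda>x. f x / c)"
  unfolding divide_inverse by (intro el_mult el_const)

lemma elementary_core:
  assumes g: "elementary (\<lambda>q. g q $ 1)" "elementary (\<lambda>q. g q $ 2)" "elementary (\<lambda>q. g q $ 3)"
  shows "elementary (\<lambda>q. core (a, b, c) R U D (g q) $ k)"
proof -
  have ch: "elementary (\<lambda>q. chi R (g q))" unfolding chi_def
    by (intro el_step el_cdivide el_add el_diff el_power el_const g)
  have sh: "elementary (\<lambda>q. shear R x y (g q $ 3))" for x y unfolding shear_def
    by (intro el_mult el_diff el_step' el_minus el_const g)
  consider "k = 1" | "k = 2" | "k = 3" using exhaust_3 by blast
  then show ?thesis
    by cases (simp_all only: core_def vector_3 roessler_nth,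
      (intro el_mult el_add el_diff el_minus el_power el_const g ch sh)+)
qed

lemma elementary_ext_field:
  assumes "R > 0"
  shows "elementary (\<lambda>q. ext_field (a, b, c) R U D \<omega> q $ k)"
proof -
  have den: "elementary (\<lambda>q :: real^4. den R (q$4))" unfolding den_def
    by (intro el_mult el_add el_diff el_step el_cdivide el_power el_const el_coord)
  have ne: "den R h \<noteq> 0" for h using den_pos[OF assms, of h] by simp
  have "elementary (\<lambda>q :: real^4. q $ i / den R (q$4))" for i
    by (intro el_divide el_coord den ne)
  then have "elementary (\<lambda>q. chart R q $ 1)" "elementary (\<lambda>q. chart R q $ 2)" "elementary (\<lambda>q. chart R q $ 3)"
    unfolding chart_def vector_3 by this+
  note co = elementary_core[OF this]
  have et: "elementary (\<lambda>q :: real^4. eta R (q$4))" unfolding eta_def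
    by (intro el_step el_cdivide el_diff el_const el_coord)
  have hp: "elementary (\<lambda>q. hopf \<omega> q $ k)"
  proof -
    consider "k = 1" | "k = 2" | "k = 3" | "k = 4" using exhaust_4 by blast
    then show ?thesis
      by cases (simp_all only: hopf_def vector_4, (intro el_mult el_const el_coord)+)
  qed
  have pu: "elementary (\<lambda>q. sphere_push q (core (a, b, c) R U D (chart R q)) $ k)"
  proof -
    consider "k = 1" | "k = 2" | "k = 3" | "k = 4" using exhaust_4 by blast
    then show ?thesis
      by cases (simp_all only: sphere_push_nth, (intro el_mult el_add el_diff el_const el_coord co)+)
  qed
  show ?thesis unfolding ext_field_def vector_add_component vector_scaleR_component real_scaleR_def
    by (intro el_mult el_add el_diff el_const et hp pu)
qed

lemma smooth_ext_field:
  assumes "R > 0"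
  shows "smooth_vf_S3 (ext_field (a, b, c) R U D \<omega>)"
  unfolding smooth_vf_S3_def smooth_map_def
proof (intro conjI allI ballI)
  show "smooth_real (\<lambda>q. ext_field (a, b, c) R U D \<omega> q $ k)" for k
    by (intro elementary_smooth_real elementary_ext_field assms)
  show "ext_field (a, b, c) R U D \<omega> q \<bullet> q = 0" if "q \<in> sphere 0 1" for q
    by (simp add: ext_field_def inner_add_left sphere_push_tangent[OF that] hopf_tangent)
qed

text \<open>\<open>F\<close> points in the direction \<open>(0, 0, -1)\<close> only on the segment between the two fixed points,
  so adding the upward field outside a large ball creates no new zeros. Where the sheared field is
  blended with the rotating one, a zero would force \<open>\<omega>\<close> to be small.\<close>

lemma ext_field_zeros:
  assumes g: "good_param (a, b, c)" and R: "R \<ge> c + 2 * (c / a) + 2"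
    and B: "\<And>t. \<bar>step' t\<bar> \<le> B" "B > 0"
    and ab: "\<And>i. \<bar>U $ i\<bar> \<le> R + 3" "\<And>i. \<bar>D $ i\<bar> \<le> R + 3"
    and \<omega>: "\<omega> > 4 * B * (R + 3) * sqrt (far R + 1)"
  shows "{q \<in> sphere 0 1. ext_field (a, b, c) R U D \<omega> q = 0} = {stereo_inv P_In, stereo_inv (P_Out (a, b, c))}"
proof -
  note gp = good_param_fixpoints[OF g]
  have ca: "c / a > 0" using gp by simp
  have R0: "R > 0" using R gp ca by linarith
  \<comment> \<open>This segment contains both fixed points; fitting it into the ball is what the
    lower bound on \<open>R\<close> is for.\<close>
  have seg: "dist centre v \<le> R" if v: "v$2 = - (v$3)" "v$1 = a * v$3" "0 \<le> v$3" "v$3 \<le> c / a" for v :: "real^3"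
  proof -
    have v1: "0 \<le> v$1" "v$1 \<le> c" using v gp by (simp_all add: pos_le_divide_eq mult.commute)
    have "(dist centre v)\<^sup>2 \<le> c\<^sup>2 + (c / a)\<^sup>2 + (c / a + 2)\<^sup>2"
      unfolding dist_centre v(1) power2_minus using v(3,4) v1 by (intro add_mono power_mono) auto
    also have "\<dots> \<le> (c + 2 * (c / a) + 2)\<^sup>2"
    proof -
      have "x\<^sup>2 + y\<^sup>2 + (y + 2)\<^sup>2 \<le> (x + 2 * y + 2)\<^sup>2" if "x > 0" "y > 0" for x y :: real
        using that mult_pos_pos[OF that] mult_pos_pos[OF that(2) that(2)] by (simp add: power2_eq_square algebra_simps)
      moreover have "c > 0" "c / a > 0" using gp ca by auto
      ultimately show ?thesis by blast
    qed
    also have "\<dots> \<le> R\<^sup>2" using R gp ca by (intro power_mono) auto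
    finally show ?thesis using R0 by (simp add: abs_le_square_iff[symmetric])
  qed
  define W where "W v = (1 - eta R (stereo_inv v $ 4)) *\<^sub>R core (a, b, c) R U D v + eta R (stereo_inv v $ 4) *\<^sub>R hopf_chart \<omega> v" for v
  have W_ball: "W v = roessler (a, b, c) v" if "dist centre v \<le> R" for v
  proof -
    have "chi R v = 0" using chi_eq_0 R0 that by blast
    moreover have "eta R (stereo_inv v $ 4) = 0"
      using cball_centre_bounds(5)[of v R] that R0 by (simp add: eta_stereo)
    ultimately show ?thesis using that R0 by (simp add: W_def core_cball)
  qed
  have W0: "W v = 0 \<longleftrightarrow> v = P_In \<or> v = P_Out (a, b, c)" for v
  proof
    assume "v = P_In \<or> v = P_Out (a, b, c)"
    moreover have "dist centre v \<le> R"
    proof (rule seg)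
      show "v$2 = - (v$3)" "v$1 = a * v$3" "0 \<le> v$3" "v$3 \<le> c / a"
        using calculation gp ca mult_strict_mono[of a 1 b 1] by (auto simp: P_Out_nth field_simps)
    qed
    ultimately show "W v = 0" using W_ball gp by auto
  next
    assume z: "W v = 0"
    consider "dist centre v \<le> R" | "R < dist centre v" "dist centre v < R + 1" | "R + 1 \<le> dist centre v" by linarith
    then show "v = P_In \<or> v = P_Out (a, b, c)"
    proof cases
      case 1
      then show ?thesis using z W_ball gp(3) by simp
    next
      case 2
      have c1: "chi R v \<noteq> 0" "chi R v \<noteq> 1" using chi_eq_0[OF R0, of v] chi_eq_1[OF R0, of v] 2 by auto
      then have c2: "0 < chi R v" "chi R v < 1" using chi_bounds[of R v] by auto
      have "eta R (stereo_inv v $ 4) = 0" using cball_centre_bounds(5)[of v R] 2 R0 by (simp add: eta_stereo)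
      then have "core (a, b, c) R U D v = 0" using z by (simp add: W_def)
      then have "((1 - chi R v) *\<^sub>R roessler (a, b, c) v + (chi R v * (1 + (v$3)\<^sup>2)) *\<^sub>R axis 3 1) $ i = 0" for i
        using 2 R0 by (simp add: core_cball)
      from this[of 1] this[of 2] this[of 3]
      \<comment> \<open>The first two components put \<open>v\<close> on the line through the fixed
        points. The third then places its height strictly between theirs, so \<open>v\<close> would
        lie in the smaller ball.\<close>
      have e: "v$2 = - (v$3)" "v$1 = - a * v$2"
        "(1 - chi R v) * (b * v$1 + v$3 * (v$1 - c)) + chi R v * (1 + (v$3)\<^sup>2) = 0"
        using c2 by (auto simp: axis_def)
      have "chi R v * (1 + (v$3)\<^sup>2) > 0" using c2 by (intro mult_pos_pos) (auto intro: add_pos_nonneg)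
      then have "(1 - chi R v) * (b * v$1 + v$3 * (v$1 - c)) < 0" using e(3) by linarith
      then have "b * v$1 + v$3 * (v$1 - c) < 0" using c2 by (simp add: mult_less_0_iff)
      then have neg: "v$3 * (a * v$3 - (c - a * b)) < 0" using e by (simp add: algebra_simps)
      have cab: "0 < c - a * b" using gp mult_strict_mono[of a 1 b 1] by simp
      have v3: "0 < v$3 \<and> a * v$3 < c - a * b"
      proof (rule ccontr)
        assume "\<not> ?thesis"
        then have "v$3 < 0" "c - a * b < a * v$3" using neg by (auto simp: mult_less_0_iff)
        then show False using cab mult_pos_neg[OF gp(4)] by fastforce
      qed
      have "a * v$3 \<le> c" using v3 mult_pos_pos[OF gp(4,6)] by linarith
      then have "v$3 \<le> c / a" using gp by (simp add: pos_le_divide_eq mult.commute)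
      then have "dist centre v \<le> R" using e v3 by (intro seg) auto
      then show ?thesis using 2 by simp
    next
      case 3
      define z where "z = v$3"
      define \<eta> where "\<eta> = eta R (stereo_inv v $ 4)"
      define m where "m i = shear R (U$i) (D$i) z" for i
      have ch: "chi R v = 1" using chi_eq_1[OF R0] 3 by blast
      have "W v $ i = 0" for i using \<open>W v = 0\<close> by simp
      from this[of 1] this[of 2] this[of 3]
      have e: "(1 - \<eta>) * ((1 + z\<^sup>2) * m 1) + \<eta> * (2 * v$1 * z - \<omega> * v$2) = 0"
        "(1 - \<eta>) * ((1 + z\<^sup>2) * m 2) + \<eta> * (2 * v$2 * z + \<omega> * v$1) = 0"
        "(1 - \<eta>) * (1 + z\<^sup>2) + \<eta> * (1 + z\<^sup>2 - (v$1)\<^sup>2 - (v$2)\<^sup>2) = 0"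
        by (simp_all add: W_def core_def ch hopf_chart_def \<eta>_def m_def z_def)
      have h: "\<eta> * ((v$1)\<^sup>2 + (v$2)\<^sup>2) = 1 + z\<^sup>2" using e(3) by (simp add: algebra_simps)
      have z2: "1 + z\<^sup>2 > 0" by (simp add: add_pos_nonneg)
      \<comment> \<open>The angular component: the radial terms cancel in this combination, and the
        third equation \<open>h\<close> turns the factor of \<open>\<omega>\<close> into
        \<open>1 + z\<^sup>2\<close>.\<close>
      have "v$1 * ((1 - \<eta>) * ((1 + z\<^sup>2) * m 2) + \<eta> * (2 * v$2 * z + \<omega> * v$1))
         - v$2 * ((1 - \<eta>) * ((1 + z\<^sup>2) * m 1) + \<eta> * (2 * v$1 * z - \<omega> * v$2)) = 0" unfolding e by simp
      then have "(1 + z\<^sup>2) * ((1 - \<eta>) * (v$1 * m 2 - v$2 * m 1)) + \<omega> * (\<eta> * ((v$1)\<^sup>2 + (v$2)\<^sup>2)) = 0"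
        by (simp add: power2_eq_square algebra_simps)
      then have "(1 + z\<^sup>2) * ((1 - \<eta>) * (v$1 * m 2 - v$2 * m 1) + \<omega>) = 0" unfolding h by (simp add: algebra_simps)
      then have "(1 - \<eta>) * (v$1 * m 2 - v$2 * m 1) + \<omega> = 0" using z2 by (metis less_irrefl mult_eq_0_iff)
      then have om: "\<omega> = (1 - \<eta>) * (v$2 * m 1 - v$1 * m 2)" by (simp add: algebra_simps)
      have \<omega>0: "\<omega> > 0"
      proof -
        have "0 \<le> 4 * B * (R + 3) * sqrt (far R + 1)" using B(2) R0 far_pos[OF R0] by simp
        then show ?thesis using \<omega> by linarith
      qed
      then have "\<eta> \<noteq> 1" using om by auto
      then have n: "nsq v \<le> far R + 1" using eta_stereo(2)[OF R0, of v] by (simp add: \<eta>_def)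
      \<comment> \<open>The bound on \<open>\<omega>\<close> arises from here: two shear terms of
        size \<open>B * (R + 3)\<close> each, multiplied by two coordinates of size
        \<open>sqrt (far R + 1)\<close>.\<close>
      have mb: "\<bar>m i\<bar> \<le> 2 * B * (R + 3)" for i
      proof -
        have "\<bar>step' (- z - (R + 3)) * D $ i\<bar> \<le> B * (R + 3)" "\<bar>step' (z - (R + 3)) * U $ i\<bar> \<le> B * (R + 3)"
          unfolding abs_mult using B ab R0 by (intro mult_mono; simp)+
        then show ?thesis unfolding m_def shear_def by linarith
      qed
      have sq: "\<bar>x\<bar> \<le> sqrt (far R + 1)" if "x\<^sup>2 \<le> far R + 1" for x
        using real_sqrt_le_mono[OF that] by simp
      have "(v$1)\<^sup>2 \<le> far R + 1" "(v$2)\<^sup>2 \<le> far R + 1"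
        using n zero_le_power2[of "v$1"] zero_le_power2[of "v$2"] zero_le_power2[of "v$3"]
        unfolding nsq_def by linarith+
      then have vb: "\<bar>v$1\<bar> \<le> sqrt (far R + 1)" "\<bar>v$2\<bar> \<le> sqrt (far R + 1)" by (auto intro: sq)
      have s0: "0 \<le> sqrt (far R + 1)" using far_pos[OF R0] by simp
      have "\<bar>v$2 * m 1\<bar> \<le> sqrt (far R + 1) * (2 * B * (R + 3))" "\<bar>v$1 * m 2\<bar> \<le> sqrt (far R + 1) * (2 * B * (R + 3))"
        unfolding abs_mult using vb mb s0 by (intro mult_mono; simp)+
      then have "\<bar>v$2 * m 1 - v$1 * m 2\<bar> \<le> 2 * (sqrt (far R + 1) * (2 * B * (R + 3)))" by linarith
      then have "\<bar>v$2 * m 1 - v$1 * m 2\<bar> \<le> 4 * B * (R + 3) * sqrt (far R + 1)" by (simp add: algebra_simps)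
      moreover have "\<bar>1 - \<eta>\<bar> \<le> 1" using eta_bounds[of R "stereo_inv v $ 4"] by (simp add: \<eta>_def)
      ultimately have "\<bar>(1 - \<eta>) * (v$2 * m 1 - v$1 * m 2)\<bar> \<le> 1 * (4 * B * (R + 3) * sqrt (far R + 1))"
        unfolding abs_mult by (intro mult_mono) auto
      then show ?thesis using om \<omega> \<omega>0 by simp
    qed
  qed
  have V0: "ext_field (a, b, c) R U D \<omega> (stereo_inv v) = 0 \<longleftrightarrow> v = P_In \<or> v = P_Out (a, b, c)" for v
    unfolding ext_field_stereo[OF R0] W_def[symmetric] sphere_push_eq_0_iff by (rule W0)
  have "north $ 4 = 1" by (simp add: north_def)
  then have "ext_field (a, b, c) R U D \<omega> north \<noteq> 0"
    using hopf_north eta_north[OF R0] by (simp add: ext_field_def)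
  then have "q \<in> sphere 0 1 \<and> ext_field (a, b, c) R U D \<omega> q = 0
      \<longleftrightarrow> q = stereo_inv P_In \<or> q = stereo_inv (P_Out (a, b, c))" for q
    using sphere_cases[of q] V0 stereo_inv_sphere[of P_In] stereo_inv_sphere[of "P_Out (a, b, c)"] by auto
  then show ?thesis by (intro set_eqI) (simp only: mem_Collect_eq insert_iff empty_iff simp_thms)
qed

section \<open>The orbit through infinity\<close>

lemma sol_on_stereo:
  assumes g: "sol_on W S I g" and V: "\<And>v. v \<in> S \<Longrightarrow> V (stereo_inv v) = sphere_push (stereo_inv v) (W v)"
  shows "sol_on V (sphere 0 1) I (\<lambda>t. stereo_inv (g t))"
  unfolding sol_on_def
proof (intro ballI conjI)
  fix t assume t: "t \<in> I"
  show "stereo_inv (g t) \<in> sphere 0 1" by (rule stereo_inv_sphere)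
  have "(stereo_inv has_derivative sphere_push (stereo_inv (g t))) (at (g t) within g ` I)"
    by (rule has_derivative_at_withinI[OF stereo_inv_has_derivative])
  from vector_derivative_diff_chain_within[OF sol_onD(2)[OF g t] this]
  show "((\<lambda>t. stereo_inv (g t)) has_vector_derivative V (stereo_inv (g t))) (at t within I)"
    by (simp add: o_def V[OF sol_onD(1)[OF g t]])
qed

lemma stereo_inv_tendsto: "(g \<longlongrightarrow> P) F \<Longrightarrow> ((\<lambda>t. stereo_inv (g t)) \<longlongrightarrow> stereo_inv P) F"
  by (rule isCont_tendsto_compose[OF has_derivative_continuous[OF stereo_inv_has_derivative]])

text \<open>Along a graph over the third axis the height satisfies
  \<open>z' = 1 + z\<^sup>2\<close>, which \<open>tan\<close> solves; so the orbit takes the time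
  from \<open>arctan z0\<close> to \<open>arctan z1\<close>.\<close>

lemma conn_stereo_curve:
  fixes m1 m2 \<mu>1 \<mu>2 :: "real \<Rightarrow> real"
  assumes z: "z0 \<le> z1"
    and m: "\<And>z. z \<in> {z0..z1} \<Longrightarrow> (m1 has_real_derivative \<mu>1 z) (at z)" "\<And>z. z \<in> {z0..z1} \<Longrightarrow> (m2 has_real_derivative \<mu>2 z) (at z)"
    and V: "\<And>z. z \<in> {z0..z1} \<Longrightarrow> V (stereo_inv (vector [m1 z, m2 z, z]))
        = sphere_push (stereo_inv (vector [m1 z, m2 z, z])) (vector [(1 + z\<^sup>2) * \<mu>1 z, (1 + z\<^sup>2) * \<mu>2 z, 1 + z\<^sup>2])"
  shows "conn V (sphere 0 1) (stereo_inv (vector [m1 z0, m2 z0, z0])) (stereo_inv (vector [m1 z1, m2 z1, z1]))"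
proof -
  define cv :: "real \<Rightarrow> real^3" where "cv z = vector [m1 z, m2 z, z]" for z
  define W :: "real^3 \<Rightarrow> real^3" where
    "W v = vector [(1 + (v$3)\<^sup>2) * \<mu>1 (v$3), (1 + (v$3)\<^sup>2) * \<mu>2 (v$3), 1 + (v$3)\<^sup>2]" for v
  have "sol_on W (cv ` {z0..z1}) {arctan z0..arctan z1} (\<lambda>t. cv (tan t))"
    unfolding sol_on_def
  proof (intro ballI conjI)
    fix t assume t: "t \<in> {arctan z0..arctan z1}"
    then have tb: "- (pi / 2) < t" "t < pi / 2" using arctan_bounded[of z0] arctan_bounded[of z1] by auto
    then have cs: "cos t > 0" by (rule cos_gt_zero_pi)
    have "tan (arctan z0) \<le> tan t" "tan t \<le> tan (arctan z1)"
      using t tb arctan_bounded[of z0] arctan_bounded[of z1] by (auto intro!: tan_mono_le)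
    then have tz: "tan t \<in> {z0..z1}" by (simp add: tan_arctan)
    then show "cv (tan t) \<in> cv ` {z0..z1}" by simp
    have dt: "(tan has_real_derivative 1 + (tan t)\<^sup>2) (at t within {arctan z0..arctan z1})"
    proof -
      have ne: "cos t \<noteq> 0" using cs by simp
      have "inverse ((cos t)\<^sup>2) = 1 + (tan t)\<^sup>2" unfolding tan_sec[OF ne] by (rule power_inverse[symmetric])
      then show ?thesis using has_field_derivative_at_within[OF DERIV_tan[OF ne]] by simp
    qed
    show "((\<lambda>t. cv (tan t)) has_vector_derivative W (cv (tan t))) (at t within {arctan z0..arctan z1})"
    proof (rule has_vector_derivative_3)
      show "((\<lambda>t. cv (tan t) $ 1) has_real_derivative W (cv (tan t)) $ 1) (at t within {arctan z0..arctan z1})"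
        using DERIV_chain2[OF m(1)[OF tz] dt] by (simp add: cv_def W_def mult.commute)
      show "((\<lambda>t. cv (tan t) $ 2) has_real_derivative W (cv (tan t)) $ 2) (at t within {arctan z0..arctan z1})"
        using DERIV_chain2[OF m(2)[OF tz] dt] by (simp add: cv_def W_def mult.commute)
      show "((\<lambda>t. cv (tan t) $ 3) has_real_derivative W (cv (tan t)) $ 3) (at t within {arctan z0..arctan z1})"
        using dt by (simp add: cv_def W_def)
    qed
  qed
  then have "sol_on V (sphere 0 1) {arctan z0..arctan z1} (\<lambda>t. stereo_inv (cv (tan t)))"
    by (rule sol_on_stereo) (use V in \<open>auto simp: cv_def W_def\<close>)
  from connI[OF this] z show ?thesis by (simp add: arctan_le_iff tan_arctan cv_def)
qed

lemma core_far:
  assumes "R > 0" "dist centre v \<ge> R + 1"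
  shows "core p R U D v = vector [(1 + (v$3)\<^sup>2) * shear R (U$1) (D$1) (v$3), (1 + (v$3)\<^sup>2) * shear R (U$2) (D$2) (v$3), 1 + (v$3)\<^sup>2]"
  using chi_eq_1[OF assms(1), of v] assms(2) by (simp add: core_def)

text \<open>The sign \<open>\<sigma>\<close> treats the upper and the lower curve together. The
  curve must stay where \<open>chi\<close> is 1 and \<open>eta\<close> is 0: below the shear it is
  vertical and moves away from the ball, beyond \<open>\<sigma> * z = R + 3\<close> the height alone
  keeps it outside, and \<open>far R\<close> was chosen to contain it.\<close>

lemma conn_shear:
  assumes R: "R > 1" and P: "dist centre P = R + 1" and \<sigma>: "\<sigma> = 1 \<or> \<sigma> = (-1 :: real)" and "z0 \<le> z1"
    and m: "\<And>i z. m i z = (1 - step (\<sigma> * z - (R + 3))) * P $ i"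
    and z: "\<And>z. z \<in> {z0..z1} \<Longrightarrow> \<bar>z\<bar> \<le> R + 4 \<and> (\<sigma> * z \<le> R + 3 \<longrightarrow> \<bar>P $ 3 + 2\<bar> \<le> \<bar>z + 2\<bar>)"
    and sh: "\<And>i z. z \<in> {z0..z1} \<Longrightarrow> shear R (U $ i) (D $ i) z = - \<sigma> * step' (\<sigma> * z - (R + 3)) * P $ i"
  shows "conn (ext_field p R U D \<omega>) (sphere 0 1)
    (stereo_inv (vector [m 1 z0, m 2 z0, z0])) (stereo_inv (vector [m 1 z1, m 2 z1, z1]))"
proof -
  define \<mu> where "\<mu> i z = - \<sigma> * step' (\<sigma> * z - (R + 3)) * P $ i" for i z
  have dm: "(m i has_real_derivative \<mu> i z) (at z)" for i z
  proof -
    have "((\<lambda>z. step (\<sigma> * z - (R + 3))) has_real_derivative step' (\<sigma> * z - (R + 3)) * \<sigma>) (at z)"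
      by (rule DERIV_chain2[OF step_has_derivative]) (auto intro!: derivative_eq_intros)
    then show ?thesis unfolding m[abs_def] \<mu>_def by (auto intro!: derivative_eq_intros)
  qed
  show ?thesis
  proof (rule conn_stereo_curve[OF \<open>z0 \<le> z1\<close> dm dm])
    fix z assume "z \<in> {z0..z1}"
    note z = z[OF this] and sh = sh[OF this]
    define v :: "real^3" where "v = vector [m 1 z, m 2 z, z]"
    have v: "v$1 = m 1 z" "v$2 = m 2 z" "v$3 = z" by (simp_all add: v_def)
    have far: "R + 1 \<le> dist centre v"
    proof (cases "\<sigma> * z \<le> R + 3")
      case True
      then have "m i z = P $ i" for i by (simp add: m step_eq_0)
      moreover have "(P$3 + 2)\<^sup>2 \<le> (z + 2)\<^sup>2" using z True by (subst abs_le_square_iff[symmetric]) simp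
      ultimately have "(dist centre P)\<^sup>2 \<le> (dist centre v)\<^sup>2" unfolding dist_centre v by simp
      then show ?thesis using P power2_le_imp_le[of "dist centre P" "dist centre v"] by simp
    next
      case False
      then have "\<bar>R + 1\<bar> \<le> \<bar>z + 2\<bar>" using \<sigma> R by auto
      then have "(R + 1)\<^sup>2 \<le> (z + 2)\<^sup>2" by (simp only: abs_le_square_iff)
      also have "\<dots> \<le> (dist centre v)\<^sup>2" unfolding dist_centre v by simp
      finally show ?thesis by (rule power2_le_imp_le) simp
    qed
    have near: "nsq v \<le> far R"
    proof -
      have mb: "(m i z)\<^sup>2 \<le> (P $ i)\<^sup>2" for i
        unfolding m power_mult_distrib using step_bounds[of "\<sigma> * z - (R + 3)"]
        by (intro mult_left_le_one_le) (auto simp: power_le_one)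
      have "(P$1)\<^sup>2 + (P$2)\<^sup>2 \<le> (R + 1)\<^sup>2" unfolding P[symmetric] dist_centre by simp
      also have "\<dots> \<le> (R + 4)\<^sup>2" using R by (intro power_mono) auto
      finally have "(m 1 z)\<^sup>2 + (m 2 z)\<^sup>2 \<le> (R + 4)\<^sup>2" using mb[of 1] mb[of 2] by linarith
      moreover have "z\<^sup>2 \<le> (R + 4)\<^sup>2" using z R by (subst abs_le_square_iff[symmetric]) auto
      ultimately show ?thesis by (simp add: nsq_def far_def v)
    qed
    show "ext_field p R U D \<omega> (stereo_inv (vector [m 1 z, m 2 z, z])) = sphere_push (stereo_inv (vector [m 1 z, m 2 z, z]))
        (vector [(1 + z\<^sup>2) * \<mu> 1 z, (1 + z\<^sup>2) * \<mu> 2 z, 1 + z\<^sup>2])"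
      using ext_field_near[of R v p U D \<omega>] core_far[OF _ far, of p U D] near R
      by (simp only: v v_def[symmetric] sh \<mu>_def)
  qed
qed

lemma conn_upper:
  assumes R: "R > 1" and U: "dist centre U = R + 1" "U $ 3 > -1"
  shows "conn (ext_field p R U D \<omega>) (sphere 0 1) (stereo_inv U) (stereo_inv (vector [0, 0, R + 4]))"
proof -
  define m where "m i z = (1 - step (1 * z - (R + 3))) * U $ i" for i z
  have z0: "U $ 3 \<le> R + 3" using cball_centre_bounds(4)[of U R] U R by simp
  have "conn (ext_field p R U D \<omega>) (sphere 0 1) (stereo_inv (vector [m 1 (U$3), m 2 (U$3), U$3]))
     (stereo_inv (vector [m 1 (R + 4), m 2 (R + 4), R + 4]))"
  proof (rule conn_shear[OF R U(1) _ _ m_def])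
    show "shear R (U $ i) (D $ i) z = - 1 * step' (1 * z - (R + 3)) * U $ i" if "z \<in> {U$3..R + 4}" for i z
      using that U R step'_eq_0[of "- z - (R + 3)"] by (simp add: shear_def)
  qed (use z0 U R in auto)
  moreover have "vector [m 1 (U$3), m 2 (U$3), U$3] = U"
    using z0 by (intro vec3_eqI) (simp_all add: m_def step_eq_0)
  moreover have "m i (R + 4) = 0" for i by (simp add: m_def step_eq_1)
  ultimately show ?thesis by simp
qed

lemma conn_lower:
  assumes R: "R > 1" and D: "dist centre D = R + 1" "D $ 3 < -2"
  shows "conn (ext_field p R U D \<omega>) (sphere 0 1) (stereo_inv (vector [0, 0, - (R + 4)])) (stereo_inv D)"
proof -
  define m where "m i z = (1 - step (- 1 * z - (R + 3))) * D $ i" for i z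
  have z1: "- (R + 3) \<le> D $ 3" using cball_centre_bounds(4)[of D R] D R by simp
  have "conn (ext_field p R U D \<omega>) (sphere 0 1) (stereo_inv (vector [m 1 (- (R + 4)), m 2 (- (R + 4)), - (R + 4)]))
     (stereo_inv (vector [m 1 (D$3), m 2 (D$3), D$3]))"
  proof (rule conn_shear[OF R D(1) _ _ m_def])
    show "shear R (U $ i) (D $ i) z = - (- 1) * step' (- 1 * z - (R + 3)) * D $ i" if "z \<in> {- (R + 4)..D$3}" for i z
      using that D R step'_eq_0[of "z - (R + 3)"] by (simp add: shear_def)
  qed (use z1 D R in auto)
  moreover have "vector [m 1 (D$3), m 2 (D$3), D$3] = D"
    using z1 by (intro vec3_eqI) (simp_all add: m_def step_eq_0)
  moreover have "m i (- (R + 4)) = 0" for i by (simp add: m_def step_eq_1)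
  ultimately show ?thesis by simp
qed

text \<open>The great circle through both poles, parametrised so that \<open>t\<close> corresponds
  to height \<open>tan t\<close> on the third axis; hence the doubled angle, and infinity at
  \<open>pi / 2\<close>.\<close>

definition axis_circle :: "real \<Rightarrow> real^4" where
  "axis_circle t = vector [0, 0, sin (2 * t), - cos (2 * t)]"

lemma axis_circle_stereo:
  assumes "cos t \<noteq> 0"
  shows "axis_circle t = stereo_inv (vector [0, 0, tan t])"
proof -
  have n: "nsq (vector [0, 0, tan t]) + 1 = inverse ((cos t)\<^sup>2)" "nsq (vector [0, 0, tan t]) - 1 = ((sin t)\<^sup>2 - (cos t)\<^sup>2) * inverse ((cos t)\<^sup>2)"
    using tan_sec[OF assms] assms by (simp_all add: nsq_def power_inverse tan_def power_divide field_simps)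
  have "2 * tan t / inverse ((cos t)\<^sup>2) = sin (2 * t)"
    unfolding sin_double using assms by (simp add: tan_def power2_eq_square field_simps)
  moreover have "((sin t)\<^sup>2 - (cos t)\<^sup>2) * inverse ((cos t)\<^sup>2) / inverse ((cos t)\<^sup>2) = - cos (2 * t)"
    unfolding cos_double using assms by (simp add: field_simps)
  ultimately show ?thesis
    by (intro vec4_eqI) (simp_all only: stereo_inv_nth n, simp_all add: axis_circle_def)
qed

text \<open>On the axis beyond height \<open>R + 4\<close> the shear is over and \<open>core\<close>
  is \<open>(0, 0, 1 + z\<^sup>2)\<close>, the same as \<open>hopf_chart\<close>. Blending equal
  fields changes nothing, whatever the value of \<open>eta\<close>.\<close>

lemma axis_circle_solution:
  assumes R: "R > 1" and t: "cos t = 0 \<and> axis_circle t = north \<or> cos t \<noteq> 0 \<and> R + 4 \<le> \<bar>tan t\<bar>"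
  shows "axis_circle t \<in> sphere 0 1 \<and>
    (axis_circle has_vector_derivative ext_field p R U D \<omega> (axis_circle t)) (at t within S)"
proof
  let ?V = "ext_field p R U D \<omega>"
  show "axis_circle t \<in> sphere 0 1"
    unfolding sphere_4_iff axis_circle_def by simp
  have d: "(axis_circle has_vector_derivative hopf \<omega> (axis_circle t)) (at t within S)"
  proof (rule has_vector_derivative_vec)
    fix i :: 4
    consider "i = 1" | "i = 2" | "i = 3" | "i = 4" using exhaust_4 by blast
    then show "((\<lambda>t. axis_circle t $ i) has_vector_derivative hopf \<omega> (axis_circle t) $ i) (at t within S)"
      unfolding has_real_derivative_iff_has_vector_derivative[symmetric]
      by cases (auto simp: axis_circle_def hopf_def intro!: derivative_eq_intros)
  qed
  have "?V (axis_circle t) = hopf \<omega> (axis_circle t)"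
  proof (cases "cos t = 0")
    case True
    then have n: "axis_circle t = north" using t by simp
    have "north $ 4 = 1" by (simp add: north_def)
    then show ?thesis unfolding n ext_field_def using eta_north[of R] R by simp
  next
    case False
    define z where "z = tan t"
    have z: "R + 4 \<le> \<bar>z\<bar>" using False t by (simp add: z_def)
    define v :: "real^3" where "v = vector [0, 0, z]"
    have "(R + 1)\<^sup>2 \<le> (dist centre v)\<^sup>2"
      unfolding dist_centre using z R by (subst abs_le_square_iff[symmetric] | simp add: v_def)+
    then have far: "R + 1 \<le> dist centre v" by (rule power2_le_imp_le) simp
    have "shear R x y z = 0" for x y
    proof -
      have "step' (- z - (R + 3)) = 0" "step' (z - (R + 3)) = 0" using z R by (intro step'_eq_0; linarith)+
      then show ?thesis by (simp add: shear_def)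
    qed
    then have "core p R U D v = hopf_chart \<omega> v"
      using core_far[OF _ far, of p U D] R by (simp add: v_def hopf_chart_def)
    then have "?V (stereo_inv v) = hopf \<omega> (stereo_inv v)"
      using R by (simp add: ext_field_stereo hopf_stereo_inv flip: scaleR_left_distrib)
    then show ?thesis using axis_circle_stereo[OF False] by (simp add: v_def z_def)
  qed
  then show "(axis_circle has_vector_derivative ?V (axis_circle t)) (at t within S)"
    using d by simp
qed

lemma axis_circle_half_pi: "axis_circle (pi / 2) = north"
  by (simp add: axis_circle_def north_def)

lemma conn_axis:
  assumes R: "R > 1"
  shows "conn (ext_field p R U D \<omega>) (sphere 0 1) (stereo_inv (vector [0, 0, R + 4])) north"
    "conn (ext_field p R U D \<omega>) (sphere 0 1) north (stereo_inv (vector [0, 0, - (R + 4)]))"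
proof -
  let ?V = "ext_field p R U D \<omega>"
  define s where "s = arctan (R + 4)"
  have s: "0 < s" "s < pi / 2" "tan s = R + 4" "cos s > 0"
  proof -
    show 1: "0 < s" "s < pi / 2" "tan s = R + 4"
      using R arctan_ubound[of "R + 4"] by (simp_all add: s_def tan_arctan zero_less_arctan_iff)
    show "cos s > 0" using 1 by (intro cos_gt_zero)
  qed
  have big: "R + 4 \<le> tan t \<and> cos t > 0" if "s \<le> t" "t < pi / 2" for t
    using tan_mono_le[of s t] that s cos_gt_zero[of t] by simp
  have sol: "sol_on (?V) (sphere 0 1) {s..pi - s} axis_circle"
    unfolding sol_on_def
  proof (intro ballI axis_circle_solution R)
    fix t assume t: "t \<in> {s..pi - s}"
    consider "t = pi / 2" | "t < pi / 2" | "t > pi / 2" by linarith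
    then show "cos t = 0 \<and> axis_circle t = north \<or> cos t \<noteq> 0 \<and> R + 4 \<le> \<bar>tan t\<bar>"
    proof cases
      case 1
      show ?thesis unfolding 1 using axis_circle_half_pi by simp
    next
      case 2
      then show ?thesis using big[of t] t by auto
    next
      case 3
      then have "R + 4 \<le> tan (pi - t) \<and> cos (pi - t) > 0" using t by (intro big) auto
      moreover have "tan (pi - t) = - tan t" "cos (pi - t) = - cos t" by (simp_all add: tan_def)
      ultimately show ?thesis by auto
    qed
  qed
  have 1: "sol_on (?V) (sphere 0 1) {s..pi / 2} axis_circle"
    and 2: "sol_on (?V) (sphere 0 1) {pi / 2..pi - s} axis_circle"
    using s(1,2) by (auto intro!: sol_on_subset[OF sol])
  show "conn (?V) (sphere 0 1) (stereo_inv (vector [0, 0, R + 4])) north"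
    using connI[OF 1] s axis_circle_stereo[of s] by (simp add: axis_circle_half_pi)
  show "conn (?V) (sphere 0 1) north (stereo_inv (vector [0, 0, - (R + 4)]))"
    using connI[OF 2] s axis_circle_stereo[of "pi - s"] by (simp add: axis_circle_half_pi tan_def)
qed

section \<open>Assembly of the heteroclinic orbit\<close>

lemma bounded_left_half_line:
  fixes x :: "real \<Rightarrow> 'a::euclidean_space"
  assumes "continuous_on {..0} x" "(x \<longlongrightarrow> P) at_bot"
  obtains M where "\<And>t. t \<le> 0 \<Longrightarrow> norm (x t) \<le> M"
proof -
  have "\<forall>\<^sub>F t in at_bot. dist (x t) P < 1" using assms(2) by (rule tendstoD) simp
  then obtain N where N: "\<And>t. t \<le> N \<Longrightarrow> dist (x t) P < 1" unfolding eventually_at_bot_linorder by blast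
  have "bounded (x ` {N..0})"
    using assms(1) by (intro compact_imp_bounded compact_continuous_image) (auto elim: continuous_on_subset)
  then obtain K where K: "\<forall>v\<in>x ` {N..0}. norm v \<le> K" unfolding bounded_iff ..
  have "norm (x t) \<le> max K (norm P + 1)" if "t \<le> 0" for t
  proof (cases "t \<le> N")
    case True
    then have "norm (x t - P) < 1" using N[of t] by (simp add: dist_norm)
    then have "norm (x t) \<le> norm P + 1" using norm_triangle_sub[of "x t" P] by linarith
    then show ?thesis by simp
  next
    case False
    then have "norm (x t) \<le> K" using K that by simp
    then show ?thesis by simp
  qed
  then show thesis by (rule that)
qed

text \<open>The choices depend on each other in this order: the half orbits at the fixed points, the
  radius \<open>R\<close>, the exit points \<open>U\<close> and \<open>D\<close>, the rotation
  speed. Extended forwards from \<open>P_Out\<close> and backwards from \<open>P_In\<close>, the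
  half orbits meet at \<open>north\<close>.\<close>

lemma heteroclinic_extension:
  assumes g: "good_param p"
  shows "\<exists>V. smooth_vf_S3 V
      \<and> (\<forall>x\<in>ball P_In r. V (stereo_inv x) = frechet_derivative stereo_inv (at x) (roessler p x))
      \<and> {q\<in>sphere 0 1. V q = 0} = {stereo_inv P_In, stereo_inv (P_Out p)}
      \<and> (\<exists>\<gamma>. trajectory_S3 V \<gamma> \<and> (\<exists>t0. \<gamma> t0 = north)
           \<and> (((\<gamma> \<longlongrightarrow> stereo_inv (P_Out p)) at_bot \<and> (\<gamma> \<longlongrightarrow> stereo_inv P_In) at_top)
              \<or> ((\<gamma> \<longlongrightarrow> stereo_inv P_In) at_bot \<and> (\<gamma> \<longlongrightarrow> stereo_inv (P_Out p)) at_top)))"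
proof -
  obtain a b c where p: "p = (a, b, c)" by (cases p)
  note gp = good_param_fixpoints[OF g[unfolded p]]
  obtain \<mu> \<rho> \<omega>' x where x: "\<mu> > 0" "\<rho> < 0"
    "\<And>l. (l + a * b) * (l\<^sup>2 - a * l + 1) - (c / a) * (a - l) = (l - \<mu>) * ((l - \<rho>)\<^sup>2 + \<omega>'\<^sup>2)"
    "\<And>t. t \<le> 0 \<Longrightarrow> (x has_vector_derivative roessler (a, b, c) (x t)) (at t within {..0})"
    "(x \<longlongrightarrow> P_Out (a, b, c)) at_bot"
    "x 0 $ 3 + b > 0" "lyap_at (a, b, c) \<mu> \<rho> (x 0) > 0"
    using unstable_branch[OF g[unfolded p]] by metis
  obtain K where K: "K \<subseteq> stable_set (roessler (a, b, c)) P_In - {P_In}" "\<And>M. \<exists>v\<in>K. - (v$3) > M"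
    "\<And>v. v \<in> K \<Longrightarrow> v$1 < 0 \<and> v$2 > 0 \<and> v$3 < 0 \<and> v$2 < - (v$3)"
    using stable_branch[OF g[unfolded p]] by metis
  obtain b0 where b0: "b0 \<in> K" "- (b0$3) > 2" using K(2) by blast
  have "b0 \<in> stable_set (roessler (a, b, c)) P_In" using K(1) b0(1) by blast
  then obtain y where y: "y 0 = b0" "sol_on (roessler (a, b, c)) UNIV {0..} y" "(y \<longlongrightarrow> P_In) at_top"
    unfolding stable_set_iff by blast
  have "continuous_on {..0} x" using x(4) by (intro sol_continuous) auto
  then obtain M1 where M1: "\<And>t. t \<le> 0 \<Longrightarrow> norm (x t) \<le> M1" using bounded_left_half_line x(5) by blast
  have "continuous_on {0..} y" using sol_onD(2)[OF y(2)] by (rule sol_continuous)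
  then have "continuous_on {..0} (\<lambda>t. y (- t))"
    by (rule continuous_on_compose2) (auto intro!: continuous_intros)
  then obtain M2 where M2: "\<And>t. t \<le> 0 \<Longrightarrow> norm (y (- t)) \<le> M2"
    using bounded_left_half_line filterlim_compose[OF y(3) filterlim_uminus_at_top_at_bot] by blast
  \<comment> \<open>\<open>centre\<close> has norm 2, hence the summands 2: the ball of radius
    \<open>R\<close> around it contains both half orbits and the prescribed ball. The last entry is
    the bound required for the zeros.\<close>
  define R where "R = Max {M1 + 2, M2 + 2, r + 2, c + 2 * (c / a) + 2}"
  have R: "M1 + 2 \<le> R" "M2 + 2 \<le> R" "r + 2 \<le> R" "c + 2 * (c / a) + 2 \<le> R" by (simp_all add: R_def)
  have R1: "R > 1" using R(4) gp divide_pos_pos[of c a] by linarith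
  then have R0: "R > 0" by simp
  have xR: "x t \<in> cball centre R" if "t \<le> 0" for t
    using dist_centre_le[of "x t"] M1[OF that] R by simp
  have yR: "y t \<in> cball centre R" if "t \<ge> 0" for t
    using dist_centre_le[of "y t"] M2[of "- t"] that R by simp
  \<comment> \<open>The two zeros are placeholders: within radius \<open>R + 1\<close> the field is
    the same for all values of \<open>U\<close> and \<open>D\<close>.\<close>
  let ?G = "core (a, b, c) R 0 0"
  have coord: "elementary (\<lambda>v :: real^3. v $ i)" for i by (rule el_coord)
  obtain L where L: "L-lipschitz_on (cball centre (R + 1)) ?G"
    using elementary_lipschitz_vec[OF elementary_core[OF coord coord coord]] by blast
  have k: "0 \<le> 1 - chi R v \<and> 1 - chi R v \<le> 1 \<and> 0 \<le> chi R v * (1 + (v$3)\<^sup>2) \<and> 1 \<le> 1 - chi R v + chi R v * (1 + (v$3)\<^sup>2)" for v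
    using chi_bounds[of R v] mult_nonneg_nonneg[of "chi R v" "(v$3)\<^sup>2"] by (simp add: distrib_left)
  obtain u T where u: "u 0 = x 0" "T \<ge> 0" "dist centre (u T) = R + 1"
    "\<And>t. t \<in> {0..T} \<Longrightarrow> u t \<in> cball centre (R + 1) \<and> (u has_vector_derivative ?G (u t)) (at t within {0..T})
        \<and> u t $ 3 + b > 0 \<and> lyap_at (a, b, c) \<mu> \<rho> (u t) > 0"
  proof (rule reach_out[OF x(3,1) gp(4,6) _ L core_cball[OF _ R0] k])
    show "x 0 \<in> ball centre (R + 1)" using xR[of 0] by simp
  qed (use x gp in auto)
  obtain w S where w: "w 0 = b0" "S \<ge> 0" "dist centre (w S) = R + 1" "w S $ 3 < - 2"
    "\<And>t. t \<in> {0..S} \<Longrightarrow> w t \<in> cball centre (R + 1) \<and> (w has_vector_derivative - ?G (w t)) (at t within {0..S})"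
  proof (rule reach_in[OF gp(4,6-8) L core_cball[OF _ R0] k])
    show "b0 \<in> ball centre (R + 1)" using yR[of 0] y(1) by simp
  qed (use K(3)[OF b0(1)] b0 in auto)
  define U where "U = u T"
  define D where "D = w S"
  have U: "dist centre U = R + 1" "U $ 3 > -1"
    using u(2,3) u(4)[of T] gp by (auto simp: U_def)
  have D: "dist centre D = R + 1" "D $ 3 < -2" using w by (auto simp: D_def)
  obtain B where B: "B > 0" "\<And>t. \<bar>step' t\<bar> \<le> B" using step'_bounded by blast
  define \<omega> where "\<omega> = 4 * B * (R + 3) * sqrt (far R + 1) + 1"
  define V where "V = ext_field (a, b, c) R U D \<omega>"
  have ab: "\<bar>U $ i\<bar> \<le> R + 3" "\<bar>D $ i\<bar> \<le> R + 3" for i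
    using cball_centre_bounds[of U R] cball_centre_bounds[of D R] U D R0 exhaust_3[of i] by auto
  have V_core: "V (stereo_inv v) = sphere_push (stereo_inv v) (?G v)" if "v \<in> cball centre (R + 1)" for v
    unfolding V_def using cball_centre_bounds(5)[of v R] that R0 by (simp add: ext_field_near core_cball)
  have V_ball: "V (stereo_inv v) = sphere_push (stereo_inv v) (roessler (a, b, c) v)" if "v \<in> cball centre R" for v
    unfolding V_def using ext_field_ball[OF R0] that by simp
  have zeros: "{q\<in>sphere 0 1. V q = 0} = {stereo_inv P_In, stereo_inv (P_Out p)}"
    unfolding V_def p by (rule ext_field_zeros[OF g[unfolded p] R(4) B(2,1) ab]) (simp add: \<omega>_def)
  have agree: "V (stereo_inv v) = frechet_derivative stereo_inv (at v) (roessler p v)" if "v \<in> ball P_In r" for v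
  proof -
    have "P_In = 0" by (simp add: vec_eq_iff)
    then have "norm v < r" using that by simp
    then have "v \<in> cball centre R" using dist_centre_le[of v] R by simp
    then show ?thesis unfolding frechet_derivative_stereo_inv p by (rule V_ball)
  qed
  have "sol_on (roessler (a, b, c)) (cball centre R) {..0} x"
    using x(4) xR by (simp add: sol_on_def)
  from sol_on_stereo[OF this V_ball]
  have left: "sol_on V (sphere 0 1) {..0} (\<lambda>t. stereo_inv (x t))" .
  have "sol_on (roessler (a, b, c)) (cball centre R) {0..} y"
    using sol_onD(2)[OF y(2)] yR by (simp add: sol_on_def)
  from sol_on_stereo[OF this V_ball]
  have right: "sol_on V (sphere 0 1) {0..} (\<lambda>t. stereo_inv (y t))" .
  have "sol_on ?G (cball centre (R + 1)) {0..T} u" using u(4) by (simp add: sol_on_def)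
  from connI[OF sol_on_stereo[OF this V_core] u(2)]
  have c1: "conn V (sphere 0 1) (stereo_inv (x 0)) (stereo_inv U)" by (simp only: u(1) U_def)
  have "sol_on (\<lambda>v. - ?G v) (cball centre (R + 1)) {0..S} w" using w(5) by (simp add: sol_on_def)
  from connI[OF sol_on_stereo[OF sol_on_reverse[OF this] V_core] w(2)]
  have c2: "conn V (sphere 0 1) (stereo_inv D) (stereo_inv (y 0))" by (simp add: w(1) y(1) D_def)
  note c3 = conn_upper[OF R1 U, of "(a, b, c)" D \<omega>, folded V_def]
  note c4 = conn_lower[OF R1 D, of "(a, b, c)" U \<omega>, folded V_def]
  note c5 = conn_axis[OF R1, of "(a, b, c)" U D \<omega>, folded V_def]
  obtain g1 where g1: "sol_on V (sphere 0 1) {..0} g1" "g1 0 = stereo_inv U" "(g1 \<longlongrightarrow> stereo_inv (P_Out p)) at_bot"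
    using extend_left[OF left refl _ c1] stereo_inv_tendsto[OF x(5)] unfolding p by metis
  obtain g2 where g2: "sol_on V (sphere 0 1) {..0} g2" "g2 0 = stereo_inv (vector [0, 0, R + 4])" "(g2 \<longlongrightarrow> stereo_inv (P_Out p)) at_bot"
    by (rule extend_left[OF g1 c3])
  obtain g3 where g3: "sol_on V (sphere 0 1) {..0} g3" "g3 0 = north" "(g3 \<longlongrightarrow> stereo_inv (P_Out p)) at_bot"
    by (rule extend_left[OF g2 c5(1)])
  obtain h1 where h1: "sol_on V (sphere 0 1) {0..} h1" "h1 0 = stereo_inv D" "(h1 \<longlongrightarrow> stereo_inv P_In) at_top"
    by (rule extend_right[OF right refl stereo_inv_tendsto[OF y(3)] c2])
  obtain h2 where h2: "sol_on V (sphere 0 1) {0..} h2" "h2 0 = stereo_inv (vector [0, 0, - (R + 4)])" "(h2 \<longlongrightarrow> stereo_inv P_In) at_top"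
    by (rule extend_right[OF h1 c4])
  obtain h3 where h3: "sol_on V (sphere 0 1) {0..} h3" "h3 0 = north" "(h3 \<longlongrightarrow> stereo_inv P_In) at_top"
    by (rule extend_right[OF h2 c5(2)])
  obtain \<Gamma> where \<Gamma>: "\<And>t. \<Gamma> t \<in> sphere 0 1 \<and> (\<Gamma> has_vector_derivative V (\<Gamma> t)) (at t)" "\<Gamma> 0 = north"
    "(\<Gamma> \<longlongrightarrow> stereo_inv (P_Out p)) at_bot" "(\<Gamma> \<longlongrightarrow> stereo_inv P_In) at_top"
  proof (rule sol_on_line[OF g3(1,3) h3(1,3) g3(2) h3(2)])
  qed (rule that; simp)
  have smooth: "smooth_vf_S3 V" unfolding V_def by (rule smooth_ext_field[OF R0])
  have "trajectory_S3 V \<Gamma>" unfolding trajectory_S3_def using \<Gamma>(1) by (intro allI)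
  then show ?thesis using smooth agree zeros \<Gamma>(2-4) by (intro exI[of _ V] conjI ballI exI[of _ \<Gamma>] exI[of _ 0] disjI1)
qed

theorem theorem2p1:
  fixes P :: "(real \<times> real \<times> real) set" and p :: "real \<times> real \<times> real"
  assumes "open P"
    and "\<forall>q\<in>P. good_param q"
    and "p \<in> P"
  shows "(\<exists>x\<in>stable_set (roessler p) P_In - {P_In}.
            \<not> bounded (connected_component_set (stable_set (roessler p) P_In - {P_In}) x))
       \<and> (\<exists>x\<in>unstable_set (roessler p) (P_Out p) - {P_Out p}.
            \<not> bounded (connected_component_set (unstable_set (roessler p) (P_Out p) - {P_Out p}) x))
       \<and> (\<exists>r0>0. \<forall>r>r0. \<exists>V. smooth_vf_S3 V
            \<and> (\<forall>x\<in>ball P_In r. V (stereo_inv x) = frechet_derivative stereo_inv (at x) (roessler p x))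
            \<and> {q\<in>sphere 0 1. V q = 0} = {stereo_inv P_In, stereo_inv (P_Out p)}
            \<and> (\<exists>\<gamma>. trajectory_S3 V \<gamma> \<and> (\<exists>t0. \<gamma> t0 = north)
                 \<and> (((\<gamma> \<longlongrightarrow> stereo_inv (P_Out p)) at_bot \<and> (\<gamma> \<longlongrightarrow> stereo_inv P_In) at_top)
                    \<or> ((\<gamma> \<longlongrightarrow> stereo_inv P_In) at_bot \<and> (\<gamma> \<longlongrightarrow> stereo_inv (P_Out p)) at_top))))"
proof -
  have g: "good_param p" using assms by blast
  show ?thesis
    \<comment> \<open>The extension is available for every \<open>r\<close>, so any positive
      threshold serves; 1 is taken.\<close>
    by (intro conjI stable_component_unbounded unstable_component_unbounded heteroclinic_extension g
        exI[of _ 1] allI impI zero_less_one)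
qed

end
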